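(* Let $Z^{H,q}=\{Z^{H,q}_t,\,t\in\mathbb{R}\}$ be the Hermite process of order $q\ge1$ ($q$ an integer) and self-similarity parameter $H\in(\frac12,1)$. Then the Malliavin derivative of $Z^{H,q}$ inherits both stationarity of increments and self-similarity: for all $a\in\mathbb{R}$ and $c>0$, $$\Big(\langle DZ^{H,q}_{s+a}-DZ^{H,q}_{a},\,DZ^{H,q}_{t+a}-DZ^{H,q}_{a}\rangle_{\mathfrak{H}}\Big)_{s,t\in\mathbb{R}}\;\overset{\text{law}}{=}\;\Big(\langle DZ^{H,q}_{s},\,DZ^{H,q}_{t}\rangle_{\mathfrak{H}}\Big)_{s,t\in\mathbb{R}},$$ and $$\Big(\langle DZ^{H,q}_{cs},\,DZ^{H,q}_{ct}\rangle_{\mathfrak{H}}\Big)_{s,t\in\mathbb{R}}\;\overset{\text{law}}{=}\;c^{2H}\Big(\langle DZ^{H,q}_{s},\,DZ^{H,q}_{t}\rangle_{\mathfrak{H}}\Big)_{s,t\in\mathbb{R}}.$$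
   Context: Let $B=\{B(t),\,t\in\mathbb{R}\}$ be a two-sided standard Brownian motion with $B(0)=0$ on a complete probability space $(\Omega,\mathcal{F},\mathbb{P})$. Let $\mathfrak{H}=L^2(\mathbb{R})$ (real-valued functions), and for $h\in\mathfrak{H}$ let $B(h)=\int_{\mathbb{R}}h(t)\,dB(t)$ be the Wiener integral, so that $\{B(h)\}$ is a centred Gaussian family with $\mathbb{E}[B(h)B(g)]=\langle h,g\rangle_{\mathfrak{H}}$. Hermite polynomials: $H_0(x)=1$, $H_1(x)=x$, $H_{q+1}(x)=xH_q(x)-qH_{q-1}(x)$. For $q\ge1$, the multiple Wiener--Itô integral $I_q$ of order $q$ is the linear map from the space $\mathfrak{H}^{\odot q}$ of symmetric functions in $L^2(\mathbb{R}^q)$ to $L^2(\Omega)$ determined by $I_q(h^{\otimes q})=H_q(B(h))$ for $\|h\|_{\mathfrak{H}}=1$, extended by linearity, polarization and density; it satisfies $\mathbb{E}[I_q(f)I_q(g)]=q!\,\langle f,g\rangle_{L^2(\mathbb{R}^q)}$. Hermite process: for an integer $q\ge1$ and $H\in(\frac12,1)$, the Hermite process of order $q$ and self-similarity parameter $H$ is $Z_t^{H,q}=I_q(L_t^{H,q})$, $t\in\mathbb{R}$, where $$L_t^{H,q}(\xi_1,\dots,\xi_q)=c(H,q)\int_0^t\prod_{j=1}^q(s-\xi_j)_+^{H_0-\frac32}\,ds,\qquad H_0=1+\frac{H-1}{q},$$ $$c(H,q)=\sqrt{\frac{H(2H-1)}{q!\,\beta(H_0-\frac12,\,2-2H_0)^q}},$$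 $\beta$ is the Beta function, $\theta_+^\alpha=\theta^\alpha$ if $\theta>0$ and $0$ otherwise, and $\int_0^t=-\int_t^0$ when $t<0$. Malliavin derivative: for $F=f(B(g_1),\dots,B(g_n))$ with $g_i\in\mathfrak{H}$ and $f$ smooth with all derivatives of polynomial growth, $D_rF=\sum_{j=1}^n\frac{\partial f}{\partial x_j}(B(g_1),\dots,B(g_n))\,g_j(r)$, $r\in\mathbb{R}$; $D$ is extended by closure to $\mathbb{D}^{1,p}$, the completion of such variables under $\|F\|_{1,p}^p=\mathbb{E}[|F|^p]+\mathbb{E}[\|DF\|_{\mathfrak{H}}^p]$. Each $Z^{H,q}_t$ belongs to $\mathbb{D}^{1,2}$, and $\langle DF,DG\rangle_{\mathfrak{H}}=\int_{\mathbb{R}}D_rF\,D_rG\,dr$. The notation $\overset{\text{law}}{=}$ between two-parameter processes indexed by $(s,t)\in\mathbb{R}^2$ means equality of all finite-dimensional distributions. *)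

theory Defs
  imports "HOL-Probability.Probability"
begin

definition sq_integrable :: "'b measure \<Rightarrow> ('b \<Rightarrow> real) \<Rightarrow> bool" where
  "sq_integrable N f \<longleftrightarrow> f \<in> borel_measurable N \<and> integrable N (\<lambda>x. (f x)\<^sup>2)"

definition L2_converges :: "'b measure \<Rightarrow> (nat \<Rightarrow> 'b \<Rightarrow> real) \<Rightarrow> ('b \<Rightarrow> real) \<Rightarrow> bool" where
  "L2_converges N fs f \<longleftrightarrow>
     (\<forall>n. sq_integrable N (fs n)) \<and> sq_integrable N f \<and>
     (\<lambda>n. \<integral>x. (fs n x - f x)\<^sup>2 \<partial>N) \<longlonglongrightarrow> 0"

locale two_sided_brownian_motion = prob_space M
  for M :: "'a measure" +
  fixes B :: "real \<Rightarrow> 'a \<Rightarrow> real"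
  assumes BM_measurable: "B t \<in> borel_measurable M"
    and BM_zero: "AE \<omega> in M. B 0 \<omega> = 0"
    and BM_increments:
      "s < t \<Longrightarrow>
         distributed M lborel (\<lambda>\<omega>. B t \<omega> - B s \<omega>) (normal_density 0 (sqrt (t - s)))"
    and BM_independent:
      "(\<And>i. i < n \<Longrightarrow> \<tau> i < \<tau> (Suc i)) \<Longrightarrow>
         indep_vars (\<lambda>_. borel) (\<lambda>i \<omega>. B (\<tau> (Suc i)) \<omega> - B (\<tau> i) \<omega>) {..<(n::nat)}"
    and BM_continuous: "AE \<omega> in M. continuous_on UNIV (\<lambda>t. B t \<omega>)"

definition step_integral ::
  "(real \<Rightarrow> 'a \<Rightarrow> real) \<Rightarrow> (real \<Rightarrow> real) \<Rightarrow> ('a \<Rightarrow> real) \<Rightarrow> bool" where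
  "step_integral B h X \<longleftrightarrow>
     (\<exists>(n::nat) c a b. (\<forall>i<n. a i \<le> b i) \<and>
        h = (\<lambda>r. \<Sum>i<n. c i * indicator {a i<..b i} r) \<and>
        X = (\<lambda>\<omega>. \<Sum>i<n. c i * (B (b i) \<omega> - B (a i) \<omega>)))"

text \<open>
  Stochastic integrals are determined only up to null sets, so they are introduced as
  relations: \<open>is_wiener_integral M B h X\<close> says that \<open>X\<close> is a version of \<open>B(h)\<close>, and
  \<open>is_multiple_integral M B q f X\<close> below that \<open>X\<close> is a version of \<open>I\<^sub>q(f)\<close>.
\<close>

definition is_wiener_integral ::
  "'a measure \<Rightarrow> (real \<Rightarrow> 'a \<Rightarrow> real) \<Rightarrow> (real \<Rightarrow> real) \<Rightarrow> ('a \<Rightarrow> real) \<Rightarrow> bool" where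
  "is_wiener_integral M B h X \<longleftrightarrow>
     (\<exists>hs Xs. (\<forall>n. step_integral B (hs n) (Xs n)) \<and>
        L2_converges lborel hs h \<and> L2_converges M Xs X)"

fun hermite_poly :: "nat \<Rightarrow> real \<Rightarrow> real" where
  "hermite_poly 0 x = 1"
| "hermite_poly (Suc 0) x = x"
| "hermite_poly (Suc (Suc n)) x =
     x * hermite_poly (Suc n) x - real (Suc n) * hermite_poly n x"

text \<open>Points of \<open>\<real>\<^sup>q\<close> are functions on the index set \<open>{..<q}\<close>.\<close>

abbreviation lborel_pow :: "nat \<Rightarrow> (nat \<Rightarrow> real) measure" where
  "lborel_pow q \<equiv> (\<Pi>\<^sub>M j\<in>{..<q}. lborel)"

definition tensor_power :: "nat \<Rightarrow> (real \<Rightarrow> real) \<Rightarrow> (nat \<Rightarrow> real) \<Rightarrow> real" where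
  "tensor_power q h \<xi> = (\<Prod>j<q. h (\<xi> j))"

definition symmetric_fun :: "nat \<Rightarrow> ((nat \<Rightarrow> real) \<Rightarrow> real) \<Rightarrow> bool" where
  "symmetric_fun q f \<longleftrightarrow>
     (\<forall>\<sigma>. \<sigma> permutes {..<q} \<longrightarrow> (AE \<xi> in lborel_pow q. f (\<xi> \<circ> \<sigma>) = f \<xi>))"

text \<open>The integral on the linear span of the tensor powers of unit vectors.\<close>

definition elementary_multiple_integral ::
  "'a measure \<Rightarrow> (real \<Rightarrow> 'a \<Rightarrow> real) \<Rightarrow> nat \<Rightarrow>
     ((nat \<Rightarrow> real) \<Rightarrow> real) \<Rightarrow> ('a \<Rightarrow> real) \<Rightarrow> bool" where
  "elementary_multiple_integral M B q f X \<longleftrightarrow>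
     (\<exists>(m::nat) c h W.
        (\<forall>i<m. is_wiener_integral M B (h i) (W i) \<and> (\<integral>r. (h i r)\<^sup>2 \<partial>lborel) = 1) \<and>
        f = (\<lambda>\<xi>. \<Sum>i<m. c i * tensor_power q (h i) \<xi>) \<and>
        X = (\<lambda>\<omega>. \<Sum>i<m. c i * hermite_poly q (W i \<omega>)))"

definition is_multiple_integral ::
  "'a measure \<Rightarrow> (real \<Rightarrow> 'a \<Rightarrow> real) \<Rightarrow> nat \<Rightarrow>
     ((nat \<Rightarrow> real) \<Rightarrow> real) \<Rightarrow> ('a \<Rightarrow> real) \<Rightarrow> bool" where
  "is_multiple_integral M B q f X \<longleftrightarrow>
     symmetric_fun q f \<and>
     (\<exists>fs Xs. (\<forall>n. elementary_multiple_integral M B q (fs n) (Xs n)) \<and>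
        L2_converges (lborel_pow q) fs f \<and> L2_converges M Xs X)"

definition hermite_H0 :: "real \<Rightarrow> nat \<Rightarrow> real" where
  "hermite_H0 H q = 1 + (H - 1) / real q"

definition hermite_const :: "real \<Rightarrow> nat \<Rightarrow> real" where
  "hermite_const H q =
     sqrt (H * (2 * H - 1) /
       (fact q * Beta (hermite_H0 H q - 1/2) (2 - 2 * hermite_H0 H q) ^ q))"

definition pos_powr :: "real \<Rightarrow> real \<Rightarrow> real" where
  "pos_powr \<theta> \<alpha> = (if \<theta> > 0 then \<theta> powr \<alpha> else 0)"

text \<open>The interval integral is oriented: it changes sign when \<open>t < 0\<close>.\<close>

definition hermite_kernel :: "real \<Rightarrow> nat \<Rightarrow> real \<Rightarrow> (nat \<Rightarrow> real) \<Rightarrow> real" where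
  "hermite_kernel H q t \<xi> =
     hermite_const H q *
       (LBINT s=ereal 0..ereal t. (\<Prod>j<q. pos_powr (s - \<xi> j) (hermite_H0 H q - 3/2)))"

definition is_hermite_process ::
  "'a measure \<Rightarrow> (real \<Rightarrow> 'a \<Rightarrow> real) \<Rightarrow> real \<Rightarrow> nat \<Rightarrow> (real \<Rightarrow> 'a \<Rightarrow> real) \<Rightarrow> bool" where
  "is_hermite_process M B H q Z \<longleftrightarrow>
     (\<forall>t. is_multiple_integral M B q (hermite_kernel H q t) (Z t))"

definition partial_deriv :: "nat \<Rightarrow> ((nat \<Rightarrow> real) \<Rightarrow> real) \<Rightarrow> (nat \<Rightarrow> real) \<Rightarrow> real" where
  "partial_deriv i f x = deriv (\<lambda>u. f (x(i := u))) (x i)"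

text \<open>
  A function on \<open>\<real>\<^sup>n\<close> is represented by a function of sequences that depends on the first
  \<open>n\<close> coordinates only; continuity in the product topology is then continuity on \<open>\<real>\<^sup>n\<close>.
  The list \<open>is\<close> runs through all iterated partial derivatives, including \<open>f\<close> itself.
\<close>

definition smooth_poly_growth :: "nat \<Rightarrow> ((nat \<Rightarrow> real) \<Rightarrow> real) \<Rightarrow> bool" where
  "smooth_poly_growth n f \<longleftrightarrow>
     (\<forall>x y. (\<forall>i<n. x i = y i) \<longrightarrow> f x = f y) \<and>
     (\<forall>is. set is \<subseteq> {..<n} \<longrightarrow>
        (let g = fold partial_deriv is f in
           continuous_on UNIV g \<and>
           (\<forall>i<n. \<forall>x. (\<lambda>u. g (x(i := u))) differentiable (at (x i))) \<and>
           (\<exists>C (k::nat). \<forall>x. \<bar>g x\<bar> \<le> C * (1 + (\<Sum>i<n. \<bar>x i\<bar>)) ^ k)))"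

definition smooth_functional ::
  "'a measure \<Rightarrow> (real \<Rightarrow> 'a \<Rightarrow> real) \<Rightarrow> ('a \<Rightarrow> real) \<Rightarrow> ('a \<Rightarrow> real \<Rightarrow> real) \<Rightarrow> bool" where
  "smooth_functional M B F DF \<longleftrightarrow>
     (\<exists>(n::nat) f g W.
        smooth_poly_growth n f \<and> (\<forall>i<n. is_wiener_integral M B (g i) (W i)) \<and>
        F = (\<lambda>\<omega>. f (\<lambda>i. W i \<omega>)) \<and>
        DF = (\<lambda>\<omega> r. \<Sum>j<n. partial_deriv j f (\<lambda>i. W i \<omega>) * g j r))"

text \<open>
  The closure in \<open>\<D>\<^sup>1\<^sup>,\<^sup>2\<close>, with \<open>L\<^sup>2(\<Omega>; L\<^sup>2(\<real>))\<close> identified with \<open>L\<^sup>2(\<Omega> \<times> \<real>)\<close>.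
\<close>

definition has_malliavin_derivative ::
  "'a measure \<Rightarrow> (real \<Rightarrow> 'a \<Rightarrow> real) \<Rightarrow> ('a \<Rightarrow> real) \<Rightarrow> ('a \<Rightarrow> real \<Rightarrow> real) \<Rightarrow> bool" where
  "has_malliavin_derivative M B F u \<longleftrightarrow>
     (\<exists>Fs us. (\<forall>n. smooth_functional M B (Fs n) (us n)) \<and>
        L2_converges M Fs F \<and>
        L2_converges (M \<Otimes>\<^sub>M lborel) (\<lambda>n. case_prod (us n)) (case_prod u))"

text \<open>A version of \<open>DF\<close>; it is unique almost everywhere because the operator is closable.\<close>

definition malliavin_D ::
  "'a measure \<Rightarrow> (real \<Rightarrow> 'a \<Rightarrow> real) \<Rightarrow> ('a \<Rightarrow> real) \<Rightarrow> 'a \<Rightarrow> real \<Rightarrow> real" where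
  "malliavin_D M B F = (SOME u. has_malliavin_derivative M B F u)"

definition inner_H :: "(real \<Rightarrow> real) \<Rightarrow> (real \<Rightarrow> real) \<Rightarrow> real" where
  "inner_H u v = (\<integral>r. u r * v r \<partial>lborel)"

text \<open>
  Measurability is demanded explicitly: \<^const>\<open>distr\<close> along non-measurable maps is degenerate.
\<close>

definition equal_in_law ::
  "'a measure \<Rightarrow> ('i \<Rightarrow> 'a \<Rightarrow> real) \<Rightarrow> ('i \<Rightarrow> 'a \<Rightarrow> real) \<Rightarrow> bool" where
  "equal_in_law M X Y \<longleftrightarrow>
     (\<forall>i. X i \<in> borel_measurable M \<and> Y i \<in> borel_measurable M) \<and>
     (\<forall>J. finite J \<longrightarrow>
        distr M (\<Pi>\<^sub>M j\<in>J. borel) (\<lambda>\<omega>. \<lambda>j\<in>J. X j \<omega>) =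
        distr M (\<Pi>\<^sub>M j\<in>J. borel) (\<lambda>\<omega>. \<lambda>j\<in>J. Y j \<omega>))"

end

theory Submission
  imports Defs "HOL-Real_Asymp.Real_Asymp"
begin

text \<open>
  For \<open>c > 0\<close> and real \<open>a\<close> the process \<open>B'\<^sub>t = c powr (-1/2) * (B\<^sub>c\<^sub>t\<^sub>+\<^sub>a - B\<^sub>a)\<close> is again a Brownian motion
  (\<open>brownian_increments_affine\<close>).  Multiple integrals with respect to \<open>B\<close> become multiple integrals with
  respect to \<open>B'\<close> when the kernel is composed with \<open>r \<mapsto> c r + a\<close> in each variable and normalised, and
  derivatives follow the same rule (\<open>chaos_affine\<close>).  The substitution \<open>s \<mapsto> c s + a\<close> in the kernel of the
  Hermite process (\<open>hermite_kernel_affine\<close>) then shows that \<open>t \<mapsto> Z\<^sub>c\<^sub>t\<^sub>+\<^sub>a - Z\<^sub>a\<close> is \<open>c powr H\<close> times the Hermite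
  process driven by \<open>B'\<close>.  The inner product over the line is invariant under the same substitution, so
  the inner products of the derivatives of these increments are \<open>c powr (2 * H)\<close> times a functional of
  the path of \<open>B'\<close>, and this is the functional that yields the inner products of the derivatives of \<open>Z\<close>
  from the path of \<open>B\<close>.  Both paths have the same law (\<open>path_law_unique\<close>), which proves equality of the
  finite-dimensional distributions (\<open>malliavin_covariance_affine\<close>).  Stationarity is the case \<open>c = 1\<close>,
  self-similarity the case \<open>a = 0\<close>.

  The argument needs that multiple integrals and derivatives are determined almost surely, and by the
  path alone.  Both uniqueness statements rest on the Gaussian integration by parts formula
  \<open>E[V f(W)] = (\<Sum>j. \<langle>g\<^sub>j, h\<rangle> E[\<partial>\<^sub>j f(W)])\<close> for Wiener integrals \<open>W\<^sub>j\<close> of \<open>g\<^sub>j\<close> and \<open>V\<close> of \<open>h\<close>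
  (\<open>wiener_integration_by_parts\<close>).  It is obtained for step functions from the one-dimensional formula
  for independent normal increments, and carried to the limit by uniform moment bounds.

  Applied to Hermite polynomials, it gives \<open>E[H\<^sub>q(W) H\<^sub>q(V)] = q! \<langle>g, h\<rangle>\<^sup>q\<close> for
  kernels of norm one (\<open>hermite_covariance\<close>), hence
  the isometry between kernels, multiple integrals and derivatives (\<open>elementary_chaos_isometry\<close>): a
  multiple integral of order \<open>q\<close> has a derivative, and the kernel determines both.

  Applied to the product of a smooth functional \<open>F\<close> and a test functional \<open>G\<close>, it expresses
  \<open>E[G \<langle>DF, h\<rangle>]\<close> through \<open>F\<close> (\<open>malliavin_derivative_duality\<close>).  The derivative is therefore determined
  by its pairings with products of functions of path values and indicators of intervals
  (\<open>malliavin_derivative_unique\<close>).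

  Finally, an approximating sequence for a functional of \<open>B\<close> is a sequence of functions of the path, and
  evaluating these functions along \<open>B'\<close> gives the approximating sequence of the same functional of \<open>B'\<close>
  (\<open>chaos_transport\<close>).
\<close>

section \<open>Square-integrable functions\<close>

lemma sq_integrable_measurable: "sq_integrable N f \<Longrightarrow> f \<in> borel_measurable N"
  by (simp add: sq_integrable_def)

lemma sq_integrable_mult:
  assumes "sq_integrable N f" "sq_integrable N g"
  shows "integrable N (\<lambda>x. f x * g x)"
proof (rule Bochner_Integration.integrable_bound)
  show "integrable N (\<lambda>x. (f x)\<^sup>2 + (g x)\<^sup>2)"
    using assms by (auto simp: sq_integrable_def)
  show "(\<lambda>x. f x * g x) \<in> borel_measurable N"
    using assms by (auto simp: sq_integrable_def)
  have "\<bar>a * b\<bar> \<le> a\<^sup>2 + b\<^sup>2" for a b :: real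
  proof -
    have "2 * (\<bar>a\<bar> * \<bar>b\<bar>) \<le> a\<^sup>2 + b\<^sup>2" "0 \<le> \<bar>a\<bar> * \<bar>b\<bar>"
      using sum_squares_bound[of "\<bar>a\<bar>" "\<bar>b\<bar>"] by simp_all
    then show ?thesis unfolding abs_mult by linarith
  qed
  then show "AE x in N. norm (f x * g x) \<le> norm ((f x)\<^sup>2 + (g x)\<^sup>2)"
    by simp
qed

lemma sq_integrable_cmult:
  assumes "sq_integrable N f"
  shows "sq_integrable N (\<lambda>x. c * f x)"
  using assms by (auto simp: sq_integrable_def power_mult_distrib)

lemma sq_integrable_add:
  assumes "sq_integrable N f" "sq_integrable N g"
  shows "sq_integrable N (\<lambda>x. f x + g x)"
  using assms sq_integrable_mult[OF assms]
  by (auto simp: sq_integrable_def power2_sum mult.assoc)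

lemma sq_integrable_diff:
  assumes "sq_integrable N f" "sq_integrable N g"
  shows "sq_integrable N (\<lambda>x. f x - g x)"
  using sq_integrable_add[OF assms(1) sq_integrable_cmult[OF assms(2), of "-1"]] by simp

lemma sq_integrable_zero: "sq_integrable N (\<lambda>x. 0)"
  by (simp add: sq_integrable_def)

lemma sq_integrable_sum:
  assumes "\<And>i. i \<in> I \<Longrightarrow> sq_integrable N (f i)"
  shows "sq_integrable N (\<lambda>x. \<Sum>i\<in>I. f i x)"
  using assms
  by (induction I rule: infinite_finite_induct) (auto intro: sq_integrable_add sq_integrable_zero)

lemma integral_diff_square_expand:
  assumes "sq_integrable N f" "sq_integrable N g"
  shows "(\<integral>x. (f x - g x)\<^sup>2 \<partial>N) =
    (\<integral>x. (f x)\<^sup>2 \<partial>N) - 2 * (\<integral>x. f x * g x \<partial>N) + (\<integral>x. (g x)\<^sup>2 \<partial>N)"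
proof -
  have "(\<lambda>x. (f x - g x)\<^sup>2) = (\<lambda>x. ((f x)\<^sup>2 - 2 * (f x * g x)) + (g x)\<^sup>2)"
    by (auto simp: power2_diff)
  then show ?thesis
    using assms sq_integrable_mult[OF assms] by (simp add: sq_integrable_def)
qed

text \<open>
  The quadratic \<open>t \<mapsto> \<parallel>f - t g\<parallel>\<^sup>2\<close> is nonnegative, in particular at its
  minimum \<open>t = \<langle>f, g\<rangle> / \<parallel>g\<parallel>\<^sup>2\<close>; if \<open>\<parallel>g\<parallel> = 0\<close> it is affine, hence constant.
\<close>

lemma L2_Cauchy_Schwarz:
  assumes f: "sq_integrable N f" and g: "sq_integrable N g"
  shows "(\<integral>x. f x * g x \<partial>N)\<^sup>2 \<le> (\<integral>x. (f x)\<^sup>2 \<partial>N) * (\<integral>x. (g x)\<^sup>2 \<partial>N)"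
proof -
  let ?A = "\<integral>x. (f x)\<^sup>2 \<partial>N" and ?B = "\<integral>x. f x * g x \<partial>N" and ?C = "\<integral>x. (g x)\<^sup>2 \<partial>N"
  have q: "0 \<le> ?A - 2 * t * ?B + t\<^sup>2 * ?C" for t
  proof -
    have "0 \<le> (\<integral>x. (f x - t * g x)\<^sup>2 \<partial>N)" by simp
    also have "\<dots> = ?A - 2 * (\<integral>x. f x * (t * g x) \<partial>N) + (\<integral>x. (t * g x)\<^sup>2 \<partial>N)"
      by (rule integral_diff_square_expand[OF f sq_integrable_cmult[OF g]])
    finally show ?thesis
      by (simp add: power_mult_distrib mult.left_commute[of _ t])
  qed
  have C: "0 \<le> ?C" by simp
  show ?thesis
  proof (cases "?C = 0")
    case True
    have "?B = 0"
    proof (rule ccontr)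
      assume "?B \<noteq> 0"
      then show False using q[of "(?A + 1) / (2 * ?B)"] True by (simp add: field_simps)
    qed
    then show ?thesis using True by simp
  next
    case False
    with C have "?C > 0" by linarith
    with q[of "?B / ?C"] show ?thesis by (simp add: field_simps power2_eq_square)
  qed
qed

subsection \<open>Convergence in mean square\<close>

lemma L2_convergesD:
  assumes "L2_converges N fs f"
  shows "sq_integrable N (fs n)" "sq_integrable N f" "(\<lambda>n. \<integral>x. (fs n x - f x)\<^sup>2 \<partial>N) \<longlonglongrightarrow> 0"
  using assms by (auto simp: L2_converges_def)

lemma L2_convergesI:
  assumes "\<And>n. sq_integrable N (fs n)" "sq_integrable N f"
    "(\<lambda>n. \<integral>x. (fs n x - f x)\<^sup>2 \<partial>N) \<longlonglongrightarrow> 0"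
  shows "L2_converges N fs f"
  using assms by (auto simp: L2_converges_def)

lemma L2_converges_const: "sq_integrable N f \<Longrightarrow> L2_converges N (\<lambda>n. f) f"
  by (simp add: L2_converges_def)

lemma L2_converges_subseq:
  assumes "L2_converges N fs f" "strict_mono r"
  shows "L2_converges N (\<lambda>n. fs (r n)) f"
  using assms LIMSEQ_subseq_LIMSEQ[OF L2_convergesD(3)[OF assms(1)] assms(2)]
  by (auto simp: L2_converges_def o_def)

lemma integral_square_add_le:
  assumes "sq_integrable N f" "sq_integrable N g"
  shows "(\<integral>x. (f x + g x)\<^sup>2 \<partial>N) \<le> 2 * (\<integral>x. (f x)\<^sup>2 \<partial>N) + 2 * (\<integral>x. (g x)\<^sup>2 \<partial>N)"
proof -
  have le: "(a + b)\<^sup>2 \<le> 2 * a\<^sup>2 + 2 * b\<^sup>2" for a b :: real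
    using zero_le_power2[of "a - b"] by (simp add: power2_sum power2_diff)
  have "(\<integral>x. (f x + g x)\<^sup>2 \<partial>N) \<le> (\<integral>x. 2 * (f x)\<^sup>2 + 2 * (g x)\<^sup>2 \<partial>N)"
    using assms sq_integrable_add[OF assms]
    by (intro integral_mono le) (auto simp: sq_integrable_def)
  also have "\<dots> = 2 * (\<integral>x. (f x)\<^sup>2 \<partial>N) + 2 * (\<integral>x. (g x)\<^sup>2 \<partial>N)"
    using assms by (simp add: sq_integrable_def)
  finally show ?thesis .
qed

lemma L2_converges_add:
  assumes f: "L2_converges N fs f" and g: "L2_converges N gs g"
  shows "L2_converges N (\<lambda>n x. fs n x + gs n x) (\<lambda>x. f x + g x)"
proof (rule L2_convergesI)
  note F = L2_convergesD[OF f] and G = L2_convergesD[OF g]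
  show "sq_integrable N (\<lambda>x. fs n x + gs n x)" for n by (intro sq_integrable_add F G)
  show "sq_integrable N (\<lambda>x. f x + g x)" by (intro sq_integrable_add F G)
  have lim: "(\<lambda>n. 2 * (\<integral>x. (fs n x - f x)\<^sup>2 \<partial>N) + 2 * (\<integral>x. (gs n x - g x)\<^sup>2 \<partial>N)) \<longlonglongrightarrow> 2 * 0 + 2 * 0"
    by (intro tendsto_intros F G)
  show "(\<lambda>n. \<integral>x. (fs n x + gs n x - (f x + g x))\<^sup>2 \<partial>N) \<longlonglongrightarrow> 0"
  proof (rule tendsto_sandwich[OF _ _ tendsto_const])
    show "\<forall>\<^sub>F n in sequentially. (\<integral>x. (fs n x + gs n x - (f x + g x))\<^sup>2 \<partial>N)
       \<le> 2 * (\<integral>x. (fs n x - f x)\<^sup>2 \<partial>N) + 2 * (\<integral>x. (gs n x - g x)\<^sup>2 \<partial>N)"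
      using integral_square_add_le[OF sq_integrable_diff[OF F(1) F(2)] sq_integrable_diff[OF G(1) G(2)]]
      by (simp add: algebra_simps)
  qed (use lim in simp_all)
qed

lemma L2_converges_cmult:
  assumes f: "L2_converges N fs f"
  shows "L2_converges N (\<lambda>n x. c * fs n x) (\<lambda>x. c * f x)"
proof (rule L2_convergesI)
  note F = L2_convergesD[OF f]
  show "sq_integrable N (\<lambda>x. c * fs n x)" for n by (intro sq_integrable_cmult F)
  show "sq_integrable N (\<lambda>x. c * f x)" by (intro sq_integrable_cmult F)
  have "(\<lambda>n. c\<^sup>2 * (\<integral>x. (fs n x - f x)\<^sup>2 \<partial>N)) \<longlonglongrightarrow> c\<^sup>2 * 0"
    by (intro tendsto_intros F)
  moreover have "(\<integral>x. (c * fs n x - c * f x)\<^sup>2 \<partial>N) = c\<^sup>2 * (\<integral>x. (fs n x - f x)\<^sup>2 \<partial>N)" for n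
  proof -
    have "(\<lambda>x. (c * fs n x - c * f x)\<^sup>2) = (\<lambda>x. c\<^sup>2 * (fs n x - f x)\<^sup>2)"
      by (auto simp: power_mult_distrib right_diff_distrib[symmetric])
    then show ?thesis by simp
  qed
  ultimately show "(\<lambda>n. \<integral>x. (c * fs n x - c * f x)\<^sup>2 \<partial>N) \<longlonglongrightarrow> 0" by simp
qed

lemma L2_converges_diff:
  assumes f: "L2_converges N fs f" and g: "L2_converges N gs g"
  shows "L2_converges N (\<lambda>n x. fs n x - gs n x) (\<lambda>x. f x - g x)"
  using L2_converges_add[OF f L2_converges_cmult[OF g, of "-1"]] by simp

lemma L2_converges_square:
  assumes f: "L2_converges N fs f"
  shows "(\<lambda>n. \<integral>x. (fs n x)\<^sup>2 \<partial>N) \<longlonglongrightarrow> (\<integral>x. (f x)\<^sup>2 \<partial>N)"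
proof -
  note F = L2_convergesD[OF f]
  let ?d = "\<lambda>n. \<integral>x. (fs n x - f x)\<^sup>2 \<partial>N" and ?A = "\<integral>x. (f x)\<^sup>2 \<partial>N"
  have D: "sq_integrable N (\<lambda>x. fs n x - f x)" for n
    by (intro sq_integrable_diff F)
  have bound: "\<bar>(\<integral>x. (fs n x)\<^sup>2 \<partial>N) - ?A\<bar> \<le> ?d n + 2 * sqrt (?d n * ?A)" for n
  proof -
    have "(fs n x)\<^sup>2 = ((fs n x - f x)\<^sup>2 + 2 * ((fs n x - f x) * f x)) + (f x)\<^sup>2" for x
      by (simp add: power2_eq_square algebra_simps)
    then have "(\<integral>x. (fs n x)\<^sup>2 \<partial>N) =
        (\<integral>x. ((fs n x - f x)\<^sup>2 + 2 * ((fs n x - f x) * f x)) + (f x)\<^sup>2 \<partial>N)"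
      by (intro Bochner_Integration.integral_cong) auto
    also have "\<dots> = ?d n + 2 * (\<integral>x. (fs n x - f x) * f x \<partial>N) + ?A"
      using D[of n] F(2) sq_integrable_mult[OF D[of n] F(2)] by (simp add: sq_integrable_def)
    finally have "(\<integral>x. (fs n x)\<^sup>2 \<partial>N) = ?d n + 2 * (\<integral>x. (fs n x - f x) * f x \<partial>N) + ?A" .
    moreover have "\<bar>\<integral>x. (fs n x - f x) * f x \<partial>N\<bar> \<le> sqrt (?d n * ?A)"
      using L2_Cauchy_Schwarz[OF D[of n] F(2)]
      by (intro real_le_rsqrt) simp
    moreover have "0 \<le> ?d n" by simp
    ultimately show ?thesis by linarith
  qed
  have "(\<lambda>n. ?d n + 2 * sqrt (?d n * ?A)) \<longlonglongrightarrow> 0 + 2 * sqrt (0 * ?A)"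
    by (intro tendsto_add tendsto_mult tendsto_real_sqrt tendsto_const F(3))
  then have lim: "(\<lambda>n. ?d n + 2 * sqrt (?d n * ?A)) \<longlonglongrightarrow> 0" by simp
  have "(\<lambda>n. (\<integral>x. (fs n x)\<^sup>2 \<partial>N) - ?A) \<longlonglongrightarrow> 0"
    by (rule Lim_null_comparison[OF always_eventually lim]) (use bound in simp)
  then show ?thesis by (rule LIM_zero_cancel)
qed

text \<open>Polarisation carries the convergence of norms over to inner products.\<close>

lemma L2_converges_inner:
  assumes f: "L2_converges N fs f" and g: "L2_converges N gs g"
  shows "(\<lambda>n. \<integral>x. fs n x * gs n x \<partial>N) \<longlonglongrightarrow> (\<integral>x. f x * g x \<partial>N)"
proof -
  have pol: "(\<integral>x. u x * v x \<partial>N) =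
      ((\<integral>x. (u x)\<^sup>2 \<partial>N) + (\<integral>x. (v x)\<^sup>2 \<partial>N) - (\<integral>x. (u x - v x)\<^sup>2 \<partial>N)) / 2"
    if "sq_integrable N u" "sq_integrable N v" for u v
    using integral_diff_square_expand[OF that] by simp
  note F = L2_convergesD[OF f] and G = L2_convergesD[OF g]
  show ?thesis
    unfolding pol[OF F(1) G(1)] pol[OF F(2) G(2)]
    by (intro tendsto_intros L2_converges_square f g L2_converges_diff) simp
qed

lemma L2_converges_AE_subseq:
  assumes f: "L2_converges N fs f"
  shows "\<exists>r. strict_mono r \<and> (AE x in N. (\<lambda>n. fs (r n) x) \<longlonglongrightarrow> f x)"
proof -
  note F = L2_convergesD[OF f]
  have "integrable N (\<lambda>x. (fs n x - f x)\<^sup>2)" for n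
    using sq_integrable_diff[OF F(1) F(2)] by (simp add: sq_integrable_def)
  then obtain r where r: "strict_mono r" "AE x in N. (\<lambda>n. (fs (r n) x - f x)\<^sup>2) \<longlonglongrightarrow> 0"
    using tendsto_L1_AE_subseq[of N "\<lambda>n x. (fs n x - f x)\<^sup>2"] F(3) by auto
  have "(\<lambda>n. fs (r n) x) \<longlonglongrightarrow> f x" if "(\<lambda>n. (fs (r n) x - f x)\<^sup>2) \<longlonglongrightarrow> 0" for x
  proof -
    have "(\<lambda>n. sqrt ((fs (r n) x - f x)\<^sup>2)) \<longlonglongrightarrow> sqrt 0"
      by (intro tendsto_intros that)
    then show ?thesis
      by (simp add: tendsto_rabs_zero_iff LIM_zero_iff)
  qed
  with r show ?thesis by (intro exI[of _ r]) auto
qed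

lemma integral_square_eq_0_AE:
  assumes "sq_integrable N f" "(\<integral>x. (f x)\<^sup>2 \<partial>N) = 0"
  shows "AE x in N. f x = 0"
  using assms integral_nonneg_eq_0_iff_AE[of N "\<lambda>x. (f x)\<^sup>2"] by (simp add: sq_integrable_def)

lemma L2_limits_AE_eq:
  assumes f: "L2_converges N fs f" and g: "L2_converges N gs g"
    and "(\<lambda>n. \<integral>x. (fs n x - gs n x)\<^sup>2 \<partial>N) \<longlonglongrightarrow> 0"
  shows "AE x in N. f x = g x"
proof -
  have "(\<integral>x. (f x - g x)\<^sup>2 \<partial>N) = 0"
    using L2_converges_square[OF L2_converges_diff[OF f g]] assms(3) by (rule LIMSEQ_unique)
  with integral_square_eq_0_AE[OF sq_integrable_diff[OF L2_convergesD(2)[OF f] L2_convergesD(2)[OF g]]]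
  show ?thesis by simp
qed

lemma sq_integrable_cong_AE:
  assumes "sq_integrable N f" "g \<in> borel_measurable N" "AE x in N. f x = g x"
  shows "sq_integrable N g"
proof -
  have "integrable N (\<lambda>x. (f x)\<^sup>2) \<longleftrightarrow> integrable N (\<lambda>x. (g x)\<^sup>2)"
    using assms by (intro integrable_cong_AE) (auto simp: sq_integrable_def)
  then show ?thesis using assms by (auto simp: sq_integrable_def)
qed

lemma L2_converges_cong_AE:
  assumes f: "L2_converges N fs f"
    and "\<And>n. gs n \<in> borel_measurable N" "g \<in> borel_measurable N"
    and ae: "\<And>n. AE x in N. fs n x = gs n x" "AE x in N. f x = g x"
  shows "L2_converges N gs g"
proof (rule L2_convergesI)
  note F = L2_convergesD[OF f]
  show "sq_integrable N (gs n)" for n by (rule sq_integrable_cong_AE[OF F(1) assms(2) ae(1)])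
  show "sq_integrable N g" by (rule sq_integrable_cong_AE[OF F(2) assms(3) ae(2)])
  have "(\<integral>x. (gs n x - g x)\<^sup>2 \<partial>N) = (\<integral>x. (fs n x - f x)\<^sup>2 \<partial>N)" for n
    using ae(1)[of n] ae(2) assms(2,3) F(1,2)[THEN sq_integrable_measurable]
    by (intro integral_cong_AE) auto
  with F(3) show "(\<lambda>n. \<integral>x. (gs n x - g x)\<^sup>2 \<partial>N) \<longlonglongrightarrow> 0" by simp
qed

lemma sq_integrable_distr_iff:
  assumes "T \<in> measurable N Q" "f \<in> borel_measurable Q"
  shows "sq_integrable (distr N Q T) f \<longleftrightarrow> sq_integrable N (\<lambda>x. f (T x))"
  using assms by (simp add: sq_integrable_def integrable_distr_eq)

lemma L2_converges_distr_iff: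
  assumes T: "T \<in> measurable N Q" and "\<And>n. fs n \<in> borel_measurable Q" "f \<in> borel_measurable Q"
  shows "L2_converges (distr N Q T) fs f \<longleftrightarrow> L2_converges N (\<lambda>n x. fs n (T x)) (\<lambda>x. f (T x))"
  using assms by (simp add: L2_converges_def sq_integrable_distr_iff integral_distr)

subsection \<open>Completeness\<close>

text \<open>
  Along a subsequence whose consecutive squared distances are at most \<open>8\<^sup>-\<^sup>k\<close>, the series
  \<open>\<Sum>\<^sub>k 2\<^sup>k d\<^sub>k\<^sup>2\<close> of squared increments has finite integral.  Almost everywhere it is then finite,
  the increments decay geometrically, and the subsequence converges; Fatou's lemma identifies
  the pointwise limit as the limit in mean square.
\<close>

lemma L2_complete:
  fixes us :: "nat \<Rightarrow> 'b \<Rightarrow> real"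
  assumes sq: "\<And>n. sq_integrable N (us n)"
    and cauchy: "\<And>e. e > 0 \<Longrightarrow> \<exists>K. \<forall>m\<ge>K. \<forall>n\<ge>K. (\<integral>x. (us m x - us n x)\<^sup>2 \<partial>N) < e"
  shows "\<exists>u. L2_converges N us u"
proof -
  have meas[measurable]: "us n \<in> borel_measurable N" for n
    by (rule sq_integrable_measurable[OF sq])
  obtain K where K: "\<And>e m n. e > 0 \<Longrightarrow> m \<ge> K e \<Longrightarrow> n \<ge> K e \<Longrightarrow> (\<integral>x. (us m x - us n x)\<^sup>2 \<partial>N) < e"
  proof -
    have "\<forall>e. \<exists>K. e > 0 \<longrightarrow> (\<forall>m\<ge>K. \<forall>n\<ge>K. (\<integral>x. (us m x - us n x)\<^sup>2 \<partial>N) < e)"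
      using cauchy by blast
    from choice[OF this] obtain K where
      K: "\<forall>e. e > 0 \<longrightarrow> (\<forall>m\<ge>K e. \<forall>n\<ge>K e. (\<integral>x. (us m x - us n x)\<^sup>2 \<partial>N) < e)" ..
    show ?thesis
      by (rule that[of K]) (use K in simp)
  qed
  \<comment> \<open>Strictly increasing, with all terms from the \<open>k\<close>-th index on within squared distance \<open>8\<^sup>-\<^sup>k\<close> of each other.\<close>
  define r where "r = rec_nat (K ((1/8)^0)) (\<lambda>k p. max (Suc p) (K ((1/8)^Suc k)))"
  have r_ge: "r k \<ge> K ((1/8)^k)" for k
    by (cases k) (auto simp: r_def)
  have "r k < r (Suc k)" for k
    by (simp add: r_def less_max_iff_disj)
  then have r_mono: "strict_mono r" by (simp add: strict_mono_Suc_iff)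
  define d where "d k x = us (r (Suc k)) x - us (r k) x" for k x
  have dsq: "sq_integrable N (d k)" for k
    unfolding d_def by (intro sq_integrable_diff sq)
  have [measurable]: "d k \<in> borel_measurable N" for k
    using dsq by (simp add: sq_integrable_def)
  have d_le: "(\<integral>x. (d k x)\<^sup>2 \<partial>N) \<le> (1/8)^k" for k
  proof -
    have "r (Suc k) \<ge> K ((1/8)^k)"
      using r_ge[of k] strict_mono_leD[OF r_mono, of k "Suc k"] by simp
    then show ?thesis
      unfolding d_def using K[of "(1/8)^k" "r (Suc k)" "r k"] r_ge[of k] by simp
  qed
  have "(\<integral>\<^sup>+x. (\<Sum>k. ennreal (2^k * (d k x)\<^sup>2)) \<partial>N) = (\<Sum>k. \<integral>\<^sup>+x. ennreal (2^k * (d k x)\<^sup>2) \<partial>N)"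
    by (rule nn_integral_suminf) simp
  also have "\<dots> \<le> (\<Sum>k. ennreal ((1/4)^k))"
  proof (intro suminf_le summableI)
    fix k
    have "(\<integral>\<^sup>+x. ennreal (2^k * (d k x)\<^sup>2) \<partial>N) = ennreal (\<integral>x. 2^k * (d k x)\<^sup>2 \<partial>N)"
      using dsq by (intro nn_integral_eq_integral) (auto simp: sq_integrable_def)
    also have "(\<integral>x. 2^k * (d k x)\<^sup>2 \<partial>N) = 2^k * (\<integral>x. (d k x)\<^sup>2 \<partial>N)" by simp
    also have "\<dots> \<le> 2^k * (1/8)^k" by (intro mult_left_mono d_le) simp
    also have "\<dots> = (1/4)^k" by (simp add: power_mult_distrib[symmetric])
    finally show "(\<integral>\<^sup>+x. ennreal (2^k * (d k x)\<^sup>2) \<partial>N) \<le> ennreal ((1/4)^k)"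
      by (simp add: ennreal_leI)
  qed
  also have "(\<Sum>k. ennreal ((1/4)^k)) = ennreal (1 / (1 - 1/4))"
    using geometric_sums[of "1/4::real"] by (intro suminf_ennreal_eq) simp_all
  also have "\<dots> < \<infinity>" by simp
  finally have fin: "(\<integral>\<^sup>+x. (\<Sum>k. ennreal (2^k * (d k x)\<^sup>2)) \<partial>N) \<noteq> \<infinity>"
    by (rule less_imp_neq)
  have "AE x in N. (\<Sum>k. ennreal (2^k * (d k x)\<^sup>2)) \<noteq> \<infinity>"
    by (rule nn_integral_PInf_AE[OF _ fin]) simp
  then have conv: "AE x in N. convergent (\<lambda>k. us (r k) x)"
  proof eventually_elim
    case (elim x)
    have sm: "summable (\<lambda>k. 2^k * (d k x)\<^sup>2)"
      using elim by (intro summable_suminf_not_top) auto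
    have "Bseq (\<lambda>k. 2^k * (d k x)\<^sup>2)"
      using summable_LIMSEQ_zero[OF sm] by (intro convergent_imp_Bseq) (auto simp: convergent_def)
    then obtain C where C: "C > 0" "\<And>k. norm (2^k * (d k x)\<^sup>2) \<le> C"
      by (auto simp: Bseq_def)
    have bound: "\<bar>d k x\<bar> \<le> sqrt C * (sqrt (1/2))^k" for k
    proof -
      have "(d k x)\<^sup>2 \<le> C * (1/2)^k"
        using C(2)[of k] by (simp add: field_simps power_one_over)
      then have "sqrt ((d k x)\<^sup>2) \<le> sqrt (C * (1/2)^k)" by (rule real_sqrt_le_mono)
      then show ?thesis unfolding real_sqrt_abs unfolding real_sqrt_mult real_sqrt_power .
    qed
    have geo: "summable (\<lambda>k. sqrt C * (sqrt (1/2))^k)"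
      by (intro summable_mult summable_geometric) (simp add: real_sqrt_divide)
    have "summable (\<lambda>k. d k x)"
      by (rule summable_comparison_test'[OF geo, of 0]) (use bound in simp)
    then have "convergent (\<lambda>n. \<Sum>k<n. d k x)" by (simp add: summable_iff_convergent)
    moreover have "(\<Sum>k<n. d k x) = us (r n) x - us (r 0) x" for n
      unfolding d_def by (rule sum_lessThan_telescope)
    ultimately have "convergent (\<lambda>n. us (r n) x - us (r 0) x)" by simp
    then have "convergent (\<lambda>n. (us (r n) x - us (r 0) x) + us (r 0) x)"
      by (intro convergent_add convergent_const)
    then show ?case by simp
  qed
  define u where "u x = lim (\<lambda>k. us (r k) x)" for x
  have [measurable]: "u \<in> borel_measurable N"
    unfolding u_def by measurable
  have lim: "AE x in N. (\<lambda>k. us (r k) x) \<longlonglongrightarrow> u x"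
    using conv unfolding u_def by eventually_elim (rule convergent_LIMSEQ_iff[THEN iffD1])
  have nn: "(\<integral>\<^sup>+x. ennreal ((us n x - u x)\<^sup>2) \<partial>N) \<le> ennreal e" if e: "e > 0" "n \<ge> K e" for n e
  proof -
    have "(\<integral>\<^sup>+x. ennreal ((us n x - u x)\<^sup>2) \<partial>N)
        = (\<integral>\<^sup>+x. liminf (\<lambda>k. ennreal ((us n x - us (r k) x)\<^sup>2)) \<partial>N)"
    proof (rule nn_integral_cong_AE, use lim in eventually_elim)
      case (elim x)
      have "(\<lambda>k. ennreal ((us n x - us (r k) x)\<^sup>2)) \<longlonglongrightarrow> ennreal ((us n x - u x)\<^sup>2)"
        by (intro tendsto_intros elim)
      then show ?case
        by (rule lim_imp_Liminf[OF trivial_limit_sequentially, symmetric])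
    qed
    also have "\<dots> \<le> liminf (\<lambda>k. \<integral>\<^sup>+x. ennreal ((us n x - us (r k) x)\<^sup>2) \<partial>N)"
      by (rule nn_integral_liminf) simp
    also have "\<dots> \<le> liminf (\<lambda>k. ennreal e)"
    proof (intro Liminf_mono)
      have "\<forall>\<^sub>F k in sequentially. k \<ge> K e" by (rule eventually_ge_at_top)
      then show "\<forall>\<^sub>F k in sequentially. (\<integral>\<^sup>+x. ennreal ((us n x - us (r k) x)\<^sup>2) \<partial>N) \<le> ennreal e"
      proof eventually_elim
        case (elim k)
        then have "r k \<ge> K e" using seq_suble[OF r_mono, of k] by simp
        then have "(\<integral>x. (us n x - us (r k) x)\<^sup>2 \<partial>N) < e" using K e by blast
        moreover have "(\<integral>\<^sup>+x. ennreal ((us n x - us (r k) x)\<^sup>2) \<partial>N)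
            = ennreal (\<integral>x. (us n x - us (r k) x)\<^sup>2 \<partial>N)"
          using sq_integrable_diff[OF sq sq, of n "r k"]
          by (intro nn_integral_eq_integral) (auto simp: sq_integrable_def)
        ultimately show ?case by (simp add: ennreal_leI)
      qed
    qed
    also have "\<dots> = ennreal e" by (simp add: Liminf_const)
    finally show ?thesis .
  qed
  have diff_sq: "sq_integrable N (\<lambda>x. us n x - u x)" if "n \<ge> K 1" for n
  proof -
    have "(\<integral>\<^sup>+x. ennreal ((us n x - u x)\<^sup>2) \<partial>N) < \<infinity>"
      using nn[of 1 n] that by (auto intro: le_less_trans)
    then show ?thesis
      unfolding sq_integrable_def by (auto simp: integrable_iff_bounded)
  qed
  have usq: "sq_integrable N u"
    using sq_integrable_diff[OF sq[of "K 1"] diff_sq[of "K 1"]] by simp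
  have le: "(\<integral>x. (us n x - u x)\<^sup>2 \<partial>N) \<le> e" if "e > 0" "n \<ge> K e" for n e
  proof -
    have "ennreal (\<integral>x. (us n x - u x)\<^sup>2 \<partial>N) = (\<integral>\<^sup>+x. ennreal ((us n x - u x)\<^sup>2) \<partial>N)"
      using sq_integrable_diff[OF sq usq, of n]
      by (intro nn_integral_eq_integral[symmetric]) (auto simp: sq_integrable_def)
    with nn[OF that] have "ennreal (\<integral>x. (us n x - u x)\<^sup>2 \<partial>N) \<le> ennreal e" by (rule ord_eq_le_trans[rotated])
    then show ?thesis using that by (simp add: ennreal_le_iff)
  qed
  have "(\<lambda>n. \<integral>x. (us n x - u x)\<^sup>2 \<partial>N) \<longlonglongrightarrow> 0"
  proof (rule LIMSEQ_I)
    fix e :: real assume "e > 0"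
    then have "norm ((\<integral>x. (us n x - u x)\<^sup>2 \<partial>N) - 0) < e" if "n \<ge> K (e/2)" for n
      using le[of "e/2" n] that by simp
    then show "\<exists>no. \<forall>n\<ge>no. norm ((\<integral>x. (us n x - u x)\<^sup>2 \<partial>N) - 0) < e" by blast
  qed
  then show ?thesis using sq usq by (intro exI[of _ u] L2_convergesI)
qed

section \<open>Random variables with moments of all orders\<close>

text \<open>
  Bounds uniform along a sequence are what passes to the limit of approximations; a single random
  variable is treated as a constant sequence.
\<close>

definition bounded_moments :: "'a measure \<Rightarrow> (nat \<Rightarrow> 'a \<Rightarrow> real) \<Rightarrow> bool" where
  "bounded_moments M Xs \<longleftrightarrow>
     (\<forall>m. Xs m \<in> borel_measurable M) \<and>
     (\<forall>p::nat. \<exists>K. \<forall>m. integrable M (\<lambda>\<omega>. \<bar>Xs m \<omega>\<bar> ^ p) \<and> (\<integral>\<omega>. \<bar>Xs m \<omega>\<bar> ^ p \<partial>M) \<le> K)"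

lemma bounded_momentsD:
  assumes "bounded_moments M Xs"
  shows "Xs m \<in> borel_measurable M" "integrable M (\<lambda>\<omega>. \<bar>Xs m \<omega>\<bar> ^ p)"
    "integrable M (Xs m)" "sq_integrable M (Xs m)"
proof -
  show m: "Xs m \<in> borel_measurable M" using assms by (simp add: bounded_moments_def)
  show i: "integrable M (\<lambda>\<omega>. \<bar>Xs m \<omega>\<bar> ^ p)" for p using assms by (auto simp: bounded_moments_def)
  show "integrable M (Xs m)" using i[of 1] m by (simp add: integrable_abs_iff)
  show "sq_integrable M (Xs m)" using i[of 2] m by (simp add: sq_integrable_def)
qed

lemma bounded_moments_bound:
  assumes "bounded_moments M Xs"
  shows "\<exists>K. \<forall>m. (\<integral>\<omega>. \<bar>Xs m \<omega>\<bar> ^ p \<partial>M) \<le> K"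
  using assms unfolding bounded_moments_def by blast

lemma bounded_momentsI:
  assumes "\<And>m. Xs m \<in> borel_measurable M"
    and "\<And>p. \<exists>Ys K. \<forall>m. integrable M (Ys m) \<and> (\<integral>\<omega>. Ys m \<omega> \<partial>M) \<le> K \<and> (\<forall>\<omega>. \<bar>Xs m \<omega>\<bar> ^ p \<le> Ys m \<omega>)"
  shows "bounded_moments M Xs"
  unfolding bounded_moments_def
proof (intro conjI allI)
  show meas: "Xs m \<in> borel_measurable M" for m by fact
  fix p
  obtain Ys :: "nat \<Rightarrow> 'a \<Rightarrow> real" and K where Y: "\<And>m. integrable M (Ys m)" "\<And>m. (\<integral>\<omega>. Ys m \<omega> \<partial>M) \<le> K"
    "\<And>m \<omega>. \<bar>Xs m \<omega>\<bar> ^ p \<le> Ys m \<omega>"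
    using assms(2)[of p] by blast
  have int: "integrable M (\<lambda>\<omega>. \<bar>Xs m \<omega>\<bar> ^ p)" for m
    by (rule Bochner_Integration.integrable_bound[OF Y(1)[of m]])
       (use meas Y(3) in \<open>auto intro!: AE_I2 order_trans[OF _ abs_ge_self]\<close>)
  have "(\<integral>\<omega>. \<bar>Xs m \<omega>\<bar> ^ p \<partial>M) \<le> K" for m
    by (rule order_trans[OF integral_mono[OF int Y(1)] Y(2)]) (rule Y(3))
  with int show "\<exists>K. \<forall>m. integrable M (\<lambda>\<omega>. \<bar>Xs m \<omega>\<bar> ^ p) \<and> (\<integral>\<omega>. \<bar>Xs m \<omega>\<bar> ^ p \<partial>M) \<le> K" by blast
qed

lemma abs_power_le_even_power: "\<bar>x\<bar> ^ p \<le> 1 + x ^ (2 * p)" for x :: real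
proof -
  have "2 * (1 * \<bar>x\<bar> ^ p) \<le> 1 + (\<bar>x\<bar> ^ p)\<^sup>2" using sum_squares_bound[of 1 "\<bar>x\<bar> ^ p"] by simp
  moreover have "(\<bar>x\<bar> ^ p)\<^sup>2 = x ^ (2 * p)"
    by (simp add: power_even_abs flip: power_mult power_abs mult.commute[of 2])
  moreover have "0 \<le> \<bar>x\<bar> ^ p" by simp
  ultimately show ?thesis by linarith
qed

lemma bounded_moments_dominated:
  assumes X: "bounded_moments M Xs" and "\<And>m. Ys m \<in> borel_measurable M"
    and le: "\<And>m \<omega>. \<bar>Ys m \<omega>\<bar> \<le> \<bar>Xs m \<omega>\<bar>"
  shows "bounded_moments M Ys"
proof (rule bounded_momentsI)
  fix p
  obtain K where "\<And>m. (\<integral>\<omega>. \<bar>Xs m \<omega>\<bar> ^ p \<partial>M) \<le> K" using bounded_moments_bound[OF X] by blast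
  then show "\<exists>Zs K. \<forall>m. integrable M (Zs m) \<and> (\<integral>\<omega>. Zs m \<omega> \<partial>M) \<le> K \<and> (\<forall>\<omega>. \<bar>Ys m \<omega>\<bar> ^ p \<le> Zs m \<omega>)"
    using bounded_momentsD(2)[OF X, of _ p] le
    by (intro exI[of _ "\<lambda>m \<omega>. \<bar>Xs m \<omega>\<bar> ^ p"] exI[of _ K]) (auto intro: power_mono)
qed fact

lemma bounded_moments_add:
  assumes X: "bounded_moments M Xs" and Y: "bounded_moments M Ys"
  shows "bounded_moments M (\<lambda>m \<omega>. Xs m \<omega> + Ys m \<omega>)"
proof (rule bounded_momentsI)
  show "(\<lambda>\<omega>. Xs m \<omega> + Ys m \<omega>) \<in> borel_measurable M" for m
    using bounded_momentsD(1)[OF X] bounded_momentsD(1)[OF Y] by simp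
  fix p
  obtain K where K: "\<And>m. (\<integral>\<omega>. \<bar>Xs m \<omega>\<bar> ^ p \<partial>M) \<le> K" using bounded_moments_bound[OF X] by blast
  obtain L where L: "\<And>m. (\<integral>\<omega>. \<bar>Ys m \<omega>\<bar> ^ p \<partial>M) \<le> L" using bounded_moments_bound[OF Y] by blast
  have le: "\<bar>a + b\<bar> ^ p \<le> 2^p * \<bar>a\<bar>^p + 2^p * \<bar>b\<bar>^p" for a b :: real
  proof -
    have "\<bar>a + b\<bar> ^ p \<le> (2 * max \<bar>a\<bar> \<bar>b\<bar>) ^ p"
      by (intro power_mono) auto
    also have "\<dots> = 2^p * (max \<bar>a\<bar> \<bar>b\<bar>)^p" by (simp add: power_mult_distrib)
    also have "\<dots> \<le> 2^p * (\<bar>a\<bar>^p + \<bar>b\<bar>^p)"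
      by (intro mult_left_mono) (auto simp: max_def)
    finally show ?thesis by (simp add: distrib_left)
  qed
  show "\<exists>Zs K. \<forall>m. integrable M (Zs m) \<and> (\<integral>\<omega>. Zs m \<omega> \<partial>M) \<le> K \<and> (\<forall>\<omega>. \<bar>Xs m \<omega> + Ys m \<omega>\<bar> ^ p \<le> Zs m \<omega>)"
  proof (intro exI allI conjI)
    fix m
    show "integrable M (\<lambda>\<omega>. 2^p * \<bar>Xs m \<omega>\<bar>^p + 2^p * \<bar>Ys m \<omega>\<bar>^p)"
      using bounded_momentsD(2)[OF X, of m p] bounded_momentsD(2)[OF Y, of m p] by simp
    show "(\<integral>\<omega>. 2^p * \<bar>Xs m \<omega>\<bar>^p + 2^p * \<bar>Ys m \<omega>\<bar>^p \<partial>M) \<le> 2^p * K + 2^p * L"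
      using bounded_momentsD(2)[OF X, of m p] bounded_momentsD(2)[OF Y, of m p] K[of m] L[of m]
      by (simp add: add_mono)
  qed (rule le)
qed

lemma bounded_moments_mult:
  assumes X: "bounded_moments M Xs" and Y: "bounded_moments M Ys"
  shows "bounded_moments M (\<lambda>m \<omega>. Xs m \<omega> * Ys m \<omega>)"
proof (rule bounded_momentsI)
  show "(\<lambda>\<omega>. Xs m \<omega> * Ys m \<omega>) \<in> borel_measurable M" for m
    using bounded_momentsD(1)[OF X] bounded_momentsD(1)[OF Y] by simp
  fix p
  obtain K where K: "\<And>m. (\<integral>\<omega>. \<bar>Xs m \<omega>\<bar> ^ (2*p) \<partial>M) \<le> K" using bounded_moments_bound[OF X] by blast
  obtain L where L: "\<And>m. (\<integral>\<omega>. \<bar>Ys m \<omega>\<bar> ^ (2*p) \<partial>M) \<le> L" using bounded_moments_bound[OF Y] by blast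
  have le: "\<bar>a * b\<bar> ^ p \<le> \<bar>a\<bar>^(2*p) + \<bar>b\<bar>^(2*p)" for a b :: real
  proof -
    have "2 * (\<bar>a\<bar>^p * \<bar>b\<bar>^p) \<le> (\<bar>a\<bar>^p)\<^sup>2 + (\<bar>b\<bar>^p)\<^sup>2" "0 \<le> \<bar>a\<bar>^p * \<bar>b\<bar>^p"
      using sum_squares_bound[of "\<bar>a\<bar>^p" "\<bar>b\<bar>^p"] by simp_all
    then have "\<bar>a\<bar>^p * \<bar>b\<bar>^p \<le> (\<bar>a\<bar>^p)\<^sup>2 + (\<bar>b\<bar>^p)\<^sup>2" by linarith
    moreover have "(\<bar>c\<bar>^p)\<^sup>2 = \<bar>c\<bar>^(2*p)" for c :: real
      by (simp only: power_mult[symmetric] mult.commute)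
    ultimately show ?thesis unfolding abs_mult power_mult_distrib by simp
  qed
  show "\<exists>Zs K. \<forall>m. integrable M (Zs m) \<and> (\<integral>\<omega>. Zs m \<omega> \<partial>M) \<le> K \<and> (\<forall>\<omega>. \<bar>Xs m \<omega> * Ys m \<omega>\<bar> ^ p \<le> Zs m \<omega>)"
  proof (intro exI allI conjI)
    fix m
    note i = bounded_momentsD(2)[OF X, of m "2*p"] bounded_momentsD(2)[OF Y, of m "2*p"]
    show "integrable M (\<lambda>\<omega>. \<bar>Xs m \<omega>\<bar>^(2*p) + \<bar>Ys m \<omega>\<bar>^(2*p))"
      by (intro Bochner_Integration.integrable_add i)
    show "(\<integral>\<omega>. \<bar>Xs m \<omega>\<bar>^(2*p) + \<bar>Ys m \<omega>\<bar>^(2*p) \<partial>M) \<le> K + L"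
      unfolding Bochner_Integration.integral_add[OF i] by (intro add_mono K L)
  qed (rule le)
qed

context prob_space
begin

lemma bounded_moments_const: "bounded_moments M (\<lambda>m \<omega>. c)"
  unfolding bounded_moments_def by (auto simp: prob_space)

lemma bounded_moments_cmult:
  "bounded_moments M Xs \<Longrightarrow> bounded_moments M (\<lambda>m \<omega>. c * Xs m \<omega>)"
  by (intro bounded_moments_mult bounded_moments_const)

lemma bounded_moments_diff:
  assumes "bounded_moments M Xs" "bounded_moments M Ys"
  shows "bounded_moments M (\<lambda>m \<omega>. Xs m \<omega> - Ys m \<omega>)"
  using bounded_moments_add[OF assms(1) bounded_moments_cmult[OF assms(2), of "-1"]] by simp

lemma bounded_moments_power:
  "bounded_moments M Xs \<Longrightarrow> bounded_moments M (\<lambda>m \<omega>. Xs m \<omega> ^ k)"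
  by (induction k) (auto intro: bounded_moments_const bounded_moments_mult)

lemma bounded_moments_sum:
  assumes "\<And>i. i \<in> I \<Longrightarrow> bounded_moments M (\<lambda>m. Xs i m)"
  shows "bounded_moments M (\<lambda>m \<omega>. \<Sum>i\<in>I. Xs i m \<omega>)"
  using assms
  by (induction I rule: infinite_finite_induct) (auto intro: bounded_moments_const bounded_moments_add)

lemma bounded_moments_abs:
  assumes "bounded_moments M Xs"
  shows "bounded_moments M (\<lambda>m \<omega>. \<bar>Xs m \<omega>\<bar>)"
  by (rule bounded_moments_dominated[OF assms]) (use bounded_momentsD(1)[OF assms] in auto)

text \<open>
  A second moment bound controls the tails uniformly: \<open>t \<le> min t L + t\<^sup>2 / L\<close> splits the mean of
  \<open>\<bar>X\<^sub>m - X\<bar>\<close> into a part handled by bounded convergence and a part of order \<open>1 / L\<close>.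
\<close>

lemma bounded_moments_limit:
  assumes X: "bounded_moments M Xs" and meas: "Y \<in> borel_measurable M"
    and ae: "AE \<omega> in M. (\<lambda>m. Xs m \<omega>) \<longlonglongrightarrow> Y \<omega>"
  shows "bounded_moments M (\<lambda>m. Y)" (is ?Y)
    and "(\<lambda>m. expectation (Xs m)) \<longlonglongrightarrow> expectation Y"
proof -
  note [measurable] = meas bounded_momentsD(1)[OF X]
  have mom: "integrable M (\<lambda>\<omega>. \<bar>Y \<omega>\<bar>^p)" for p
  proof -
    obtain K where K: "\<And>m. (\<integral>\<omega>. \<bar>Xs m \<omega>\<bar> ^ p \<partial>M) \<le> K" using bounded_moments_bound[OF X] by blast
    have "(\<integral>\<^sup>+\<omega>. ennreal (\<bar>Y \<omega>\<bar>^p) \<partial>M) = (\<integral>\<^sup>+\<omega>. liminf (\<lambda>m. ennreal (\<bar>Xs m \<omega>\<bar>^p)) \<partial>M)"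
    proof (rule nn_integral_cong_AE, use ae in eventually_elim)
      case (elim \<omega>)
      have "(\<lambda>m. ennreal (\<bar>Xs m \<omega>\<bar>^p)) \<longlonglongrightarrow> ennreal (\<bar>Y \<omega>\<bar>^p)"
        by (intro tendsto_ennrealI tendsto_power tendsto_rabs elim)
      then show ?case
        by (rule lim_imp_Liminf[OF trivial_limit_sequentially, symmetric])
    qed
    also have "\<dots> \<le> liminf (\<lambda>m. \<integral>\<^sup>+\<omega>. ennreal (\<bar>Xs m \<omega>\<bar>^p) \<partial>M)"
      by (rule nn_integral_liminf) simp
    also have "\<dots> \<le> liminf (\<lambda>m. ennreal K)"
    proof (intro Liminf_mono always_eventually allI)
      fix m
      show "(\<integral>\<^sup>+\<omega>. ennreal (\<bar>Xs m \<omega>\<bar>^p) \<partial>M) \<le> ennreal K"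
        using nn_integral_eq_integral[OF bounded_momentsD(2)[OF X, of m p]] K[of m]
        by (simp add: ennreal_leI)
    qed
    also have "\<dots> = ennreal K" by (simp add: Liminf_const)
    finally have "(\<integral>\<^sup>+\<omega>. ennreal (\<bar>Y \<omega>\<bar>^p) \<partial>M) < \<infinity>" by (rule le_less_trans) simp
    then show ?thesis by (intro integrableI_bounded) simp_all
  qed
  show Y: ?Y
    unfolding bounded_moments_def using meas mom by auto
  define D where "D m \<omega> = \<bar>Xs m \<omega> - Y \<omega>\<bar>" for m \<omega>
  have DX: "bounded_moments M D"
    unfolding D_def by (intro bounded_moments_abs bounded_moments_diff X Y)
  note [measurable] = bounded_momentsD(1)[OF DX]
  obtain K where K: "\<And>m. (\<integral>\<omega>. \<bar>D m \<omega>\<bar> ^ 2 \<partial>M) \<le> K" using bounded_moments_bound[OF DX] by blast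
  have K0: "0 \<le> K" by (rule order_trans[OF _ K[of 0]]) simp
  have Dlim: "(\<lambda>m. expectation (D m)) \<longlonglongrightarrow> 0"
  proof (rule LIMSEQ_I)
    fix e :: real assume e: "e > 0"
    define L where "L = 2 * (K + 1) / e"
    have L: "L > 0" using e K0 by (simp add: L_def)
    have "(\<lambda>m. expectation (\<lambda>\<omega>. min (D m \<omega>) L)) \<longlonglongrightarrow> expectation (\<lambda>\<omega>. 0)"
    proof (rule integral_dominated_convergence[where w = "\<lambda>\<omega>. L"])
      show "AE \<omega> in M. (\<lambda>m. min (D m \<omega>) L) \<longlonglongrightarrow> 0"
        using ae
      proof eventually_elim
        case (elim \<omega>)
        have "(\<lambda>m. min (D m \<omega>) L) \<longlonglongrightarrow> min \<bar>Y \<omega> - Y \<omega>\<bar> L"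
          unfolding D_def by (intro tendsto_min tendsto_rabs tendsto_diff tendsto_const elim)
        then show ?case using L by simp
      qed
    qed (use L in \<open>auto simp: D_def\<close>)
    then have "\<forall>\<^sub>F m in sequentially. expectation (\<lambda>\<omega>. min (D m \<omega>) L) < e / 2"
      using e by (intro order_tendstoD(2)[of _ 0]) auto
    then have "\<forall>\<^sub>F m in sequentially. norm (expectation (D m) - 0) < e"
    proof eventually_elim
      case (elim m)
      have i1: "integrable M (\<lambda>\<omega>. min (D m \<omega>) L)"
        by (rule Bochner_Integration.integrable_bound[where f = "\<lambda>\<omega>. L"]) (use L in \<open>auto simp: D_def\<close>)
      have i2: "integrable M (\<lambda>\<omega>. \<bar>D m \<omega>\<bar>^2)" by (rule bounded_momentsD(2)[OF DX])
      have "t \<le> min t L + \<bar>t\<bar>^2 / L" for t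
      proof (cases "t \<le> L")
        case False
        then have "t * L \<le> t * t" using L by (intro mult_left_mono) auto
        then have "t \<le> \<bar>t\<bar>^2 / L" using L by (simp add: field_simps power2_eq_square)
        then show ?thesis using False L by simp
      qed (use L in simp)
      then have "expectation (D m) \<le> expectation (\<lambda>\<omega>. min (D m \<omega>) L + \<bar>D m \<omega>\<bar>^2 / L)"
        using i1 i2 bounded_momentsD(3)[OF DX] by (intro integral_mono) auto
      also have "\<dots> = expectation (\<lambda>\<omega>. min (D m \<omega>) L) + expectation (\<lambda>\<omega>. \<bar>D m \<omega>\<bar>^2) / L"
        using i1 i2 by simp
      also have "expectation (\<lambda>\<omega>. \<bar>D m \<omega>\<bar>^2) / L \<le> K / L"
        using K[of m] L by (intro divide_right_mono) auto
      also have "K / L \<le> e / 2"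
        using e K0 by (simp add: L_def field_simps)
      finally have "expectation (D m) < e" using elim by simp
      moreover have "0 \<le> expectation (D m)" by (simp add: D_def)
      ultimately show ?case by simp
    qed
    then show "\<exists>no. \<forall>n\<ge>no. norm (expectation (D n) - 0) < e"
      by (simp add: eventually_sequentially)
  qed
  have "(\<lambda>m. expectation (Xs m) - expectation Y) \<longlonglongrightarrow> 0"
  proof (rule Lim_null_comparison[OF always_eventually Dlim], rule allI)
    fix m
    have "expectation (Xs m) - expectation Y = expectation (\<lambda>\<omega>. Xs m \<omega> - Y \<omega>)"
      using bounded_momentsD(3)[OF X, of m] bounded_momentsD(3)[OF Y] by simp
    also have "norm \<dots> \<le> expectation (\<lambda>\<omega>. norm (Xs m \<omega> - Y \<omega>))" by (rule integral_norm_bound)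
    finally show "norm (expectation (Xs m) - expectation Y) \<le> expectation (D m)"
      by (simp add: D_def[abs_def])
  qed
  then show "(\<lambda>m. expectation (Xs m)) \<longlonglongrightarrow> expectation Y"
    by (rule LIM_zero_cancel)
qed

end

section \<open>Continuously differentiable functions of polynomial growth\<close>

definition poly_growth :: "nat \<Rightarrow> ((nat \<Rightarrow> real) \<Rightarrow> real) \<Rightarrow> bool" where
  "poly_growth n f \<longleftrightarrow> (\<exists>C (k::nat). \<forall>x. \<bar>f x\<bar> \<le> C * (1 + (\<Sum>i<n. \<bar>x i\<bar>)) ^ k)"

lemma poly_growthE:
  assumes "poly_growth n f"
  obtains C k where "C \<ge> 0" "\<And>x. \<bar>f x\<bar> \<le> C * (1 + (\<Sum>i<n. \<bar>x i\<bar>)) ^ k"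
proof -
  obtain C k where C: "\<And>x. \<bar>f x\<bar> \<le> C * (1 + (\<Sum>i<n. \<bar>x i\<bar>)) ^ k"
    using assms unfolding poly_growth_def by blast
  have "0 \<le> \<bar>f (\<lambda>_. 0)\<bar>" by simp
  also have "\<dots> \<le> C" using C[of "\<lambda>_. 0"] by simp
  finally show ?thesis using that C by blast
qed

lemma poly_growth_const: "poly_growth n (\<lambda>x. c)"
  unfolding poly_growth_def by (intro exI[of _ "\<bar>c\<bar>"] exI[of _ 0]) simp

lemma poly_growth_add:
  assumes "poly_growth n f" "poly_growth n g"
  shows "poly_growth n (\<lambda>x. f x + g x)"
proof -
  obtain C k where C: "C \<ge> 0" "\<And>x. \<bar>f x\<bar> \<le> C * (1 + (\<Sum>i<n. \<bar>x i\<bar>)) ^ k" using assms(1) by (rule poly_growthE) blast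
  obtain D l where D: "D \<ge> 0" "\<And>x. \<bar>g x\<bar> \<le> D * (1 + (\<Sum>i<n. \<bar>x i\<bar>)) ^ l" using assms(2) by (rule poly_growthE) blast
  show ?thesis unfolding poly_growth_def
  proof (intro exI allI)
    fix x :: "nat \<Rightarrow> real"
    define s where "s = 1 + (\<Sum>i<n. \<bar>x i\<bar>)"
    have s: "s \<ge> 1" by (simp add: s_def sum_nonneg)
    have "\<bar>f x + g x\<bar> \<le> C * s^k + D * s^l" using C(2)[of x] D(2)[of x] by (simp add: s_def)
    also have "\<dots> \<le> C * s^(k+l) + D * s^(k+l)"
      using C(1) D(1) s by (intro add_mono mult_left_mono power_increasing) auto
    finally show "\<bar>f x + g x\<bar> \<le> (C + D) * (1 + (\<Sum>i<n. \<bar>x i\<bar>)) ^ (k + l)"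
      by (simp add: s_def distrib_right)
  qed
qed

lemma poly_growth_mult:
  assumes "poly_growth n f" "poly_growth n g"
  shows "poly_growth n (\<lambda>x. f x * g x)"
proof -
  obtain C k where C: "C \<ge> 0" "\<And>x. \<bar>f x\<bar> \<le> C * (1 + (\<Sum>i<n. \<bar>x i\<bar>)) ^ k" using assms(1) by (rule poly_growthE) blast
  obtain D l where D: "D \<ge> 0" "\<And>x. \<bar>g x\<bar> \<le> D * (1 + (\<Sum>i<n. \<bar>x i\<bar>)) ^ l" using assms(2) by (rule poly_growthE) blast
  have "\<bar>f x * g x\<bar> \<le> (C * D) * (1 + (\<Sum>i<n. \<bar>x i\<bar>)) ^ (k + l)" for x
  proof -
    have "\<bar>f x * g x\<bar> \<le> (C * (1 + (\<Sum>i<n. \<bar>x i\<bar>)) ^ k) * (D * (1 + (\<Sum>i<n. \<bar>x i\<bar>)) ^ l)"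
      unfolding abs_mult using C D by (intro mult_mono) (auto simp: sum_nonneg)
    then show ?thesis by (simp add: power_add mult_ac)
  qed
  then show ?thesis unfolding poly_growth_def by blast
qed

lemma poly_growth_sum:
  assumes "\<And>i. i \<in> I \<Longrightarrow> poly_growth n (f i)"
  shows "poly_growth n (\<lambda>x. \<Sum>i\<in>I. f i x)"
  using assms
  by (induction I rule: infinite_finite_induct) (auto intro: poly_growth_const poly_growth_add)

lemma poly_growth_mono:
  assumes "poly_growth n f" "n \<le> m"
  shows "poly_growth m f"
proof -
  obtain C k where C: "C \<ge> 0" "\<And>x. \<bar>f x\<bar> \<le> C * (1 + (\<Sum>i<n. \<bar>x i\<bar>)) ^ k" using assms(1) by (rule poly_growthE) blast
  have "\<bar>f x\<bar> \<le> C * (1 + (\<Sum>i<m. \<bar>x i\<bar>)) ^ k" for x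
  proof -
    have "(\<Sum>i<n. \<bar>x i\<bar>) \<le> (\<Sum>i<m. \<bar>x i\<bar>)" using assms(2) by (intro sum_mono2) auto
    then have "C * (1 + (\<Sum>i<n. \<bar>x i\<bar>)) ^ k \<le> C * (1 + (\<Sum>i<m. \<bar>x i\<bar>)) ^ k"
      using C(1) by (intro mult_left_mono power_mono) (auto simp: sum_nonneg)
    with C(2)[of x] show ?thesis by linarith
  qed
  then show ?thesis unfolding poly_growth_def by blast
qed

lemma poly_growth_coord:
  assumes "\<And>u. \<bar>\<phi> u\<bar> \<le> C * (1 + \<bar>u\<bar>) ^ p" "k < n"
  shows "poly_growth n (\<lambda>x. \<phi> (x k))"
proof -
  have C: "C \<ge> 0" using assms(1)[of 0] by simp
  have "\<bar>\<phi> (x k)\<bar> \<le> C * (1 + (\<Sum>i<n. \<bar>x i\<bar>)) ^ p" for x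
  proof -
    have "\<bar>x k\<bar> \<le> (\<Sum>i<n. \<bar>x i\<bar>)" using assms(2) by (intro member_le_sum) auto
    then have "C * (1 + \<bar>x k\<bar>) ^ p \<le> C * (1 + (\<Sum>i<n. \<bar>x i\<bar>)) ^ p"
      using C by (intro mult_left_mono power_mono) auto
    with assms(1)[of "x k"] show ?thesis by linarith
  qed
  then show ?thesis unfolding poly_growth_def by blast
qed

lemma poly_growth_linear:
  assumes "poly_growth n f"
  shows "poly_growth N (\<lambda>x. f (\<lambda>i. \<Sum>l<N. d i l * x l))"
proof -
  obtain C k where C: "C \<ge> 0" "\<And>x. \<bar>f x\<bar> \<le> C * (1 + (\<Sum>i<n. \<bar>x i\<bar>)) ^ k" using assms(1) by (rule poly_growthE) blast
  define D where "D = (\<Sum>i<n. \<Sum>l<N. \<bar>d i l\<bar>)"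
  have D: "D \<ge> 0" by (simp add: D_def sum_nonneg)
  have "\<bar>f (\<lambda>i. \<Sum>l<N. d i l * x l)\<bar> \<le> (C * (1 + D)^k) * (1 + (\<Sum>i<N. \<bar>x i\<bar>)) ^ k" for x
  proof -
    define s where "s = (\<Sum>i<N. \<bar>x i\<bar>)"
    have s: "s \<ge> 0" by (simp add: s_def sum_nonneg)
    have "(\<Sum>i<n. \<bar>\<Sum>l<N. d i l * x l\<bar>) \<le> (\<Sum>i<n. \<Sum>l<N. \<bar>d i l\<bar> * s)"
    proof (intro sum_mono order_trans[OF sum_abs])
      fix i l assume "l \<in> {..<N}"
      then have "\<bar>x l\<bar> \<le> s" unfolding s_def by (intro member_le_sum) auto
      then show "\<bar>d i l * x l\<bar> \<le> \<bar>d i l\<bar> * s" by (simp add: abs_mult mult_left_mono)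
    qed
    also have "\<dots> = D * s" by (simp add: D_def sum_distrib_right)
    finally have "1 + (\<Sum>i<n. \<bar>\<Sum>l<N. d i l * x l\<bar>) \<le> (1 + D) * (1 + s)"
      using s D by (simp add: algebra_simps)
    then have "C * (1 + (\<Sum>i<n. \<bar>\<Sum>l<N. d i l * x l\<bar>)) ^ k \<le> C * ((1 + D) * (1 + s)) ^ k"
      using C(1) by (intro mult_left_mono power_mono) (auto simp: sum_nonneg)
    with C(2)[of "\<lambda>i. \<Sum>l<N. d i l * x l"] show ?thesis
      by (simp add: power_mult_distrib s_def mult.assoc)
  qed
  then show ?thesis unfolding poly_growth_def by blast
qed

lemma (in prob_space) bounded_moments_poly_growth:
  assumes f: "poly_growth n f" and W: "\<And>i. i < n \<Longrightarrow> bounded_moments M (\<lambda>m. W m i)"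
    and meas: "\<And>m. (\<lambda>\<omega>. f (\<lambda>i. W m i \<omega>)) \<in> borel_measurable M"
  shows "bounded_moments M (\<lambda>m \<omega>. f (\<lambda>i. W m i \<omega>))"
proof -
  obtain C k where C: "C \<ge> 0" "\<And>x. \<bar>f x\<bar> \<le> C * (1 + (\<Sum>i<n. \<bar>x i\<bar>)) ^ k" using f by (rule poly_growthE) blast
  show ?thesis
  proof (rule bounded_moments_dominated[OF _ meas])
    show "bounded_moments M (\<lambda>m \<omega>. C * (1 + (\<Sum>i<n. \<bar>W m i \<omega>\<bar>)) ^ k)"
      using W by (intro bounded_moments_cmult bounded_moments_power bounded_moments_add
          bounded_moments_const bounded_moments_sum bounded_moments_abs) auto
    show "\<bar>f (\<lambda>i. W m i \<omega>)\<bar> \<le> \<bar>C * (1 + (\<Sum>i<n. \<bar>W m i \<omega>\<bar>)) ^ k\<bar>" for m \<omega>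
      using C(2)[of "\<lambda>i. W m i \<omega>"] by linarith
  qed
qed

text \<open>
  Functions of the first \<open>n\<close> coordinates of a sequence, with \<open>f' j\<close> the partial derivative in coordinate
  \<open>j\<close>.  The ambient space of sequences is the same for all \<open>n\<close>, so that functions of families of
  different sizes can be combined.
\<close>

definition C1_poly :: "nat \<Rightarrow> ((nat \<Rightarrow> real) \<Rightarrow> real) \<Rightarrow> (nat \<Rightarrow> (nat \<Rightarrow> real) \<Rightarrow> real) \<Rightarrow> bool" where
  "C1_poly n f f' \<longleftrightarrow>
     (\<forall>x y. (\<forall>i<n. x i = y i) \<longrightarrow> f x = f y) \<and> continuous_on UNIV f \<and> poly_growth n f \<and>
     (\<forall>j<n. continuous_on UNIV (f' j) \<and> poly_growth n (f' j) \<and>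
        (\<forall>x. ((\<lambda>u. f (x(j := u))) has_real_derivative f' j x) (at (x j))))"

lemma C1_polyD:
  assumes "C1_poly n f f'"
  shows "(\<And>i. i < n \<Longrightarrow> x i = y i) \<Longrightarrow> f x = f y" "continuous_on UNIV f" "poly_growth n f"
    "j < n \<Longrightarrow> continuous_on UNIV (f' j)" "j < n \<Longrightarrow> poly_growth n (f' j)"
    "j < n \<Longrightarrow> ((\<lambda>u. f (x(j := u))) has_real_derivative f' j x) (at (x j))"
  using assms unfolding C1_poly_def by auto

lemma C1_poly_gradient_depends:
  assumes f: "C1_poly n f f'" and j: "j < n" and xy: "\<And>i. i < n \<Longrightarrow> x i = y i"
  shows "f' j x = f' j y"
proof -
  have "(\<lambda>u. f (x(j := u))) = (\<lambda>u. f (y(j := u)))"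
    using xy by (intro ext C1_polyD(1)[OF f]) auto
  with C1_polyD(6)[OF f j, of x] C1_polyD(6)[OF f j, of y] xy[OF j] show ?thesis
    by (simp add: DERIV_unique)
qed

lemma C1_poly_mult:
  assumes f: "C1_poly n f f'" and g: "C1_poly n g g'"
  shows "C1_poly n (\<lambda>x. f x * g x) (\<lambda>j x. f' j x * g x + f x * g' j x)"
  unfolding C1_poly_def
proof (intro conjI allI impI)
  note F = C1_polyD[OF f] and G = C1_polyD[OF g]
  show "f x * g x = f y * g y" if "\<forall>i<n. x i = y i" for x y
    using that F(1)[of x y] G(1)[of x y] by simp
  show "continuous_on UNIV (\<lambda>x. f x * g x)" by (intro continuous_intros F G)
  show "poly_growth n (\<lambda>x. f x * g x)" by (intro poly_growth_mult F G)
  fix j assume j: "j < n"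
  show "continuous_on UNIV (\<lambda>x. f' j x * g x + f x * g' j x)" by (intro continuous_intros F G j)
  show "poly_growth n (\<lambda>x. f' j x * g x + f x * g' j x)" by (intro poly_growth_add poly_growth_mult F G j)
  show "((\<lambda>u. f (x(j := u)) * g (x(j := u))) has_real_derivative f' j x * g x + f x * g' j x) (at (x j))" for x
    using DERIV_mult[OF F(6)[OF j, of x] G(6)[OF j, of x]] by (simp add: algebra_simps)
qed

lemma C1_poly_mono:
  assumes f: "C1_poly n f f'" and "n \<le> m"
  shows "C1_poly m f (\<lambda>j. if j < n then f' j else (\<lambda>x. 0))"
  unfolding C1_poly_def
proof (intro conjI allI impI)
  note F = C1_polyD[OF f]
  show "f x = f y" if "\<forall>i<m. x i = y i" for x y using that assms(2) by (intro F(1)) auto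
  show "continuous_on UNIV f" by (rule F)
  show "poly_growth m f" by (rule poly_growth_mono[OF F(3) assms(2)])
  fix j assume "j < m"
  show "continuous_on UNIV (if j < n then f' j else (\<lambda>x. 0))" using F(4) by auto
  show "poly_growth m (if j < n then f' j else (\<lambda>x. 0))"
    using poly_growth_mono[OF F(5) assms(2)] poly_growth_const by auto
  show "((\<lambda>u. f (x(j := u))) has_real_derivative (if j < n then f' j else (\<lambda>x. 0)) x) (at (x j))" for x
  proof (cases "j < n")
    case False
    then have "(\<lambda>u. f (x(j := u))) = (\<lambda>u. f x)" by (intro ext F(1)) auto
    then show ?thesis using False by simp
  qed (use F(6) in simp)
qed

lemma C1_poly_coord:
  assumes k: "k < n" and "\<And>u. (\<phi> has_real_derivative \<phi>' u) (at u)" "continuous_on UNIV \<phi>'"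
    and "\<And>u. \<bar>\<phi> u\<bar> \<le> C * (1 + \<bar>u\<bar>) ^ p" "\<And>u. \<bar>\<phi>' u\<bar> \<le> D * (1 + \<bar>u\<bar>) ^ r"
  shows "C1_poly n (\<lambda>x. \<phi> (x k)) (\<lambda>j x. if j = k then \<phi>' (x k) else 0)"
  unfolding C1_poly_def
proof (intro conjI allI impI)
  have "continuous_on UNIV \<phi>"
    by (rule DERIV_continuous_on) (rule has_field_derivative_at_within[OF assms(2)])
  then show "continuous_on UNIV (\<lambda>x::nat \<Rightarrow> real. \<phi> (x k))"
    by (rule continuous_on_compose2[OF _ continuous_on_product_coordinates]) simp
  show "poly_growth n (\<lambda>x. \<phi> (x k))" by (rule poly_growth_coord) fact+
  fix j :: nat
  have "continuous_on UNIV (\<lambda>x::nat \<Rightarrow> real. \<phi>' (x k))"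
    by (rule continuous_on_compose2[OF assms(3) continuous_on_product_coordinates]) simp
  then show "continuous_on UNIV (\<lambda>x. if j = k then \<phi>' (x k) else 0)" by (cases "j = k") auto
  show "poly_growth n (\<lambda>x. if j = k then \<phi>' (x k) else 0)"
    using poly_growth_coord[of \<phi>', OF assms(5) k] poly_growth_const[of n 0] by (cases "j = k") auto
  show "((\<lambda>u. \<phi> ((x(j := u)) k)) has_real_derivative (if j = k then \<phi>' (x k) else 0)) (at (x j))" for x
    using assms(2) by (cases "j = k") auto
qed (use k in auto)

lemma C1_poly_one: "C1_poly n (\<lambda>x. 1) (\<lambda>j x. 0)"
  unfolding C1_poly_def by (auto intro: poly_growth_const)

lemma tendsto_coordinatewise:
  fixes xs :: "'b \<Rightarrow> 'i \<Rightarrow> real"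
  assumes "\<And>i. ((\<lambda>n. xs n i) \<longlongrightarrow> x i) F"
  shows "(xs \<longlongrightarrow> x) F"
proof -
  have "limitin (product_topology (\<lambda>i. euclidean) UNIV) xs x F"
    unfolding limitin_componentwise using assms by simp
  then show ?thesis by (simp add: euclidean_product_topology)
qed

lemma borel_measurable_continuous_coords:
  fixes f :: "(nat \<Rightarrow> real) \<Rightarrow> real"
  assumes "continuous_on UNIV f" "\<And>i. W i \<in> borel_measurable M"
  shows "(\<lambda>\<omega>. f (\<lambda>i. W i \<omega>)) \<in> borel_measurable M"
  by (rule measurable_compose[OF measurable_coordinatewise_then_product[of "\<lambda>\<omega> i. W i \<omega>"]
        borel_measurable_continuous_onI[OF assms(1)]]) (use assms(2) in simp)

subsection \<open>The chain rule along a line\<close>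

text \<open>
  The partial derivative in \<open>s\<close> exists everywhere and is continuous at \<open>(t0, t0)\<close>; together with the
  derivative in \<open>t\<close> at that point this gives total differentiability there.
\<close>

lemma DERIV_diagonal:
  fixes g G :: "real \<Rightarrow> real \<Rightarrow> real"
  assumes t: "((\<lambda>t. g t0 t) has_real_derivative D) (at t0)"
    and s: "\<And>s t. ((\<lambda>s. g s t) has_real_derivative G s t) (at s)"
    and cont: "isCont (\<lambda>(t, s). G s t) (t0, t0)"
  shows "((\<lambda>t. g t t) has_real_derivative D + G t0 t0) (at t0)"
proof -
  have "((\<lambda>(t, s). g s t) has_derivative (\<lambda>(tx, ty). tx * D + blinfun_apply (blinfun_mult_right (G t0 t0)) ty))
      (at (t0, t0) within UNIV \<times> UNIV)"
  proof (rule has_derivative_partialsI[where fy = "\<lambda>t s. blinfun_mult_right (G s t)"])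
    show "((\<lambda>t. g t0 t) has_derivative (\<lambda>tx. tx * D)) (at t0)"
      using t by (simp add: has_field_derivative_def mult_commute_abs)
    show "((\<lambda>s. g s t) has_derivative blinfun_apply (blinfun_mult_right (G s t))) (at s)" for s t
      using s[of t s] by (simp add: has_field_derivative_def blinfun_mult_right.rep_eq)
    have "isCont (\<lambda>z. blinfun_mult_right (case z of (t, s) \<Rightarrow> G s t)) (t0, t0)"
      by (rule bounded_linear.isCont[OF bounded_linear_blinfun_mult_right cont])
    then show "continuous (at (t0, t0) within UNIV \<times> UNIV) (\<lambda>(t, s). blinfun_mult_right (G s t))"
      by (simp add: split_beta')
  qed auto
  then have *: "((\<lambda>(t, s). g s t) has_derivative (\<lambda>(tx, ty). tx * D + G t0 t0 * ty)) (at (t0, t0))"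
    by (simp add: blinfun_mult_right.rep_eq)
  have "((\<lambda>t. (t, t)) has_derivative (\<lambda>h. (h, h))) (at t0)"
    by (intro has_derivative_Pair has_derivative_ident)
  from has_derivative_compose[OF this *]
  have "((\<lambda>t. g t t) has_derivative (\<lambda>h. h * D + G t0 t0 * h)) (at t0)" by simp
  also have "(\<lambda>h. h * D + G t0 t0 * h) = (*) (D + G t0 t0)" by (auto simp: algebra_simps)
  finally show ?thesis by (simp add: has_field_derivative_def)
qed

text \<open>
  The coordinates are released one after the other: when the first \<open>m\<close> of them follow the line and the
  next one is released, the derivative is that of a function of two variables along the diagonal.
\<close>

lemma C1_poly_DERIV_line:
  assumes f: "C1_poly n f f'"
  shows "((\<lambda>t. f (\<lambda>i. a i + t * b i)) has_real_derivative (\<Sum>j<n. b j * f' j (\<lambda>i. a i + t0 * b i))) (at t0)"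
proof -
  note F = C1_polyD[OF f]
  define y where "y m x t = (\<lambda>i. if i < m then a i + t * b i else x i)" for m :: nat and x :: "nat \<Rightarrow> real" and t
  have "((\<lambda>t. f (y m x t)) has_real_derivative (\<Sum>j<m. b j * f' j (y m x t0))) (at t0)" if "m \<le> n" for m x
    using that
  proof (induction m arbitrary: x)
    case 0
    then show ?case by (simp add: y_def)
  next
    case (Suc m)
    define w where "w s t = (y m x t)(m := a m + s * b m)" for s t
    have w: "w s t = y m (x(m := a m + s * b m)) t" for s t
      by (auto simp: w_def y_def fun_eq_iff)
    have wd: "w t t = y (Suc m) x t" for t
      by (auto simp: w_def y_def fun_eq_iff less_Suc_eq)
    have "((\<lambda>t. f (w t t)) has_real_derivative (\<Sum>j<m. b j * f' j (w t0 t0)) + b m * f' m (w t0 t0)) (at t0)"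
    proof (rule DERIV_diagonal[where g = "\<lambda>s t. f (w s t)" and G = "\<lambda>s t. b m * f' m (w s t)"])
      show "((\<lambda>t. f (w t0 t)) has_real_derivative (\<Sum>j<m. b j * f' j (w t0 t0))) (at t0)"
        unfolding w using Suc by simp
      show "((\<lambda>s. f (w s t)) has_real_derivative b m * f' m (w s t)) (at s)" for s t
      proof -
        have 1: "((\<lambda>u. f ((w s t)(m := u))) has_real_derivative f' m (w s t)) (at (a m + s * b m))"
          using F(6)[of m "w s t"] Suc.prems by (simp add: w_def)
        have 2: "((\<lambda>s. a m + s * b m) has_real_derivative b m) (at s)"
          by (auto intro!: derivative_eq_intros)
        have "(w s t)(m := a m + s' * b m) = w s' t" for s' by (simp add: w_def)
        with DERIV_chain2[OF 1 2] show ?thesis by (simp add: mult.commute)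
      qed
      have "isCont (\<lambda>z. f' m (w (snd z) (fst z))) (t0, t0)"
      proof -
        have "continuous_on UNIV (\<lambda>z. w (snd z) (fst z) i)" for i
          by (cases "i = m"; cases "i < m") (auto simp: w_def y_def intro!: continuous_intros)
        then have "continuous_on UNIV (\<lambda>z. w (snd z) (fst z))"
          by (rule continuous_on_coordinatewise_then_product)
        from continuous_on_compose2[OF F(4) this] have "continuous_on UNIV (\<lambda>z. f' m (w (snd z) (fst z)))"
          using Suc.prems by simp
        then show ?thesis by (simp add: continuous_on_eq_continuous_at)
      qed
      then show "isCont (\<lambda>(t, s). b m * f' m (w s t)) (t0, t0)"
        unfolding case_prod_beta by (intro continuous_intros)
    qed
    then show ?case by (simp add: wd)
  qed
  from this[of n a] have "((\<lambda>t. f (y n a t)) has_real_derivative (\<Sum>j<n. b j * f' j (y n a t0))) (at t0)" by simp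
  moreover have "f (y n a t) = f (\<lambda>i. a i + t * b i)" for t by (rule F(1)) (simp add: y_def)
  moreover have "f' j (y n a t0) = f' j (\<lambda>i. a i + t0 * b i)" if "j < n" for j
    by (rule C1_poly_gradient_depends[OF f that]) (simp add: y_def)
  ultimately show ?thesis by simp
qed

lemma C1_poly_linear:
  assumes f: "C1_poly n f f'"
  shows "C1_poly N (\<lambda>x. f (\<lambda>i. \<Sum>l<N. d i l * x l)) (\<lambda>k x. \<Sum>j<n. d j k * f' j (\<lambda>i. \<Sum>l<N. d i l * x l))"
proof -
  note F = C1_polyD[OF f]
  have lin: "continuous_on UNIV (\<lambda>x::nat \<Rightarrow> real. (\<lambda>i. \<Sum>l<N. d i l * x l))"
    by (intro continuous_on_coordinatewise_then_product continuous_intros continuous_on_product_coordinates)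
  show ?thesis
    unfolding C1_poly_def
  proof (intro conjI allI impI)
    show "f (\<lambda>i. \<Sum>l<N. d i l * x l) = f (\<lambda>i. \<Sum>l<N. d i l * y l)" if "\<forall>i<N. x i = y i" for x y
      using that by (intro F(1) sum.cong) auto
    show "continuous_on UNIV (\<lambda>x. f (\<lambda>i. \<Sum>l<N. d i l * x l))"
      by (rule continuous_on_compose2[OF F(2) lin]) simp
    show "poly_growth N (\<lambda>x. f (\<lambda>i. \<Sum>l<N. d i l * x l))" by (rule poly_growth_linear[OF F(3)])
    fix k assume k: "k < N"
    show "continuous_on UNIV (\<lambda>x. \<Sum>j<n. d j k * f' j (\<lambda>i. \<Sum>l<N. d i l * x l))"
      by (intro continuous_on_sum continuous_on_mult continuous_on_const
          continuous_on_compose2[OF F(4) lin]) auto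
    show "poly_growth N (\<lambda>x. \<Sum>j<n. d j k * f' j (\<lambda>i. \<Sum>l<N. d i l * x l))"
      by (intro poly_growth_sum poly_growth_mult poly_growth_const poly_growth_linear[OF F(5)]) auto
    fix x :: "nat \<Rightarrow> real"
    have eq: "(\<Sum>l<N. d i l * (x(k := u)) l) = (\<Sum>l<N. d i l * (x(k := 0)) l) + u * d i k" for i u
    proof -
      have "(\<Sum>l<N. d i l * (x(k := u)) l) = (\<Sum>l<N. d i l * (x(k := 0)) l + (if l = k then u * d i k else 0))"
        by (intro sum.cong) auto
      then show ?thesis using k by (simp add: sum.distrib)
    qed
    have "((\<lambda>t. f (\<lambda>i. (\<Sum>l<N. d i l * (x(k := 0)) l) + t * d i k)) has_real_derivative
        (\<Sum>j<n. d j k * f' j (\<lambda>i. (\<Sum>l<N. d i l * (x(k := 0)) l) + x k * d i k))) (at (x k))"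
      by (rule C1_poly_DERIV_line[OF f])
    then show "((\<lambda>u. f (\<lambda>i. \<Sum>l<N. d i l * (x(k := u)) l)) has_real_derivative
        (\<Sum>j<n. d j k * f' j (\<lambda>i. \<Sum>l<N. d i l * x l))) (at (x k))"
      unfolding eq[symmetric] by simp
  qed
qed

section \<open>Gaussian integration by parts\<close>

abbreviation centred_normal :: "real \<Rightarrow> real measure" where
  "centred_normal \<sigma> \<equiv> density lborel (\<lambda>x. ennreal (normal_density 0 \<sigma> x))"

lemma centred_normal_bounded_moments:
  assumes "\<sigma> > 0"
  shows "bounded_moments (centred_normal \<sigma>) (\<lambda>m x. x)"
proof (rule bounded_momentsI)
  fix p :: nat
  have int: "integrable (centred_normal \<sigma>) (\<lambda>x. x ^ k)" for k
    using integrable_normal_moment[OF assms, of 0 k] by (subst integrable_real_density) auto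
  interpret prob_space "centred_normal \<sigma>" by (rule prob_space_normal_density[OF assms])
  note le = abs_power_le_even_power[of _ p]
  show "\<exists>Ys K. \<forall>m. integrable (centred_normal \<sigma>) (Ys m) \<and> (\<integral>x. Ys m x \<partial>centred_normal \<sigma>) \<le> K \<and>
      (\<forall>x. \<bar>x\<bar> ^ p \<le> Ys m x)"
    using int[of "2*p"] le
    by (intro exI[of _ "\<lambda>m x. 1 + x ^ (2 * p)"] exI[of _ "\<integral>x. 1 + x ^ (2 * p) \<partial>centred_normal \<sigma>"]) auto
qed simp

lemma integrable_centred_normal:
  assumes "\<sigma> > 0" and "g \<in> borel_measurable borel" and "\<And>x. \<bar>g x\<bar> \<le> C * (1 + \<bar>x\<bar>) ^ p"
  shows "integrable (centred_normal \<sigma>) g"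
proof -
  interpret prob_space "centred_normal \<sigma>" by (rule prob_space_normal_density[OF assms(1)])
  have "bounded_moments (centred_normal \<sigma>) (\<lambda>m x. C * (1 + \<bar>x\<bar>) ^ p)"
    by (intro bounded_moments_cmult bounded_moments_power bounded_moments_add bounded_moments_const
        bounded_moments_abs centred_normal_bounded_moments assms)
  then have "integrable (centred_normal \<sigma>) (\<lambda>x. C * (1 + \<bar>x\<bar>) ^ p)" by (rule bounded_momentsD(3))
  then show ?thesis
    by (rule Bochner_Integration.integrable_bound)
       (use assms(2,3) in \<open>auto intro!: AE_I2 order_trans[OF _ abs_ge_self]\<close>)
qed

lemma normal_density_decay:
  assumes "\<sigma> > 0"
  shows "((\<lambda>x. (1 + x) ^ p * normal_density 0 \<sigma> x) \<longlongrightarrow> 0) at_top"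
proof -
  have "((\<lambda>x. (1 + x) ^ p * exp (- (x\<^sup>2) / (2 * \<sigma>\<^sup>2))) \<longlongrightarrow> 0) at_top"
    using assms by real_asymp
  from tendsto_mult_left_zero[OF this, of "1 / sqrt (2 * pi * \<sigma>\<^sup>2)"] show ?thesis
    by (simp add: normal_density_def mult_ac)
qed

text \<open>
  The density of \<open>N(0, \<sigma>\<^sup>2)\<close> satisfies \<open>\<sigma>\<^sup>2 n' = - x n\<close>, so \<open>n (\<sigma>\<^sup>2 \<phi>' - x \<phi>)\<close> is the derivative of
  \<open>\<sigma>\<^sup>2 n \<phi>\<close>, which vanishes at both ends of the line.
\<close>

lemma centred_normal_integration_by_parts:
  assumes \<sigma>: "\<sigma> > 0" and deriv: "\<And>x. (\<phi> has_real_derivative \<phi>' x) (at x)"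
    and cont: "continuous_on UNIV \<phi>'"
    and g0: "\<And>x. \<bar>\<phi> x\<bar> \<le> C * (1 + \<bar>x\<bar>) ^ p" and g1: "\<And>x. \<bar>\<phi>' x\<bar> \<le> D * (1 + \<bar>x\<bar>) ^ r"
  shows "(\<integral>x. x * \<phi> x \<partial>centred_normal \<sigma>) = \<sigma>\<^sup>2 * (\<integral>x. \<phi>' x \<partial>centred_normal \<sigma>)"
proof -
  let ?n = "normal_density 0 \<sigma>"
  have cont0: "continuous_on UNIV \<phi>"
    by (rule DERIV_continuous_on) (rule has_field_derivative_at_within[OF deriv])
  note [measurable] = borel_measurable_continuous_onI[OF cont0] borel_measurable_continuous_onI[OF cont]
  have i1: "integrable (centred_normal \<sigma>) (\<lambda>x. x * \<phi> x)"
  proof (rule integrable_centred_normal[OF \<sigma>])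
    fix x :: real
    have "\<bar>x\<bar> * \<bar>\<phi> x\<bar> \<le> (1 + \<bar>x\<bar>) * (C * (1 + \<bar>x\<bar>) ^ p)" using g0[of x] by (intro mult_mono) auto
    then show "\<bar>x * \<phi> x\<bar> \<le> C * (1 + \<bar>x\<bar>) ^ Suc p" by (simp add: abs_mult mult_ac)
  qed measurable
  have i2: "integrable (centred_normal \<sigma>) \<phi>'" by (rule integrable_centred_normal[OF \<sigma> _ g1]) measurable
  define f where "f x = ?n x * (\<sigma>\<^sup>2 * \<phi>' x - x * \<phi> x)" for x
  define F where "F x = \<sigma>\<^sup>2 * (\<phi> x * ?n x)" for x
  have intf: "integrable lborel f"
  proof -
    have "integrable (centred_normal \<sigma>) (\<lambda>x. \<sigma>\<^sup>2 * \<phi>' x - x * \<phi> x)" using i1 i2 by simp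
    then show ?thesis unfolding f_def by (subst (asm) integrable_real_density) auto
  qed
  have dn: "(?n has_real_derivative - (x / \<sigma>\<^sup>2) * ?n x) (at x)" for x
    unfolding normal_density_def using \<sigma>
    by (auto intro!: derivative_eq_intros simp: power2_eq_square field_simps)
  have dF: "(F has_real_derivative f x) (at x)" for x
  proof -
    have "(F has_real_derivative \<sigma>\<^sup>2 * (\<phi>' x * ?n x + (- (x / \<sigma>\<^sup>2) * ?n x) * \<phi> x)) (at x)"
      unfolding F_def by (intro DERIV_cmult DERIV_mult deriv dn)
    also have "\<sigma>\<^sup>2 * (\<phi>' x * ?n x + (- (x / \<sigma>\<^sup>2) * ?n x) * \<phi> x) = f x"
      using \<sigma> by (simp add: f_def field_simps)
    finally show ?thesis .
  qed
  have cf: "isCont f x" for x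
  proof -
    have "isCont ?n x" by (rule DERIV_isCont[OF dn])
    moreover have "isCont \<phi> x" by (rule DERIV_isCont[OF deriv])
    moreover have "isCont \<phi>' x" using cont by (simp add: continuous_on_eq_continuous_at)
    ultimately show ?thesis unfolding f_def by (intro continuous_intros)
  qed
  have lim1: "(\<lambda>m. \<integral>x. f x * indicator {- real m .. real m} x \<partial>lborel) \<longlonglongrightarrow> (\<integral>x. f x \<partial>lborel)"
  proof (rule integral_dominated_convergence[where w = "\<lambda>x. \<bar>f x\<bar>"])
    show "AE x in lborel. (\<lambda>m. f x * indicator {- real m .. real m} x) \<longlonglongrightarrow> f x"
    proof (rule AE_I2, rule tendsto_eventually)
      fix x
      obtain N where N: "\<bar>x\<bar> \<le> real N" using real_arch_simple by blast
      show "\<forall>\<^sub>F m in sequentially. f x * indicator {- real m .. real m} x = f x"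
        using eventually_ge_at_top[of N]
      proof eventually_elim
        case (elim m)
        then have "\<bar>x\<bar> \<le> real m" using N by linarith
        then show ?case by (auto simp: indicator_def abs_le_iff)
      qed
    qed
  qed (use intf in \<open>auto simp: indicator_def\<close>)
  have "(\<integral>x. f x * indicator {- real m .. real m} x \<partial>lborel) = F (real m) - F (- real m)" for m
    by (rule integral_FTC_Icc_real) (use dF cf in auto)
  moreover have "(\<lambda>m. F (real m) - F (- real m)) \<longlonglongrightarrow> 0"
  proof -
    have "((\<lambda>m. (1 + real m) ^ p * ?n (real m)) \<longlongrightarrow> 0) sequentially"
      by (rule filterlim_compose[OF normal_density_decay[OF \<sigma>] filterlim_real_sequentially])
    from tendsto_mult_right_zero[OF this, of "2 * \<sigma>\<^sup>2 * C"]
    have lim: "((\<lambda>m. 2 * \<sigma>\<^sup>2 * C * ((1 + real m) ^ p * ?n (real m))) \<longlongrightarrow> 0) sequentially" .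
    show ?thesis
    proof (rule Lim_null_comparison[OF always_eventually lim], rule allI)
      fix m :: nat
      have b: "\<bar>F x\<bar> \<le> \<sigma>\<^sup>2 * (C * (1 + real m) ^ p * ?n (real m))" if x: "\<bar>x\<bar> = real m" for x
      proof -
        have "?n x = ?n \<bar>x\<bar>" by (simp add: normal_density_def)
        then have "?n x = ?n (real m)" using x by simp
        moreover have "\<bar>\<phi> x\<bar> \<le> C * (1 + real m) ^ p" using g0[of x] x by simp
        ultimately show ?thesis
          unfolding F_def abs_mult by (intro mult_mono) auto
      qed
      have "\<bar>F (real m) - F (- real m)\<bar> \<le> \<bar>F (real m)\<bar> + \<bar>F (- real m)\<bar>" by simp
      also have "\<dots> \<le> 2 * (\<sigma>\<^sup>2 * (C * (1 + real m) ^ p * ?n (real m)))"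
        using b[of "real m"] b[of "- real m"] by simp
      finally show "norm (F (real m) - F (- real m)) \<le> 2 * \<sigma>\<^sup>2 * C * ((1 + real m) ^ p * ?n (real m))"
        by (simp add: mult_ac)
    qed
  qed
  ultimately have "(\<integral>x. f x \<partial>lborel) = 0" using lim1 by (simp add: LIMSEQ_unique)
  moreover have "(\<integral>x. f x \<partial>lborel) = (\<integral>x. \<sigma>\<^sup>2 * \<phi>' x - x * \<phi> x \<partial>centred_normal \<sigma>)"
    unfolding f_def by (subst integral_real_density) auto
  ultimately show ?thesis using i1 i2 by simp
qed

lemma poly_growth_slice:
  assumes "poly_growth n f" "k < n"
  shows "\<exists>C p. \<forall>u. \<bar>f (x(k := u))\<bar> \<le> C * (1 + \<bar>u\<bar>) ^ p"
proof -
  obtain C p where C: "C \<ge> 0" "\<And>x. \<bar>f x\<bar> \<le> C * (1 + (\<Sum>i<n. \<bar>x i\<bar>)) ^ p" using assms(1) by (rule poly_growthE) blast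
  define S where "S = (\<Sum>i<n. \<bar>x i\<bar>)"
  have S: "S \<ge> 0" by (simp add: S_def sum_nonneg)
  have "\<bar>f (x(k := u))\<bar> \<le> (C * (1 + S) ^ p) * (1 + \<bar>u\<bar>) ^ p" for u
  proof -
    have "(\<Sum>i<n. \<bar>(x(k := u)) i\<bar>) \<le> (\<Sum>i<n. \<bar>x i\<bar> + (if i = k then \<bar>u\<bar> else 0))"
      by (intro sum_mono) auto
    also have "\<dots> = S + \<bar>u\<bar>" using assms(2) by (simp add: sum.distrib S_def)
    finally have "(\<Sum>i<n. \<bar>(x(k := u)) i\<bar>) \<le> S + \<bar>u\<bar>" .
    moreover have "(1 + S) * (1 + \<bar>u\<bar>) = 1 + S + \<bar>u\<bar> + S * \<bar>u\<bar>" by (simp add: algebra_simps)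
    moreover have "0 \<le> S * \<bar>u\<bar>" using S by simp
    ultimately have "1 + (\<Sum>i<n. \<bar>(x(k := u)) i\<bar>) \<le> (1 + S) * (1 + \<bar>u\<bar>)" by linarith
    then have "C * (1 + (\<Sum>i<n. \<bar>(x(k := u)) i\<bar>)) ^ p \<le> C * ((1 + S) * (1 + \<bar>u\<bar>)) ^ p"
      using C(1) by (intro mult_left_mono power_mono) (auto simp: sum_nonneg)
    with C(2)[of "x(k := u)"] show ?thesis by (simp add: power_mult_distrib mult_ac)
  qed
  then show ?thesis by blast
qed

text \<open>Fubini's theorem reduces independent coordinates to integration by parts in one of them.\<close>

lemma (in prob_space) independent_normal_integration_by_parts:
  assumes indep: "indep_vars (\<lambda>_. borel) X {..<N}"
    and dist: "\<And>k. k < N \<Longrightarrow> distributed M lborel (X k) (normal_density 0 (\<sigma> k))"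
    and \<sigma>: "\<And>k. k < N \<Longrightarrow> \<sigma> k > 0"
    and f: "C1_poly N f f'" and k: "k < N"
    and mom: "\<And>i. i < N \<Longrightarrow> bounded_moments M (\<lambda>m::nat. X i)"
  shows "expectation (\<lambda>\<omega>. X k \<omega> * f (\<lambda>i. X i \<omega>)) = (\<sigma> k)\<^sup>2 * expectation (\<lambda>\<omega>. f' k (\<lambda>i. X i \<omega>))"
proof -
  note F = C1_polyD[OF f]
  \<comment> \<open>The value 1 beyond \<open>N\<close> makes every factor of the product a probability measure.\<close>
  define \<nu> where "\<nu> i = centred_normal (if i < N then \<sigma> i else 1)" for i
  have [measurable_cong]: "sets (\<nu> i) = sets borel" for i by (simp add: \<nu>_def)
  have prob: "prob_space (\<nu> i)" for i
    unfolding \<nu>_def using \<sigma> by (intro prob_space_normal_density) auto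
  interpret \<nu>: product_prob_space \<nu> UNIV
    by (rule product_prob_spaceI) (rule prob)
  have meas: "X i \<in> borel_measurable M" if "i < N" for i
    using dist[OF that] by (auto simp: distributed_def)
  have meas_f: "(\<lambda>x. h x) \<in> borel_measurable (PiM {..<N} \<nu>)"
    if "continuous_on UNIV h" "\<And>x y. (\<And>i. i < N \<Longrightarrow> x i = y i) \<Longrightarrow> h x = h y" for h :: "(nat \<Rightarrow> real) \<Rightarrow> real"
  proof -
    have "(\<lambda>x. h (\<lambda>i. if i < N then x i else 0)) \<in> borel_measurable (PiM {..<N} \<nu>)"
    proof (rule borel_measurable_continuous_coords[OF that(1)])
      show "(\<lambda>x. if i < N then x i else 0) \<in> borel_measurable (PiM {..<N} \<nu>)" for i
        by (cases "i < N") auto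
    qed
    moreover have "h x = h (\<lambda>i. if i < N then x i else 0)" for x
      by (rule that(2)) simp
    ultimately show ?thesis by simp
  qed
  define T where "T \<omega> = (\<lambda>i\<in>{..<N}. X i \<omega>)" for \<omega>
  have T: "T \<in> measurable M (PiM {..<N} \<nu>)"
    unfolding T_def using meas by (intro measurable_restrict) auto
  have law: "distr M (PiM {..<N} \<nu>) T = PiM {..<N} \<nu>"
  proof -
    have "distr M (PiM {..<N} (\<lambda>_. borel)) (\<lambda>\<omega>. \<lambda>i\<in>{..<N}. X i \<omega>) = (\<Pi>\<^sub>M i\<in>{..<N}. distr M borel (X i))"
      using indep k meas by (subst indep_vars_iff_distr_eq_PiM'[symmetric]) auto
    also have "\<dots> = PiM {..<N} \<nu>"
    proof (rule PiM_cong)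
      fix i assume "i \<in> {..<N}"
      then have i: "i < N" by simp
      have "distr M borel (X i) = distr M lborel (X i)" by (rule distr_cong) auto
      also have "\<dots> = \<nu> i" using distributed_distr_eq_density[OF dist[OF i]] i by (simp add: \<nu>_def)
      finally show "distr M borel (X i) = \<nu> i" .
    qed simp
    also have "distr M (PiM {..<N} (\<lambda>_. borel)) (\<lambda>\<omega>. \<lambda>i\<in>{..<N}. X i \<omega>) = distr M (PiM {..<N} \<nu>) T"
      unfolding T_def by (intro distr_cong refl sets_PiM_cong) (simp_all add: \<nu>_def)
    finally show ?thesis .
  qed
  have transfer: "expectation (\<lambda>\<omega>. h (\<lambda>i. X i \<omega>)) = (\<integral>x. h x \<partial>PiM {..<N} \<nu>)"
    and transfer_int: "integrable (PiM {..<N} \<nu>) h"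
    if h: "continuous_on UNIV h" "\<And>x y. (\<And>i. i < N \<Longrightarrow> x i = y i) \<Longrightarrow> h x = h y" "poly_growth N h"
    for h :: "(nat \<Rightarrow> real) \<Rightarrow> real"
  proof -
    have eq: "h (T \<omega>) = h (\<lambda>i. X i \<omega>)" for \<omega> by (rule h(2)) (simp add: T_def)
    have m: "h \<in> borel_measurable (PiM {..<N} \<nu>)" using meas_f[OF h(1,2)] by simp
    have "(\<integral>x. h x \<partial>distr M (PiM {..<N} \<nu>) T) = expectation (\<lambda>\<omega>. h (T \<omega>))"
      by (rule integral_distr[OF T m])
    then show "expectation (\<lambda>\<omega>. h (\<lambda>i. X i \<omega>)) = (\<integral>x. h x \<partial>PiM {..<N} \<nu>)"
      by (simp add: law eq)
    have "bounded_moments M (\<lambda>m::nat. \<lambda>\<omega>. h (\<lambda>i. X i \<omega>))"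
    proof (rule bounded_moments_poly_growth[OF h(3) mom])
      show "(\<lambda>\<omega>. h (\<lambda>i. X i \<omega>)) \<in> borel_measurable M"
        using measurable_compose[OF T m] by (simp add: eq)
    qed
    then have "integrable M (\<lambda>\<omega>. h (T \<omega>))" unfolding eq by (rule bounded_momentsD(3))
    then have "integrable (distr M (PiM {..<N} \<nu>) T) h" by (subst integrable_distr_eq[OF T m])
    then show "integrable (PiM {..<N} \<nu>) h" by (simp add: law)
  qed
  have ins: "insert k ({..<N} - {k}) = {..<N}" using k by auto
  have slice: "(\<integral>x. h x \<partial>PiM {..<N} \<nu>) = (\<integral>x. (\<integral>y. h (x(k := y)) \<partial>\<nu> k) \<partial>PiM ({..<N} - {k}) \<nu>)"
    if "integrable (PiM {..<N} \<nu>) h" for h :: "(nat \<Rightarrow> real) \<Rightarrow> real"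
    using \<nu>.product_integral_insert[of "{..<N} - {k}" k h] that unfolding ins by simp
  have c1: "continuous_on UNIV (\<lambda>x. x k * f x)"
    by (intro continuous_intros F(2)) simp
  have d1: "x k * f x = y k * f y" if "\<And>i. i < N \<Longrightarrow> x i = y i" for x y
    using that k F(1)[of x y] by simp
  have p1: "poly_growth N (\<lambda>x. x k * f x)"
    by (intro poly_growth_mult F(3) poly_growth_coord[where \<phi> = "\<lambda>u. u" and C = 1 and p = 1] k) simp
  have d2: "f' k x = f' k y" if "\<And>i. i < N \<Longrightarrow> x i = y i" for x y
    by (rule C1_poly_gradient_depends[OF f k that])
  have inner: "(\<integral>y. (x(k := y)) k * f (x(k := y)) \<partial>\<nu> k) = (\<sigma> k)\<^sup>2 * (\<integral>y. f' k (x(k := y)) \<partial>\<nu> k)" for x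
  proof -
    obtain C p where C: "\<And>u. \<bar>f (x(k := u))\<bar> \<le> C * (1 + \<bar>u\<bar>) ^ p"
      using poly_growth_slice[OF F(3) k, of x] by blast
    obtain D r where D: "\<And>u. \<bar>f' k (x(k := u))\<bar> \<le> D * (1 + \<bar>u\<bar>) ^ r"
      using poly_growth_slice[OF F(5)[OF k] k, of x] by blast
    have "(\<integral>y. y * f (x(k := y)) \<partial>centred_normal (\<sigma> k)) = (\<sigma> k)\<^sup>2 * (\<integral>y. f' k (x(k := y)) \<partial>centred_normal (\<sigma> k))"
    proof (rule centred_normal_integration_by_parts[OF \<sigma>[OF k] _ _ C D])
      show "((\<lambda>y. f (x(k := y))) has_real_derivative f' k (x(k := y))) (at y)" for y
        using F(6)[OF k, of "x(k := y)"] by simp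
      have "continuous_on UNIV (\<lambda>y. (x(k := y)))"
      proof (rule continuous_on_coordinatewise_then_product)
        show "continuous_on UNIV (\<lambda>y. (x(k := y)) i)" for i
          by (cases "i = k") (auto intro: continuous_intros)
      qed
      then show "continuous_on UNIV (\<lambda>y. f' k (x(k := y)))"
        by (rule continuous_on_compose2[OF F(4)[OF k]]) simp
    qed
    then show ?thesis using k by (simp add: \<nu>_def)
  qed
  have "expectation (\<lambda>\<omega>. X k \<omega> * f (\<lambda>i. X i \<omega>)) = (\<integral>x. x k * f x \<partial>PiM {..<N} \<nu>)"
    by (rule transfer[OF c1 d1 p1])
  also have "\<dots> = (\<integral>x. (\<integral>y. (x(k := y)) k * f (x(k := y)) \<partial>\<nu> k) \<partial>PiM ({..<N} - {k}) \<nu>)"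
    by (rule slice[OF transfer_int[OF c1 d1 p1]])
  also have "\<dots> = (\<sigma> k)\<^sup>2 * (\<integral>x. (\<integral>y. f' k (x(k := y)) \<partial>\<nu> k) \<partial>PiM ({..<N} - {k}) \<nu>)"
    unfolding inner by simp
  also have "(\<integral>x. (\<integral>y. f' k (x(k := y)) \<partial>\<nu> k) \<partial>PiM ({..<N} - {k}) \<nu>) = (\<integral>x. f' k x \<partial>PiM {..<N} \<nu>)"
    by (rule slice[OF transfer_int[OF F(4)[OF k] d2 F(5)[OF k]], symmetric])
  also have "\<dots> = expectation (\<lambda>\<omega>. f' k (\<lambda>i. X i \<omega>))"
    by (rule transfer[OF F(4)[OF k] d2 F(5)[OF k], symmetric])
  finally show ?thesis .
qed

section \<open>Processes with Brownian increments\<close>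

text \<open>
  Wiener integrals, and with them all functionals considered here, see a process through its
  increments only.
\<close>

locale brownian_increments = prob_space M for M :: "'a measure" +
  fixes B :: "real \<Rightarrow> 'a \<Rightarrow> real"
  assumes process_measurable: "B t \<in> borel_measurable M"
    and increment_normal:
      "s < t \<Longrightarrow> distributed M lborel (\<lambda>\<omega>. B t \<omega> - B s \<omega>) (normal_density 0 (sqrt (t - s)))"
    and increments_independent:
      "(\<And>i. i < n \<Longrightarrow> \<tau> i < \<tau> (Suc i)) \<Longrightarrow>
         indep_vars (\<lambda>_. borel) (\<lambda>i \<omega>. B (\<tau> (Suc i)) \<omega> - B (\<tau> i) \<omega>) {..<(n::nat)}"

lemma two_sided_brownian_motion_increments:
  assumes "two_sided_brownian_motion M B"
  shows "brownian_increments M B"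
proof -
  interpret two_sided_brownian_motion M B by fact
  show ?thesis by unfold_locales (rule BM_measurable BM_increments BM_independent; assumption)+
qed

subsection \<open>Step functions on a common partition\<close>

lemma finite_subset_partition:
  fixes S :: "real set"
  assumes "finite S"
  shows "\<exists>(N::nat) \<tau>. strict_mono \<tau> \<and> S \<subseteq> \<tau> ` {..N}"
proof -
  define S' where "S' = insert 0 S"
  have fin: "finite S'" using assms by (simp add: S'_def)
  define xs where "xs = sorted_list_of_set S'"
  have xs: "sorted_wrt (<) xs" "set xs = insert 0 S"
    unfolding S'_def[symmetric] using fin by (simp_all add: xs_def)
  then have len: "length xs > 0" by (auto simp del: length_greater_0_conv simp: length_pos_if_in_set)
  define \<tau> where "\<tau> k = (if k < length xs then xs ! k else last xs + real k)" for k
  have "\<tau> k < \<tau> (Suc k)" for k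
  proof (cases "Suc k < length xs")
    case True
    then show ?thesis using xs(1) by (simp add: \<tau>_def sorted_wrt_iff_nth_less)
  next
    case False
    show ?thesis
    proof (cases "k < length xs")
      case True
      then have "k = length xs - 1" using False by simp
      then show ?thesis using len by (simp add: \<tau>_def last_conv_nth)
    qed (simp add: \<tau>_def)
  qed
  then have "strict_mono \<tau>" by (simp add: strict_mono_Suc_iff)
  moreover have "S \<subseteq> \<tau> ` {..length xs}"
  proof
    fix s assume "s \<in> S"
    then have "s \<in> set xs" using xs(2) by simp
    then obtain k where "k < length xs" "xs ! k = s" by (auto simp: in_set_conv_nth)
    then show "s \<in> \<tau> ` {..length xs}" by (intro image_eqI[of _ _ k]) (auto simp: \<tau>_def)
  qed
  ultimately show ?thesis by blast
qed

text \<open>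
  The difference is a sum of increments between the two indices, written with coefficients that
  do not depend on the sequence \<open>b\<close>: the same coefficients serve for step functions and for their
  integrals.
\<close>

lemma partition_telescope:
  fixes b :: "nat \<Rightarrow> real"
  assumes "i \<le> N" "j \<le> N"
  shows "b i - b j = (\<Sum>k<N. (of_bool (k < i) - of_bool (k < j)) * (b (Suc k) - b k))"
proof -
  have "(\<Sum>k<N. of_bool (k < i) * (b (Suc k) - b k)) = b i - b 0" if "i \<le> N" for i
  proof -
    have "(\<Sum>k<N. of_bool (k < i) * (b (Suc k) - b k)) = (\<Sum>k<i. b (Suc k) - b k)"
      using that by (intro sum.mono_neutral_cong_right) auto
    then show ?thesis by (simp add: sum_lessThan_telescope)
  qed
  from this[OF assms(1)] this[OF assms(2)] show ?thesis
    by (simp add: left_diff_distrib sum_subtractf)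
qed

lemma step_integrals_common_partition:
  fixes n :: nat
  assumes "\<And>i. i < n \<Longrightarrow> step_integral B (h i) (W i)"
  shows "\<exists>(N::nat) \<tau> d. strict_mono \<tau> \<and>
     (\<forall>i<n. h i = (\<lambda>r. \<Sum>k<N. d i k * indicator {\<tau> k<..\<tau> (Suc k)} r) \<and>
            W i = (\<lambda>\<omega>. \<Sum>k<N. d i k * (B (\<tau> (Suc k)) \<omega> - B (\<tau> k) \<omega>)))"
proof -
  have "\<forall>i. \<exists>m c a b. i < n \<longrightarrow> (\<forall>l<m::nat. a l \<le> b l) \<and>
        h i = (\<lambda>r. \<Sum>l<m. c l * indicator {a l<..b l} r) \<and>
        W i = (\<lambda>\<omega>. \<Sum>l<m. c l * (B (b l) \<omega> - B (a l) \<omega>))"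
    using assms unfolding step_integral_def by blast
  then obtain m c a b where st: "\<And>i. i < n \<Longrightarrow> (\<forall>l<m i::nat. a i l \<le> b i l) \<and>
        h i = (\<lambda>r. \<Sum>l<m i. c i l * indicator {a i l<..b i l} r) \<and>
        W i = (\<lambda>\<omega>. \<Sum>l<m i. c i l * (B (b i l) \<omega> - B (a i l) \<omega>))"
    unfolding choice_iff by blast
  have st1: "a i l \<le> b i l" if "i < n" "l < m i" for i l using st that by blast
  have st2: "h i = (\<lambda>r. \<Sum>l<m i. c i l * indicator {a i l<..b i l} r)" if "i < n" for i
    using st that by blast
  define S where "S = (\<Union>i<n. \<Union>l<m i. {a i l, b i l})"
  have "finite S" unfolding S_def by (intro finite_UN_I) auto
  from finite_subset_partition[OF this] obtain N :: nat and \<tau> :: "nat \<Rightarrow> real"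
    where \<tau>: "strict_mono \<tau>" "S \<subseteq> \<tau> ` {..N}" by blast
  have "\<forall>s. \<exists>k. s \<in> S \<longrightarrow> k \<le> N \<and> \<tau> k = s" using \<tau>(2) by blast
  then obtain \<kappa> where \<kappa>: "\<And>s. s \<in> S \<Longrightarrow> \<kappa> s \<le> N \<and> \<tau> (\<kappa> s) = s"
    unfolding choice_iff by blast
  define e where "e i l k = (of_bool (k < \<kappa> (b i l)) - of_bool (k < \<kappa> (a i l)) :: real)" for i l k
  define d where "d i k = (\<Sum>l<m i. c i l * e i l k)" for i k
  have gen: "(\<Sum>l<m i. c i l * (v (b i l) - v (a i l))) = (\<Sum>k<N. d i k * (v (\<tau> (Suc k)) - v (\<tau> k)))"
    if "i < n" for i and v :: "real \<Rightarrow> real"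
  proof -
    have "v (b i l) - v (a i l) = (\<Sum>k<N. e i l k * (v (\<tau> (Suc k)) - v (\<tau> k)))" if l: "l < m i" for l
    proof -
      have "b i l \<in> S" "a i l \<in> S" using l \<open>i < n\<close> by (auto simp: S_def)
      then show ?thesis
        using partition_telescope[of "\<kappa> (b i l)" N "\<kappa> (a i l)" "\<lambda>k. v (\<tau> k)"] \<kappa>
        by (simp add: e_def)
    qed
    then have "(\<Sum>l<m i. c i l * (v (b i l) - v (a i l))) =
        (\<Sum>l<m i. \<Sum>k<N. c i l * e i l k * (v (\<tau> (Suc k)) - v (\<tau> k)))"
      by (intro sum.cong) (auto simp: sum_distrib_left mult.assoc)
    also have "\<dots> = (\<Sum>k<N. \<Sum>l<m i. c i l * e i l k * (v (\<tau> (Suc k)) - v (\<tau> k)))" by (rule sum.swap)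
    also have "\<dots> = (\<Sum>k<N. d i k * (v (\<tau> (Suc k)) - v (\<tau> k)))" by (simp add: d_def sum_distrib_right)
    finally show ?thesis .
  qed
  have ind: "indicator {x<..y} r = of_bool (r \<le> y) - (of_bool (r \<le> x) :: real)" if "x \<le> y" for x y r :: real
    using that by (auto simp: indicator_def)
  have "h i = (\<lambda>r. \<Sum>k<N. d i k * indicator {\<tau> k<..\<tau> (Suc k)} r)" if i: "i < n" for i
  proof
    fix r
    have "h i r = (\<Sum>l<m i. c i l * (of_bool (r \<le> b i l) - of_bool (r \<le> a i l)))"
      unfolding st2[OF i] by (intro sum.cong refl) (simp only: ind[OF st1[OF i]] lessThan_iff)
    also have "\<dots> = (\<Sum>k<N. d i k * (of_bool (r \<le> \<tau> (Suc k)) - of_bool (r \<le> \<tau> k)))"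
      by (rule gen[OF i, of "\<lambda>y. of_bool (r \<le> y)"])
    also have "\<dots> = (\<Sum>k<N. d i k * indicator {\<tau> k<..\<tau> (Suc k)} r)"
      using \<tau>(1) by (simp add: ind strict_mono_less_eq)
    finally show "h i r = (\<Sum>k<N. d i k * indicator {\<tau> k<..\<tau> (Suc k)} r)" .
  qed
  moreover have "W i = (\<lambda>\<omega>. \<Sum>k<N. d i k * (B (\<tau> (Suc k)) \<omega> - B (\<tau> k) \<omega>))" if i: "i < n" for i
  proof
    fix \<omega>
    show "W i \<omega> = (\<Sum>k<N. d i k * (B (\<tau> (Suc k)) \<omega> - B (\<tau> k) \<omega>))"
      using st[OF i] gen[OF i, of "\<lambda>t. B t \<omega>"] by simp
  qed
  ultimately show ?thesis using \<tau>(1) by (intro exI[of _ N] exI[of _ \<tau>] exI[of _ d]) blast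
qed

lemma integral_partition_step_product:
  fixes \<tau> :: "nat \<Rightarrow> real"
  assumes "strict_mono \<tau>"
  shows "(\<integral>r. (\<Sum>k<N. d k * indicator {\<tau> k<..\<tau> (Suc k)} r) * (\<Sum>k<N. e k * indicator {\<tau> k<..\<tau> (Suc k)} r) \<partial>lborel)
    = (\<Sum>k<N. d k * e k * (\<tau> (Suc k) - \<tau> k))"
proof -
  let ?I = "\<lambda>k. {\<tau> k<..\<tau> (Suc k)}"
  have disj: "indicator (?I k) r * indicator (?I l) r = (if k = l then indicator (?I k) r else (0::real))" for k l r
  proof (cases "k = l")
    case False
    have "?I k \<inter> ?I l = {}"
    proof -
      have "\<tau> (Suc k) \<le> \<tau> l \<or> \<tau> (Suc l) \<le> \<tau> k"
        using False assms by (auto simp: strict_mono_less_eq)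
      then show ?thesis by auto
    qed
    then show ?thesis using False by (auto simp: indicator_def)
  qed (auto simp: indicator_def)
  have "(\<Sum>k<N. d k * indicator (?I k) r) * (\<Sum>k<N. e k * indicator (?I k) r)
      = (\<Sum>k<N. d k * e k * indicator (?I k) r)" for r
  proof -
    have "(\<Sum>k<N. d k * indicator (?I k) r) * (\<Sum>k<N. e k * indicator (?I k) r)
      = (\<Sum>k<N. \<Sum>l<N. d k * e l * (indicator (?I k) r * indicator (?I l) r))"
      unfolding sum_product by (intro sum.cong refl) (simp only: mult_ac)
    also have "\<dots> = (\<Sum>k<N. \<Sum>l<N. if k = l then d k * e l * indicator (?I k) r else 0)"
      unfolding disj by (intro sum.cong) auto
    also have "\<dots> = (\<Sum>k<N. d k * e k * indicator (?I k) r)" by simp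
    finally show ?thesis .
  qed
  then have "(\<integral>r. (\<Sum>k<N. d k * indicator (?I k) r) * (\<Sum>k<N. e k * indicator (?I k) r) \<partial>lborel)
      = (\<integral>r. (\<Sum>k<N. d k * e k * indicator (?I k) r) \<partial>lborel)"
    by (simp only:)
  also have "\<dots> = (\<Sum>k<N. \<integral>r. d k * e k * indicator (?I k) r \<partial>lborel)"
    by (rule Bochner_Integration.integral_sum, intro integrable_mult_right integrable_real_indicator)
       (use assms in \<open>auto simp: strict_mono_less_eq\<close>)
  also have "\<dots> = (\<Sum>k<N. d k * e k * (\<tau> (Suc k) - \<tau> k))"
    using assms by (intro sum.cong refl) (simp add: strict_mono_less_eq)
  finally show ?thesis .
qed

context brownian_increments
begin

lemma increment_bounded_moments:
  assumes "s < t"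
  shows "bounded_moments M (\<lambda>m::nat. \<lambda>\<omega>. B t \<omega> - B s \<omega>)"
proof -
  let ?X = "\<lambda>\<omega>. B t \<omega> - B s \<omega>"
  note [measurable] = process_measurable
  have law: "distr M lborel ?X = centred_normal (sqrt (t - s))"
    by (rule distributed_distr_eq_density[OF increment_normal[OF assms]])
  have "integrable M (\<lambda>\<omega>. \<bar>?X \<omega>\<bar> ^ p)" for p
  proof -
    have "integrable (centred_normal (sqrt (t - s))) (\<lambda>x. \<bar>x\<bar> ^ p)"
      using assms by (intro bounded_momentsD(2)[OF centred_normal_bounded_moments]) simp
    then have "integrable (distr M lborel ?X) (\<lambda>x. \<bar>x\<bar> ^ p)" by (simp add: law)
    then show ?thesis by (subst (asm) integrable_distr_eq) auto
  qed
  then show ?thesis unfolding bounded_moments_def by auto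
qed

text \<open>
  On a common partition all integrals are linear in the independent increments, and the chain rule
  turns the coordinate formula into one with inner products of step functions.
\<close>

lemma step_integration_by_parts:
  assumes st: "\<And>i. i < n \<Longrightarrow> step_integral B (h i) (W i)" and f: "C1_poly n f f'" and m: "m < n"
  shows "expectation (\<lambda>\<omega>. W m \<omega> * f (\<lambda>i. W i \<omega>)) =
      (\<Sum>j<n. (\<integral>r. h j r * h m r \<partial>lborel) * expectation (\<lambda>\<omega>. f' j (\<lambda>i. W i \<omega>)))"
    and "\<And>i. i < n \<Longrightarrow> bounded_moments M (\<lambda>_::nat. W i)"
proof -
  note [measurable] = process_measurable
  obtain N \<tau> d where \<tau>: "strict_mono \<tau>"
    and h: "\<And>i. i < n \<Longrightarrow> h i = (\<lambda>r. \<Sum>k<N. d i k * indicator {\<tau> k<..\<tau> (Suc k)} r)"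
    and W: "\<And>i. i < n \<Longrightarrow> W i = (\<lambda>\<omega>. \<Sum>k<N. d i k * (B (\<tau> (Suc k)) \<omega> - B (\<tau> k) \<omega>))"
    using step_integrals_common_partition[of n B h W] st by blast
  define X where "X k \<omega> = B (\<tau> (Suc k)) \<omega> - B (\<tau> k) \<omega>" for k \<omega>
  have lt: "\<tau> k < \<tau> (Suc k)" for k using \<tau> by (simp add: strict_mono_Suc_iff)
  have X: "bounded_moments M (\<lambda>_::nat. X k)" for k
    unfolding X_def by (rule increment_bounded_moments[OF lt])
  show mom: "bounded_moments M (\<lambda>_::nat. W i)" if "i < n" for i
    using X unfolding W[OF that] X_def by (intro bounded_moments_sum bounded_moments_cmult)
  have indep: "indep_vars (\<lambda>_. borel) X {..<N}"
    unfolding X_def by (rule increments_independent) (rule lt)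
  have dist: "distributed M lborel (X k) (normal_density 0 (sqrt (\<tau> (Suc k) - \<tau> k)))" for k
    unfolding X_def by (rule increment_normal[OF lt])
  define F where "F x = f (\<lambda>i. \<Sum>l<N. d i l * x l)" for x
  define F' where "F' k x = (\<Sum>j<n. d j k * f' j (\<lambda>i. \<Sum>l<N. d i l * x l))" for k x
  have F: "C1_poly N F F'" unfolding F_def F'_def by (rule C1_poly_linear[OF f])
  have WX: "W i \<omega> = (\<Sum>l<N. d i l * X l \<omega>)" if "i < n" for i \<omega>
    using W[OF that] by (simp add: X_def)
  have fF: "f (\<lambda>i. W i \<omega>) = F (\<lambda>k. X k \<omega>)" for \<omega>
    unfolding F_def by (rule C1_polyD(1)[OF f]) (rule WX)
  have fF': "F' k (\<lambda>k. X k \<omega>) = (\<Sum>j<n. d j k * f' j (\<lambda>i. W i \<omega>))" for k \<omega>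
    unfolding F'_def
    by (intro sum.cong refl arg_cong2[where f = "(*)"] C1_poly_gradient_depends[OF f]) (auto simp: WX)
  have meas: "X k \<in> borel_measurable M" for k by (rule bounded_momentsD(1)[OF X])
  have mF: "bounded_moments M (\<lambda>_::nat. \<lambda>\<omega>. F (\<lambda>k. X k \<omega>))"
    by (intro bounded_moments_poly_growth[OF C1_polyD(3)[OF F] X]
        borel_measurable_continuous_coords[OF C1_polyD(2)[OF F]] meas)
  have mf': "integrable M (\<lambda>\<omega>. f' j (\<lambda>i. W i \<omega>))" if j: "j < n" for j
  proof -
    have eq: "(\<lambda>\<omega>. f' j (\<lambda>i. W i \<omega>)) = (\<lambda>\<omega>. f' j (\<lambda>i. \<Sum>l<N. d i l * X l \<omega>))"
      by (intro ext C1_poly_gradient_depends[OF f j] WX)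
    have "bounded_moments M (\<lambda>_::nat. \<lambda>\<omega>. f' j (\<lambda>i. \<Sum>l<N. d i l * X l \<omega>))"
      by (intro bounded_moments_poly_growth[OF C1_polyD(5)[OF f j]] bounded_moments_sum
          bounded_moments_cmult X borel_measurable_continuous_coords[OF C1_polyD(4)[OF f j]]
          borel_measurable_sum borel_measurable_times borel_measurable_const meas)
    then show ?thesis unfolding eq by (rule bounded_momentsD(3))
  qed
  have "expectation (\<lambda>\<omega>. W m \<omega> * f (\<lambda>i. W i \<omega>))
      = expectation (\<lambda>\<omega>. \<Sum>k<N. d m k * (X k \<omega> * F (\<lambda>k. X k \<omega>)))"
    unfolding fF using WX[OF m] by (simp add: sum_distrib_right mult.assoc)
  also have "\<dots> = (\<Sum>k<N. d m k * expectation (\<lambda>\<omega>. X k \<omega> * F (\<lambda>k. X k \<omega>)))"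
    using bounded_momentsD(3)[OF bounded_moments_mult[OF X mF]] by (simp add: integral_sum)
  also have "\<dots> = (\<Sum>k<N. d m k * ((\<tau> (Suc k) - \<tau> k) * expectation (\<lambda>\<omega>. F' k (\<lambda>k. X k \<omega>))))"
  proof (intro sum.cong refl arg_cong2[where f = "(*)"])
    fix k assume "k \<in> {..<N}"
    then show "expectation (\<lambda>\<omega>. X k \<omega> * F (\<lambda>k. X k \<omega>)) = (\<tau> (Suc k) - \<tau> k) * expectation (\<lambda>\<omega>. F' k (\<lambda>k. X k \<omega>))"
      using independent_normal_integration_by_parts[OF indep dist _ F, of k] lt X
      by (simp add: less_imp_le)
  qed
  also have "\<dots> = (\<Sum>k<N. \<Sum>j<n. d j k * d m k * (\<tau> (Suc k) - \<tau> k) * expectation (\<lambda>\<omega>. f' j (\<lambda>i. W i \<omega>)))"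
    unfolding fF' using mf' by (simp add: integral_sum sum_distrib_left mult_ac)
  also have "\<dots> = (\<Sum>j<n. \<Sum>k<N. d j k * d m k * (\<tau> (Suc k) - \<tau> k) * expectation (\<lambda>\<omega>. f' j (\<lambda>i. W i \<omega>)))"
    by (rule sum.swap)
  also have "\<dots> = (\<Sum>j<n. (\<integral>r. h j r * h m r \<partial>lborel) * expectation (\<lambda>\<omega>. f' j (\<lambda>i. W i \<omega>)))"
  proof (intro sum.cong refl)
    fix j assume "j \<in> {..<n}"
    then have "(\<integral>r. h j r * h m r \<partial>lborel) = (\<Sum>k<N. d j k * d m k * (\<tau> (Suc k) - \<tau> k))"
      using m by (simp only: h lessThan_iff integral_partition_step_product[OF \<tau>])
    then show "(\<Sum>k<N. d j k * d m k * (\<tau> (Suc k) - \<tau> k) * expectation (\<lambda>\<omega>. f' j (\<lambda>i. W i \<omega>))) =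
        (\<integral>r. h j r * h m r \<partial>lborel) * expectation (\<lambda>\<omega>. f' j (\<lambda>i. W i \<omega>))"
      by (simp only: sum_distrib_right)
  qed
  finally show "expectation (\<lambda>\<omega>. W m \<omega> * f (\<lambda>i. W i \<omega>)) =
      (\<Sum>j<n. (\<integral>r. h j r * h m r \<partial>lborel) * expectation (\<lambda>\<omega>. f' j (\<lambda>i. W i \<omega>)))" .
qed

text \<open>
  Integration by parts of \<open>V\<close> against \<open>V\<close> to the power \<open>2 p + 1\<close> gives the recursion between even
  moments; they depend on the norm of \<open>g\<close> only.
\<close>

lemma step_moment:
  assumes "step_integral B g V"
  shows "expectation (\<lambda>\<omega>. V \<omega> ^ (2 * p)) = (\<Prod>i<p. real (2 * i + 1)) * (\<integral>r. (g r)\<^sup>2 \<partial>lborel) ^ p"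
proof (induction p)
  case (Suc p)
  have c: "C1_poly 1 (\<lambda>x. x 0 ^ (2 * p + 1)) (\<lambda>j x. if j = 0 then real (2 * p + 1) * x 0 ^ (2 * p) else 0)"
  proof (rule C1_poly_coord[where C = 1 and p = "2 * p + 1" and D = "real (2 * p + 1)" and r = "2 * p"])
    show "((\<lambda>u. u ^ (2 * p + 1)) has_real_derivative real (2 * p + 1) * u ^ (2 * p)) (at u)" for u :: real
      using DERIV_pow[of "2 * p + 1" u] by simp
    show "continuous_on UNIV (\<lambda>u::real. real (2 * p + 1) * u ^ (2 * p))"
      by (intro continuous_intros)
    have pow: "\<bar>u ^ k\<bar> \<le> (1 + \<bar>u\<bar>) ^ k" for u :: real and k
      unfolding power_abs by (intro power_mono) auto
    show "\<bar>u ^ (2 * p + 1)\<bar> \<le> 1 * (1 + \<bar>u\<bar>) ^ (2 * p + 1)" for u :: real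
      using pow[of u "2 * p + 1"] by simp
    show "\<bar>real (2 * p + 1) * u ^ (2 * p)\<bar> \<le> real (2 * p + 1) * (1 + \<bar>u\<bar>) ^ (2 * p)" for u :: real
      using pow[of u "2 * p"] by (simp only: abs_mult abs_of_nat mult_left_mono of_nat_0_le_iff)
  qed simp
  have "expectation (\<lambda>\<omega>. V \<omega> * V \<omega> ^ (2 * p + 1)) =
      (\<integral>r. g r * g r \<partial>lborel) * expectation (\<lambda>\<omega>. real (2 * p + 1) * V \<omega> ^ (2 * p))"
    using step_integration_by_parts(1)[OF _ c, of "\<lambda>_. g" "\<lambda>_. V" 0] assms by simp
  also have "(\<lambda>\<omega>. V \<omega> * V \<omega> ^ (2 * p + 1)) = (\<lambda>\<omega>. V \<omega> ^ (2 * Suc p))" by (simp add: power_add)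
  finally have "expectation (\<lambda>\<omega>. V \<omega> ^ (2 * Suc p)) =
      (\<integral>r. (g r)\<^sup>2 \<partial>lborel) * (real (2 * p + 1) * expectation (\<lambda>\<omega>. V \<omega> ^ (2 * p)))"
    by (simp only: power2_eq_square integral_mult_right_zero)
  then show ?case unfolding Suc.IH by (simp only: prod.lessThan_Suc power_Suc mult_ac)
qed (simp add: prob_space)

lemma step_integrals_bounded_moments:
  assumes st: "\<And>m. step_integral B (hs m) (Xs m)" and K: "\<And>m. (\<integral>r. (hs m r)\<^sup>2 \<partial>lborel) \<le> K"
  shows "bounded_moments M Xs"
proof (rule bounded_momentsI)
  have mom: "bounded_moments M (\<lambda>_::nat. Xs m)" for m
    using step_integration_by_parts(2)[of 1 "\<lambda>_. hs m" "\<lambda>_. Xs m" "\<lambda>x. 1" "\<lambda>j x. 0" 0] st C1_poly_one by simp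
  then show "Xs m \<in> borel_measurable M" for m by (rule bounded_momentsD(1))
  fix p :: nat
  note le = abs_power_le_even_power[of _ p]
  have int: "integrable M (\<lambda>\<omega>. Xs m \<omega> ^ (2 * p))" for m
    using bounded_momentsD(3)[OF bounded_moments_power[OF mom]] .
  have "expectation (\<lambda>\<omega>. 1 + Xs m \<omega> ^ (2 * p)) \<le> 1 + (\<Prod>i<p. real (2 * i + 1)) * K ^ p" for m
  proof -
    have "(\<Prod>i<p. real (2 * i + 1)) * (\<integral>r. (hs m r)\<^sup>2 \<partial>lborel) ^ p \<le> (\<Prod>i<p. real (2 * i + 1)) * K ^ p"
      by (intro mult_left_mono power_mono K prod_nonneg) auto
    then show ?thesis using int[of m] step_moment[OF st, of m p] by (simp add: prob_space)
  qed
  then show "\<exists>Ys K. \<forall>m. integrable M (Ys m) \<and> (\<integral>\<omega>. Ys m \<omega> \<partial>M) \<le> K \<and> (\<forall>\<omega>. \<bar>Xs m \<omega>\<bar> ^ p \<le> Ys m \<omega>)"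
    using int le
    by (intro exI[of _ "\<lambda>m \<omega>. 1 + Xs m \<omega> ^ (2 * p)"] exI[of _ "1 + (\<Prod>i<p. real (2 * i + 1)) * K ^ p"]) auto
qed

subsection \<open>Wiener integrals\<close>

lemma wiener_integrals_approximation:
  fixes n :: nat
  assumes "\<And>i. i < n \<Longrightarrow> is_wiener_integral M B (h i) (W i)"
  shows "\<exists>hs Ws. \<forall>i<n. (\<forall>m. step_integral B (hs i m) (Ws i m)) \<and> L2_converges lborel (hs i) (h i) \<and>
     bounded_moments M (Ws i) \<and> (AE \<omega> in M. (\<lambda>m. Ws i m \<omega>) \<longlonglongrightarrow> W i \<omega>)"
proof -
  have "\<forall>i. \<exists>hs Xs. i < n \<longrightarrow> (\<forall>m. step_integral B (hs m) (Xs m)) \<and>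
      L2_converges lborel hs (h i) \<and> L2_converges M Xs (W i)"
    using assms unfolding is_wiener_integral_def by blast
  then obtain hs Xs where st: "\<And>i m. i < n \<Longrightarrow> step_integral B (hs i m) (Xs i m)"
    and hs: "\<And>i. i < n \<Longrightarrow> L2_converges lborel (hs i) (h i)"
    and Xs: "\<And>i. i < n \<Longrightarrow> L2_converges M (Xs i) (W i)"
    unfolding choice_iff by blast
  define U where "U m \<omega> = (\<Sum>i<n. (Xs i m \<omega> - W i \<omega>)\<^sup>2)" for m \<omega>
  have iU: "integrable M (\<lambda>\<omega>. (Xs i m \<omega> - W i \<omega>)\<^sup>2)" if "i < n" for i m
    using sq_integrable_diff[OF L2_convergesD(1,2)[OF Xs[OF that]]] by (simp add: sq_integrable_def)
  have "(\<lambda>m. \<Sum>i<n. expectation (\<lambda>\<omega>. (Xs i m \<omega> - W i \<omega>)\<^sup>2)) \<longlonglongrightarrow> (\<Sum>i<n. 0)"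
    by (intro tendsto_sum L2_convergesD(3)[OF Xs]) simp
  moreover have "expectation (\<lambda>\<omega>. norm (U m \<omega>)) = (\<Sum>i<n. expectation (\<lambda>\<omega>. (Xs i m \<omega> - W i \<omega>)\<^sup>2))" for m
  proof -
    have "expectation (\<lambda>\<omega>. norm (U m \<omega>)) = expectation (\<lambda>\<omega>. \<Sum>i<n. (Xs i m \<omega> - W i \<omega>)\<^sup>2)"
      by (simp add: U_def sum_nonneg)
    also have "\<dots> = (\<Sum>i<n. expectation (\<lambda>\<omega>. (Xs i m \<omega> - W i \<omega>)\<^sup>2))"
      by (rule Bochner_Integration.integral_sum) (use iU in simp)
    finally show ?thesis .
  qed
  ultimately have "(\<lambda>m. expectation (\<lambda>\<omega>. norm (U m \<omega>))) \<longlonglongrightarrow> 0" by simp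
  moreover have "integrable M (U m)" for m
    unfolding U_def[abs_def] by (rule Bochner_Integration.integrable_sum) (use iU in simp)
  ultimately obtain r where r: "strict_mono r" "AE \<omega> in M. (\<lambda>m. U (r m) \<omega>) \<longlonglongrightarrow> 0"
    using tendsto_L1_AE_subseq[of M U] by blast
  have "(\<forall>m. step_integral B (hs i (r m)) (Xs i (r m))) \<and> L2_converges lborel (\<lambda>m. hs i (r m)) (h i) \<and>
     bounded_moments M (\<lambda>m. Xs i (r m)) \<and> (AE \<omega> in M. (\<lambda>m. Xs i (r m) \<omega>) \<longlonglongrightarrow> W i \<omega>)" if i: "i < n" for i
  proof (intro conjI allI)
    show "step_integral B (hs i (r m)) (Xs i (r m))" for m by (rule st[OF i])
    show conv: "L2_converges lborel (\<lambda>m. hs i (r m)) (h i)" by (rule L2_converges_subseq[OF hs[OF i] r(1)])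
    have "Bseq (\<lambda>m. \<integral>x. (hs i (r m) x)\<^sup>2 \<partial>lborel)"
      using L2_converges_square[OF conv] by (rule convergent_imp_Bseq[OF convergentI])
    then obtain K where "\<And>m. norm (\<integral>x. (hs i (r m) x)\<^sup>2 \<partial>lborel) \<le> K" by (auto simp: Bseq_def)
    then have "(\<integral>x. (hs i (r m) x)\<^sup>2 \<partial>lborel) \<le> K" for m
      using abs_le_D1[of "\<integral>x. (hs i (r m) x)\<^sup>2 \<partial>lborel" K] by (simp only: real_norm_def)
    then show "bounded_moments M (\<lambda>m. Xs i (r m))"
      by (rule step_integrals_bounded_moments[OF st[OF i]])
    show "AE \<omega> in M. (\<lambda>m. Xs i (r m) \<omega>) \<longlonglongrightarrow> W i \<omega>"
      using r(2)
    proof eventually_elim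
      case (elim \<omega>)
      have "\<bar>Xs i (r m) \<omega> - W i \<omega>\<bar> \<le> sqrt (U (r m) \<omega>)" for m
      proof (rule real_le_rsqrt)
        show "\<bar>Xs i (r m) \<omega> - W i \<omega>\<bar>\<^sup>2 \<le> U (r m) \<omega>"
          unfolding U_def power2_abs using i
          by (intro member_le_sum[where f = "\<lambda>i. (Xs i (r m) \<omega> - W i \<omega>)\<^sup>2"]) auto
      qed
      moreover have "(\<lambda>m. sqrt (U (r m) \<omega>)) \<longlonglongrightarrow> 0"
        using tendsto_real_sqrt[OF elim] by simp
      ultimately have "(\<lambda>m. Xs i (r m) \<omega> - W i \<omega>) \<longlonglongrightarrow> 0"
        by (intro Lim_null_comparison[OF always_eventually, of "\<lambda>m. Xs i (r m) \<omega> - W i \<omega>" "\<lambda>m. sqrt (U (r m) \<omega>)"]) auto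
      then show ?case by (rule LIM_zero_cancel)
    qed
  qed
  then show ?thesis by (intro exI[of _ "\<lambda>i m. hs i (r m)"] exI[of _ "\<lambda>i m. Xs i (r m)"]) blast
qed

lemma wiener_sq_integrable:
  assumes "is_wiener_integral M B h W"
  shows "sq_integrable M W" "sq_integrable lborel h" "W \<in> borel_measurable M" "h \<in> borel_measurable lborel"
  using assms by (auto simp: is_wiener_integral_def L2_converges_def sq_integrable_def)

lemma wiener_bounded_moments:
  assumes "is_wiener_integral M B h W"
  shows "bounded_moments M (\<lambda>_::nat. W)"
proof -
  obtain Ws where "bounded_moments M Ws" "AE \<omega> in M. (\<lambda>m. Ws m \<omega>) \<longlonglongrightarrow> W \<omega>"
    using wiener_integrals_approximation[of 1 "\<lambda>_. h" "\<lambda>_. W"] assms by auto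
  then show ?thesis using bounded_moments_limit(1) wiener_sq_integrable(3)[OF assms] by blast
qed

lemma wiener_function_bounded_moments:
  assumes W: "\<And>i. i < n \<Longrightarrow> is_wiener_integral M B (h i) (W i)"
    and f: "continuous_on UNIV f" "poly_growth n f" "\<And>x y. (\<And>i. i < n \<Longrightarrow> x i = y i) \<Longrightarrow> f x = f y"
  shows "bounded_moments M (\<lambda>_::nat. \<lambda>\<omega>. f (\<lambda>i. W i \<omega>))"
proof -
  define V where "V i = (if i < n then W i else (\<lambda>\<omega>. 0))" for i
  have V: "bounded_moments M (\<lambda>_::nat. V i)" if "i < n" for i
    using wiener_bounded_moments[OF W[OF that]] that by (simp add: V_def)
  have mV: "V i \<in> borel_measurable M" for i
    using wiener_sq_integrable(3)[OF W] by (simp add: V_def)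
  have "bounded_moments M (\<lambda>_::nat. \<lambda>\<omega>. f (\<lambda>i. V i \<omega>))"
    by (intro bounded_moments_poly_growth[OF f(2) V] borel_measurable_continuous_coords[OF f(1)] mV)
  moreover have "f (\<lambda>i. V i \<omega>) = f (\<lambda>i. W i \<omega>)" for \<omega> by (rule f(3)) (simp add: V_def)
  ultimately show ?thesis by simp
qed

text \<open>
  Approximation by step functions extends the finite-dimensional formula: the approximating
  integrals converge almost surely along a subsequence and have uniformly bounded moments.
\<close>

theorem wiener_integration_by_parts:
  assumes W: "\<And>i. i < n \<Longrightarrow> is_wiener_integral M B (h i) (W i)" and f: "C1_poly n f f'" and m: "m < n"
  shows "expectation (\<lambda>\<omega>. W m \<omega> * f (\<lambda>i. W i \<omega>)) =
      (\<Sum>j<n. (\<integral>r. h j r * h m r \<partial>lborel) * expectation (\<lambda>\<omega>. f' j (\<lambda>i. W i \<omega>)))"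
proof -
  have "\<exists>hs Ws. \<forall>i<n. (\<forall>m. step_integral B (hs i m) (Ws i m)) \<and> L2_converges lborel (hs i) (h i) \<and>
     bounded_moments M (Ws i) \<and> (AE \<omega> in M. (\<lambda>m. Ws i m \<omega>) \<longlonglongrightarrow> W i \<omega>)"
    using W by (rule wiener_integrals_approximation)
  then obtain hs Ws where *: "\<forall>i<n. (\<forall>m. step_integral B (hs i m) (Ws i m)) \<and> L2_converges lborel (hs i) (h i) \<and>
     bounded_moments M (Ws i) \<and> (AE \<omega> in M. (\<lambda>m. Ws i m \<omega>) \<longlonglongrightarrow> W i \<omega>)"
    by (elim exE) (rule that)
  then have a: "\<And>i m. i < n \<Longrightarrow> step_integral B (hs i m) (Ws i m)"
    and hs: "\<And>i. i < n \<Longrightarrow> L2_converges lborel (hs i) (h i)"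
    and mom: "\<And>i. i < n \<Longrightarrow> bounded_moments M (Ws i)"
    and ae: "\<And>i. i < n \<Longrightarrow> AE \<omega> in M. (\<lambda>m. Ws i m \<omega>) \<longlonglongrightarrow> W i \<omega>"
    by simp_all
  \<comment> \<open>Coordinates from \<open>n\<close> on are set to zero, which makes all of them measurable.\<close>
  define V where "V i = (if i < n then W i else (\<lambda>\<omega>. 0))" for i
  define Vs where "Vs i = (if i < n then Ws i else (\<lambda>k \<omega>. 0))" for i
  have Vs_mom: "bounded_moments M (Vs i)" for i
    using mom bounded_moments_const[of 0] by (simp add: Vs_def)
  have mV: "V i \<in> borel_measurable M" for i
    using wiener_sq_integrable(3)[OF W] by (simp add: V_def)
  have aeV: "AE \<omega> in M. \<forall>i. (\<lambda>k. Vs i k \<omega>) \<longlonglongrightarrow> V i \<omega>"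
    unfolding AE_all_countable using ae by (auto simp: V_def Vs_def)
  have lim: "(\<lambda>k. expectation (\<lambda>\<omega>. u (\<lambda>i. Vs i k \<omega>))) \<longlonglongrightarrow> expectation (\<lambda>\<omega>. u (\<lambda>i. V i \<omega>))"
    if u: "continuous_on UNIV u" "poly_growth n u" for u :: "(nat \<Rightarrow> real) \<Rightarrow> real"
  proof (rule bounded_moments_limit(2))
    show "bounded_moments M (\<lambda>k \<omega>. u (\<lambda>i. Vs i k \<omega>))"
      using Vs_mom by (intro bounded_moments_poly_growth[OF u(2), where W = "\<lambda>k i. Vs i k"]
          borel_measurable_continuous_coords[OF u(1)] bounded_momentsD(1)[OF Vs_mom]) auto
    show "(\<lambda>\<omega>. u (\<lambda>i. V i \<omega>)) \<in> borel_measurable M"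
      by (rule borel_measurable_continuous_coords[OF u(1) mV])
    show "AE \<omega> in M. (\<lambda>k. u (\<lambda>i. Vs i k \<omega>)) \<longlonglongrightarrow> u (\<lambda>i. V i \<omega>)"
      using aeV
    proof eventually_elim
      case (elim \<omega>)
      have t: "((\<lambda>k i. Vs i k \<omega>) \<longlongrightarrow> (\<lambda>i. V i \<omega>)) sequentially"
        using elim by (intro tendsto_coordinatewise) simp
      have "isCont u (\<lambda>i. V i \<omega>)" using u(1) by (simp add: continuous_on_eq_continuous_at)
      from isCont_tendsto_compose[OF this t] show ?case .
    qed
  qed
  note F = C1_polyD[OF f]
  have "(\<lambda>k. expectation (\<lambda>\<omega>. Vs m k \<omega> * f (\<lambda>i. Vs i k \<omega>))) \<longlonglongrightarrow> expectation (\<lambda>\<omega>. V m \<omega> * f (\<lambda>i. V i \<omega>))"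
  proof (rule lim[of "\<lambda>x. x m * f x"])
    show "continuous_on UNIV (\<lambda>x. x m * f x)" by (intro continuous_intros F(2)) simp
    show "poly_growth n (\<lambda>x. x m * f x)"
      by (intro poly_growth_mult F(3) poly_growth_coord[where \<phi> = "\<lambda>u. u" and C = 1 and p = 1] m) simp
  qed
  moreover have "expectation (\<lambda>\<omega>. Vs m k \<omega> * f (\<lambda>i. Vs i k \<omega>)) =
      (\<Sum>j<n. (\<integral>r. hs j k r * hs m k r \<partial>lborel) * expectation (\<lambda>\<omega>. f' j (\<lambda>i. Vs i k \<omega>)))" for k
    using a by (intro step_integration_by_parts(1)[OF _ f m]) (simp add: Vs_def)
  moreover have "(\<lambda>k. \<Sum>j<n. (\<integral>r. hs j k r * hs m k r \<partial>lborel) * expectation (\<lambda>\<omega>. f' j (\<lambda>i. Vs i k \<omega>)))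
      \<longlonglongrightarrow> (\<Sum>j<n. (\<integral>r. h j r * h m r \<partial>lborel) * expectation (\<lambda>\<omega>. f' j (\<lambda>i. V i \<omega>)))"
    using m by (intro tendsto_sum tendsto_mult L2_converges_inner hs lim F(4) F(5)) auto
  ultimately have "expectation (\<lambda>\<omega>. V m \<omega> * f (\<lambda>i. V i \<omega>)) =
      (\<Sum>j<n. (\<integral>r. h j r * h m r \<partial>lborel) * expectation (\<lambda>\<omega>. f' j (\<lambda>i. V i \<omega>)))"
    by (simp add: LIMSEQ_unique)
  moreover have "V m = W m" using m by (simp add: V_def)
  moreover have "f (\<lambda>i. V i \<omega>) = f (\<lambda>i. W i \<omega>)" for \<omega> by (rule F(1)) (simp add: V_def)
  moreover have "f' j (\<lambda>i. V i \<omega>) = f' j (\<lambda>i. W i \<omega>)" if "j < n" for \<omega> j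
    by (rule C1_poly_gradient_depends[OF f that]) (simp add: V_def)
  ultimately show ?thesis by simp
qed

end

section \<open>Elementary chaos\<close>

subsection \<open>Product spaces\<close>

lemma
  assumes "sigma_finite_measure M" "sigma_finite_measure N" "integrable M f" "integrable N g"
  shows integrable_pair_product: "integrable (M \<Otimes>\<^sub>M N) (\<lambda>(x, y). f x * g y :: real)"
    and integral_pair_product: "(\<integral>(x, y). f x * g y \<partial>(M \<Otimes>\<^sub>M N)) = (\<integral>x. f x \<partial>M) * (\<integral>y. g y \<partial>N)"
proof -
  interpret pair_sigma_finite M N using assms(1,2) by (rule pair_sigma_finite.intro)
  note [measurable] = borel_measurable_integrable[OF assms(3)] borel_measurable_integrable[OF assms(4)]
  show int: "integrable (M \<Otimes>\<^sub>M N) (\<lambda>(x, y). f x * g y)"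
  proof (rule Fubini_integrable)
    have "(\<lambda>x. \<integral>y. norm (case (x, y) of (x, y) \<Rightarrow> f x * g y) \<partial>N) = (\<lambda>x. \<bar>f x\<bar> * (\<integral>y. \<bar>g y\<bar> \<partial>N))"
      by (simp add: abs_mult)
    then show "integrable M (\<lambda>x. \<integral>y. norm (case (x, y) of (x, y) \<Rightarrow> f x * g y) \<partial>N)"
      using assms(3) by simp
  qed (use assms(4) in auto)
  show "(\<integral>(x, y). f x * g y \<partial>(M \<Otimes>\<^sub>M N)) = (\<integral>x. f x \<partial>M) * (\<integral>y. g y \<partial>N)"
    using integral_fst'[OF int] by simp
qed

lemma sq_integrable_pair_product:
  assumes "sigma_finite_measure M" "sigma_finite_measure N" "sq_integrable M f" "sq_integrable N g"
  shows "sq_integrable (M \<Otimes>\<^sub>M N) (\<lambda>(x, y). f x * g y)"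
proof -
  note [measurable] = sq_integrable_measurable[OF assms(3)] sq_integrable_measurable[OF assms(4)]
  have "integrable (M \<Otimes>\<^sub>M N) (\<lambda>(x, y). (f x)\<^sup>2 * (g y)\<^sup>2)"
    using assms by (intro integrable_pair_product) (auto simp: sq_integrable_def)
  moreover have "(\<lambda>(x, y). (f x)\<^sup>2 * (g y)\<^sup>2) = (\<lambda>z. (case z of (x, y) \<Rightarrow> f x * g y)\<^sup>2)"
    by (auto simp: power_mult_distrib)
  ultimately show ?thesis by (simp add: sq_integrable_def)
qed

lemma integral_square_sum:
  assumes "\<And>i. i < m \<Longrightarrow> sq_integrable N (F i)"
  shows "(\<integral>x. (\<Sum>i<m. c i * F i x)\<^sup>2 \<partial>N) = (\<Sum>i<m. \<Sum>j<m. c i * c j * (\<integral>x. F i x * F j x \<partial>N))"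
proof -
  have "(\<integral>x. (\<Sum>i<m. c i * F i x)\<^sup>2 \<partial>N) = (\<integral>x. (\<Sum>i<m. \<Sum>j<m. (c i * c j) * (F i x * F j x)) \<partial>N)"
    unfolding power2_eq_square sum_product
    by (intro Bochner_Integration.integral_cong sum.cong refl) (simp only: mult_ac)
  also have "\<dots> = (\<Sum>i<m. \<integral>x. (\<Sum>j<m. (c i * c j) * (F i x * F j x)) \<partial>N)"
    by (rule Bochner_Integration.integral_sum)
       (auto intro!: Bochner_Integration.integrable_sum integrable_mult_right sq_integrable_mult assms)
  also have "\<dots> = (\<Sum>i<m. \<Sum>j<m. \<integral>x. (c i * c j) * (F i x * F j x) \<partial>N)"
    by (intro sum.cong refl Bochner_Integration.integral_sum)
       (auto intro!: integrable_mult_right sq_integrable_mult assms)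
  also have "\<dots> = (\<Sum>i<m. \<Sum>j<m. c i * c j * (\<integral>x. F i x * F j x \<partial>N))"
    by (simp only: integral_mult_right_zero)
  finally show ?thesis .
qed

interpretation lborel_product: product_sigma_finite "\<lambda>_::nat. lborel :: real measure"
  by standard

lemma tensor_power_sq_integrable:
  assumes "sq_integrable lborel h"
  shows "sq_integrable (lborel_pow q) (tensor_power q h)"
proof -
  have "integrable (lborel_pow q) (\<lambda>\<xi>. \<Prod>j<q. (h (\<xi> j))\<^sup>2)"
    using assms by (intro lborel_product.product_integrable_prod) (auto simp: sq_integrable_def)
  moreover have "(\<lambda>\<xi>. \<Prod>j<q. (h (\<xi> j))\<^sup>2) = (\<lambda>\<xi>. (tensor_power q h \<xi>)\<^sup>2)"
    by (simp add: tensor_power_def prod_power_distrib)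
  moreover have "tensor_power q h \<in> borel_measurable (lborel_pow q)"
  proof -
    have "(\<lambda>\<xi>. h (\<xi> j)) \<in> borel_measurable (lborel_pow q)" if "j < q" for j
    proof (rule measurable_compose[OF _ sq_integrable_measurable[OF assms]])
      show "(\<lambda>\<xi>. \<xi> j) \<in> measurable (lborel_pow q) lborel"
        using that by (intro measurable_component_singleton) simp
    qed
    then show ?thesis unfolding tensor_power_def[abs_def] by (intro borel_measurable_prod) auto
  qed
  ultimately show ?thesis by (simp add: sq_integrable_def)
qed

lemma integral_tensor_power_mult:
  assumes "sq_integrable lborel h" "sq_integrable lborel g"
  shows "(\<integral>\<xi>. tensor_power q h \<xi> * tensor_power q g \<xi> \<partial>lborel_pow q) = (\<integral>r. h r * g r \<partial>lborel) ^ q"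
proof -
  have "(\<integral>\<xi>. (\<Prod>j<q. h (\<xi> j) * g (\<xi> j)) \<partial>lborel_pow q) = (\<Prod>j<q. \<integral>r. h r * g r \<partial>lborel)"
    by (intro lborel_product.product_integral_prod sq_integrable_mult assms) simp
  then show ?thesis by (simp add: tensor_power_def prod.distrib)
qed

subsection \<open>Hermite polynomials of Wiener integrals\<close>

lemma hermite_poly_Suc:
  "hermite_poly (Suc n) x = x * hermite_poly n x - real n * hermite_poly (n - 1) x"
  by (cases n) auto

lemma hermite_poly_is_poly: "\<exists>P. \<forall>x. hermite_poly n x = poly P x"
proof (induction n rule: less_induct)
  case (less n)
  show ?case
  proof (cases n)
    case 0
    then show ?thesis by (intro exI[of _ 1]) simp
  next
    case (Suc m)
    then have "m < n" "m - 1 < n" by auto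
    then obtain P Q where PQ: "\<forall>x. hermite_poly m x = poly P x" "\<forall>x. hermite_poly (m - 1) x = poly Q x"
      using less[OF \<open>m < n\<close>] less[OF \<open>m - 1 < n\<close>] by blast
    show ?thesis
      unfolding Suc hermite_poly_Suc using PQ by (intro exI[of _ "[:0, 1:] * P - smult (real m) Q"]) simp
  qed
qed

lemma hermite_poly_deriv:
  "(hermite_poly n has_real_derivative real n * hermite_poly (n - 1) x) (at x)"
proof (induction n rule: less_induct)
  case (less n)
  show ?case
  proof (cases n)
    case 0
    then show ?thesis by (simp add: DERIV_const)
  next
    case (Suc m)
    have eq: "hermite_poly n = (\<lambda>x. x * hermite_poly m x - real m * hermite_poly (m - 1) x)"
      by (simp add: Suc hermite_poly_Suc fun_eq_iff)
    have 1: "(hermite_poly m has_real_derivative real m * hermite_poly (m - 1) x) (at x)"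
      using less[of m] Suc by simp
    have 2: "(hermite_poly (m - 1) has_real_derivative real (m - 1) * hermite_poly (m - 1 - 1) x) (at x)"
      using less[of "m - 1"] Suc by simp
    have "(hermite_poly n has_real_derivative
        hermite_poly m x + x * (real m * hermite_poly (m - 1) x)
          - real m * (real (m - 1) * hermite_poly (m - 1 - 1) x)) (at x)"
      unfolding eq using 1 2 by (auto intro!: derivative_eq_intros)
    moreover have "x * (real m * hermite_poly (m - 1) x) - real m * (real (m - 1) * hermite_poly (m - 1 - 1) x)
        = real m * hermite_poly m x"
    proof (cases m)
      case (Suc k)
      have "x * (real m * hermite_poly k x) - real m * (real k * hermite_poly (k - 1) x)
          = real m * (x * hermite_poly k x - real k * hermite_poly (k - 1) x)"
        by (simp only: right_diff_distrib mult.left_commute)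
      then show ?thesis by (simp only: Suc hermite_poly_Suc diff_Suc_1)
    qed simp
    ultimately show ?thesis by (simp add: Suc algebra_simps)
  qed
qed

lemma poly_bound: "\<exists>C p. \<forall>u::real. \<bar>poly P u\<bar> \<le> C * (1 + \<bar>u\<bar>) ^ p"
proof (induction P)
  case 0
  show ?case by (intro exI[of _ 0]) simp
next
  case (pCons a P)
  then obtain C p where C: "\<And>u. \<bar>poly P u\<bar> \<le> C * (1 + \<bar>u\<bar>) ^ p" by blast
  have "\<bar>poly (pCons a P) u\<bar> \<le> (\<bar>a\<bar> + C) * (1 + \<bar>u\<bar>) ^ Suc p" for u
  proof -
    have "\<bar>poly (pCons a P) u\<bar> \<le> \<bar>a\<bar> + \<bar>u\<bar> * \<bar>poly P u\<bar>" by (simp add: abs_mult flip: abs_mult)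
    also have "\<dots> \<le> \<bar>a\<bar> * (1 + \<bar>u\<bar>) ^ Suc p + (1 + \<bar>u\<bar>) * (C * (1 + \<bar>u\<bar>) ^ p)"
      using C[of u] by (intro add_mono mult_mono) (auto simp: mult_le_cancel_left1 one_le_power simp del: power_Suc)
    finally show ?thesis by (simp add: algebra_simps)
  qed
  then show ?case by blast
qed

lemma C1_poly_coord_poly:
  assumes "k < n"
  shows "C1_poly n (\<lambda>x. poly P (x k)) (\<lambda>j x. if j = k then poly (pderiv P) (x k) else 0)"
proof -
  obtain C p where "\<And>u. \<bar>poly P u\<bar> \<le> C * (1 + \<bar>u\<bar>) ^ p" using poly_bound by blast
  moreover obtain D r where "\<And>u. \<bar>poly (pderiv P) u\<bar> \<le> D * (1 + \<bar>u\<bar>) ^ r" using poly_bound by blast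
  ultimately show ?thesis
    by (intro C1_poly_coord[OF assms]) (auto intro!: poly_DERIV continuous_intros)
qed

lemma C1_poly_coord_hermite:
  assumes "k < n"
  shows "C1_poly n (\<lambda>x. hermite_poly q (x k)) (\<lambda>j x. if j = k then real q * hermite_poly (q - 1) (x k) else 0)"
proof -
  obtain P where P: "\<And>x. hermite_poly q x = poly P x" using hermite_poly_is_poly by blast
  have dP: "poly (pderiv P) x = real q * hermite_poly (q - 1) x" for x
  proof -
    have "hermite_poly q = poly P" using P by auto
    then have "(poly P has_real_derivative real q * hermite_poly (q - 1) x) (at x)"
      using hermite_poly_deriv[of q x] by (simp only:)
    then show ?thesis by (rule DERIV_unique[OF poly_DERIV])
  qed
  show ?thesis using C1_poly_coord_poly[OF assms, of P] unfolding dP P[symmetric] .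
qed

context brownian_increments
begin

lemma hermite_bounded_moments:
  assumes "is_wiener_integral M B h W"
  shows "bounded_moments M (\<lambda>_::nat. \<lambda>\<omega>. hermite_poly q (W \<omega>))"
proof -
  have c: "C1_poly 1 (\<lambda>x. hermite_poly q (x 0)) (\<lambda>j x. if j = 0 then real q * hermite_poly (q - 1) (x 0) else 0)"
    by (rule C1_poly_coord_hermite) simp
  show ?thesis
    by (rule wiener_function_bounded_moments[where n = 1 and h = "\<lambda>_. h" and W = "\<lambda>_. W"
          and f = "\<lambda>x. hermite_poly q (x 0)", OF assms C1_polyD(2,3)[OF c]]) simp
qed

text \<open>
  With \<open>H\<^sub>p\<^sub>+\<^sub>1(x) = x H\<^sub>p(x) - p H\<^sub>p\<^sub>-\<^sub>1(x)\<close> and \<open>H\<^sub>q' = q H\<^sub>q\<^sub>-\<^sub>1\<close>, integration by parts in the direction of \<open>W\<close>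
  removes one factor \<open>W\<close> from the first polynomial and one degree from the second.
\<close>

lemma hermite_covariance_step:
  assumes W: "is_wiener_integral M B h W" and V: "is_wiener_integral M B g V"
    and h1: "(\<integral>r. (h r)\<^sup>2 \<partial>lborel) = 1"
  shows "expectation (\<lambda>\<omega>. hermite_poly (Suc p) (W \<omega>) * hermite_poly q (V \<omega>)) =
    (\<integral>r. h r * g r \<partial>lborel) * (real q * expectation (\<lambda>\<omega>. hermite_poly p (W \<omega>) * hermite_poly (q - 1) (V \<omega>)))"
proof -
  define hs where "hs = (\<lambda>i::nat. if i = 0 then h else g)"
  define Ws where "Ws = (\<lambda>i::nat. if i = 0 then W else V)"
  have Ws: "is_wiener_integral M B (hs i) (Ws i)" for i
    using W V by (simp add: hs_def Ws_def)
  have f: "C1_poly 2 (\<lambda>x. hermite_poly p (x 0) * hermite_poly q (x 1))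
     (\<lambda>j x. (if j = 0 then real p * hermite_poly (p - 1) (x 0) else 0) * hermite_poly q (x 1) +
        hermite_poly p (x 0) * (if j = 1 then real q * hermite_poly (q - 1) (x 1) else 0))"
    by (intro C1_poly_mult C1_poly_coord_hermite) auto
  have int: "integrable M (\<lambda>\<omega>. hermite_poly a (W \<omega>) * hermite_poly b (V \<omega>))" for a b
    by (rule bounded_momentsD(3)[OF bounded_moments_mult[OF hermite_bounded_moments[OF W] hermite_bounded_moments[OF V]]])
  have "expectation (\<lambda>\<omega>. W \<omega> * (hermite_poly p (W \<omega>) * hermite_poly q (V \<omega>))) =
      (\<integral>r. h r * h r \<partial>lborel) * expectation (\<lambda>\<omega>. real p * hermite_poly (p - 1) (W \<omega>) * hermite_poly q (V \<omega>)) +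
      (\<integral>r. g r * h r \<partial>lborel) * expectation (\<lambda>\<omega>. hermite_poly p (W \<omega>) * (real q * hermite_poly (q - 1) (V \<omega>)))"
    using wiener_integration_by_parts[of 2 hs Ws, OF Ws f, of 0]
    by (simp add: hs_def Ws_def numeral_2_eq_2)
  moreover have "expectation (\<lambda>\<omega>. W \<omega> * (hermite_poly p (W \<omega>) * hermite_poly q (V \<omega>))) =
      expectation (\<lambda>\<omega>. hermite_poly (Suc p) (W \<omega>) * hermite_poly q (V \<omega>)) +
      real p * expectation (\<lambda>\<omega>. hermite_poly (p - 1) (W \<omega>) * hermite_poly q (V \<omega>))"
  proof -
    have "(\<lambda>\<omega>. W \<omega> * (hermite_poly p (W \<omega>) * hermite_poly q (V \<omega>))) =
        (\<lambda>\<omega>. hermite_poly (Suc p) (W \<omega>) * hermite_poly q (V \<omega>) +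
           real p * (hermite_poly (p - 1) (W \<omega>) * hermite_poly q (V \<omega>)))"
      by (simp add: hermite_poly_Suc algebra_simps fun_eq_iff)
    then show ?thesis using int by simp
  qed
  moreover have "expectation (\<lambda>\<omega>. hermite_poly p (W \<omega>) * (real q * hermite_poly (q - 1) (V \<omega>))) =
      real q * expectation (\<lambda>\<omega>. hermite_poly p (W \<omega>) * hermite_poly (q - 1) (V \<omega>))"
    by (simp add: mult.left_commute[of _ "real q"])
  moreover have "(\<integral>r. h r * h r \<partial>lborel) = 1" using h1 by (simp add: power2_eq_square)
  moreover have "(\<integral>r. g r * h r \<partial>lborel) = (\<integral>r. h r * g r \<partial>lborel)" by (simp add: mult.commute)
  ultimately show ?thesis by (simp add: mult.assoc)
qed

lemma hermite_covariance:
  assumes W: "is_wiener_integral M B h W" and V: "is_wiener_integral M B g V"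
    and h1: "(\<integral>r. (h r)\<^sup>2 \<partial>lborel) = 1"
  shows "expectation (\<lambda>\<omega>. hermite_poly q (W \<omega>) * hermite_poly q (V \<omega>)) = fact q * (\<integral>r. h r * g r \<partial>lborel) ^ q"
proof (induction q)
  case (Suc q)
  show ?case
    unfolding hermite_covariance_step[OF W V h1] using Suc.IH by simp
qed (simp add: prob_space)

end

text \<open>
  \<open>X\<close> is the multiple integral of a combination \<open>f\<close> of tensor powers of unit vectors, and \<open>U\<close> is its
  Malliavin derivative, by \<open>H\<^sub>q' = q H\<^sub>q\<^sub>-\<^sub>1\<close>.  They are kept together, as the transformations considered
  below act on all three simultaneously.
\<close>

definition elementary_chaos ::
  "'a measure \<Rightarrow> (real \<Rightarrow> 'a \<Rightarrow> real) \<Rightarrow> nat \<Rightarrow>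
     ((nat \<Rightarrow> real) \<Rightarrow> real) \<Rightarrow> ('a \<Rightarrow> real) \<Rightarrow> ('a \<Rightarrow> real \<Rightarrow> real) \<Rightarrow> bool" where
  "elementary_chaos M B q f X U \<longleftrightarrow>
     (\<exists>(m::nat) c h W.
        (\<forall>i<m. is_wiener_integral M B (h i) (W i) \<and> (\<integral>r. (h i r)\<^sup>2 \<partial>lborel) = 1) \<and>
        f = (\<lambda>\<xi>. \<Sum>i<m. c i * tensor_power q (h i) \<xi>) \<and>
        X = (\<lambda>\<omega>. \<Sum>i<m. c i * hermite_poly q (W i \<omega>)) \<and>
        U = (\<lambda>\<omega> r. \<Sum>i<m. c i * (real q * hermite_poly (q - 1) (W i \<omega>) * h i r)))"

lemma elementary_chaosE:
  assumes "elementary_chaos M B q f X U"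
  obtains m :: nat and c h W where
    "\<forall>i<m. is_wiener_integral M B (h i) (W i) \<and> (\<integral>r. (h i r)\<^sup>2 \<partial>lborel) = 1"
    "f = (\<lambda>\<xi>. \<Sum>i<m. c i * tensor_power q (h i) \<xi>)"
    "X = (\<lambda>\<omega>. \<Sum>i<m. c i * hermite_poly q (W i \<omega>))"
    "U = (\<lambda>\<omega> r. \<Sum>i<m. c i * (real q * hermite_poly (q - 1) (W i \<omega>) * h i r))"
  using assms unfolding elementary_chaos_def by (elim exE conjE) (rule that)

lemma elementary_chaos_exists:
  assumes "elementary_multiple_integral M B q f X"
  shows "\<exists>U. elementary_chaos M B q f X U"
  using assms unfolding elementary_multiple_integral_def elementary_chaos_def by blast

text \<open>
  Sums of elementary integrals are represented by appending their lists of terms.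
\<close>

lemma sum_lessThan_append:
  fixes g :: "nat \<Rightarrow> real"
  shows "(\<Sum>i<m + n. if i < m then g i else g' (i - m)) = (\<Sum>i<m. g i) + (\<Sum>i<n. g' i)"
  by (induction n) auto

lemma elementary_chaos_add:
  assumes "elementary_chaos M B q f X U" "elementary_chaos M B q g Y V"
  shows "elementary_chaos M B q (\<lambda>\<xi>. f \<xi> + g \<xi>) (\<lambda>\<omega>. X \<omega> + Y \<omega>) (\<lambda>\<omega> r. U \<omega> r + V \<omega> r)"
proof -
  obtain m :: nat and c h W where 1:
    "\<forall>i<m. is_wiener_integral M B (h i) (W i) \<and> (\<integral>r. (h i r)\<^sup>2 \<partial>lborel) = 1"
    "f = (\<lambda>\<xi>. \<Sum>i<m. c i * tensor_power q (h i) \<xi>)"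
    "X = (\<lambda>\<omega>. \<Sum>i<m. c i * hermite_poly q (W i \<omega>))"
    "U = (\<lambda>\<omega> r. \<Sum>i<m. c i * (real q * hermite_poly (q - 1) (W i \<omega>) * h i r))"
    using assms(1) by (elim elementary_chaosE) (rule that)
  obtain n :: nat and d k Z where 2:
    "\<forall>i<n. is_wiener_integral M B (k i) (Z i) \<and> (\<integral>r. (k i r)\<^sup>2 \<partial>lborel) = 1"
    "g = (\<lambda>\<xi>. \<Sum>i<n. d i * tensor_power q (k i) \<xi>)"
    "Y = (\<lambda>\<omega>. \<Sum>i<n. d i * hermite_poly q (Z i \<omega>))"
    "V = (\<lambda>\<omega> r. \<Sum>i<n. d i * (real q * hermite_poly (q - 1) (Z i \<omega>) * k i r))"
    using assms(2) by (elim elementary_chaosE) (rule that)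
  have sum: "(\<Sum>i<m + n. F (if i < m then c i else d (i - m)) (if i < m then h i else k (i - m))
        (if i < m then W i else Z (i - m))) = (\<Sum>i<m. F (c i) (h i) (W i)) + (\<Sum>i<n. F (d i) (k i) (Z i))"
    for F :: "_ \<Rightarrow> _ \<Rightarrow> _ \<Rightarrow> real"
    unfolding sum_lessThan_append[symmetric] by (intro sum.cong refl) simp
  show ?thesis
    unfolding elementary_chaos_def
  proof (intro exI conjI allI impI)
    fix i assume "i < m + n"
    then show "is_wiener_integral M B (if i < m then h i else k (i - m)) (if i < m then W i else Z (i - m))"
      "(\<integral>r. ((if i < m then h i else k (i - m)) r)\<^sup>2 \<partial>lborel) = 1"
      using 1(1)[rule_format, of i] 2(1)[rule_format, of "i - m"] by auto
  next
    show "(\<lambda>\<xi>. f \<xi> + g \<xi>) = (\<lambda>\<xi>. \<Sum>i<m + n. (if i < m then c i else d (i - m)) *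
        tensor_power q (if i < m then h i else k (i - m)) \<xi>)"
      unfolding 1(2) 2(2) by (rule ext) (rule sum[of "\<lambda>c h W. c * tensor_power q h \<xi>" for \<xi>, symmetric])
    show "(\<lambda>\<omega>. X \<omega> + Y \<omega>) = (\<lambda>\<omega>. \<Sum>i<m + n. (if i < m then c i else d (i - m)) *
        hermite_poly q ((if i < m then W i else Z (i - m)) \<omega>))"
      unfolding 1(3) 2(3) by (rule ext) (rule sum[of "\<lambda>c h W. c * hermite_poly q (W \<omega>)" for \<omega>, symmetric])
    show "(\<lambda>\<omega> r. U \<omega> r + V \<omega> r) = (\<lambda>\<omega> r. \<Sum>i<m + n. (if i < m then c i else d (i - m)) *
        (real q * hermite_poly (q - 1) ((if i < m then W i else Z (i - m)) \<omega>) *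
          (if i < m then h i else k (i - m)) r))"
      unfolding 1(4) 2(4)
      by (intro ext) (rule sum[of "\<lambda>c h W. c * (real q * hermite_poly (q - 1) (W \<omega>) * h r)" for \<omega> r, symmetric])
  qed
qed

lemma elementary_chaos_cmult:
  assumes "elementary_chaos M B q f X U"
  shows "elementary_chaos M B q (\<lambda>\<xi>. a * f \<xi>) (\<lambda>\<omega>. a * X \<omega>) (\<lambda>\<omega> r. a * U \<omega> r)"
proof -
  obtain m :: nat and c h W where 1:
    "\<forall>i<m. is_wiener_integral M B (h i) (W i) \<and> (\<integral>r. (h i r)\<^sup>2 \<partial>lborel) = 1"
    "f = (\<lambda>\<xi>. \<Sum>i<m. c i * tensor_power q (h i) \<xi>)"
    "X = (\<lambda>\<omega>. \<Sum>i<m. c i * hermite_poly q (W i \<omega>))"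
    "U = (\<lambda>\<omega> r. \<Sum>i<m. c i * (real q * hermite_poly (q - 1) (W i \<omega>) * h i r))"
    using assms(1) by (elim elementary_chaosE) (rule that)
  show ?thesis
    unfolding elementary_chaos_def
    by (intro exI[of _ m] exI[of _ "\<lambda>i. a * c i"] exI[of _ h] exI[of _ W])
       (use 1(1) in \<open>auto simp: 1(2-4) sum_distrib_left mult.assoc\<close>)
qed

lemma elementary_chaos_diff:
  assumes "elementary_chaos M B q f X U" "elementary_chaos M B q g Y V"
  shows "elementary_chaos M B q (\<lambda>\<xi>. f \<xi> - g \<xi>) (\<lambda>\<omega>. X \<omega> - Y \<omega>) (\<lambda>\<omega> r. U \<omega> r - V \<omega> r)"
  using elementary_chaos_add[OF assms(1) elementary_chaos_cmult[OF assms(2), of "-1"]] by simp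

context brownian_increments
begin

lemma pair_integral_derivative_terms:
  assumes W: "is_wiener_integral M B h W" and V: "is_wiener_integral M B g V"
  shows "sq_integrable (M \<Otimes>\<^sub>M lborel) (\<lambda>(\<omega>, r). real q * hermite_poly (q - 1) (W \<omega>) * h r)"
    and "(\<integral>z. (case z of (\<omega>, r) \<Rightarrow> real q * hermite_poly (q - 1) (W \<omega>) * h r) *
           (case z of (\<omega>, r) \<Rightarrow> real q * hermite_poly (q - 1) (V \<omega>) * g r) \<partial>(M \<Otimes>\<^sub>M lborel)) =
         (real q)\<^sup>2 * expectation (\<lambda>\<omega>. hermite_poly (q - 1) (W \<omega>) * hermite_poly (q - 1) (V \<omega>)) * (\<integral>r. h r * g r \<partial>lborel)"
proof -
  have sf: "sigma_finite_measure M" by (rule sigma_finite_measure_axioms)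
  have sfl: "sigma_finite_measure (lborel :: real measure)" by (rule sigma_finite_lborel)
  have sq: "sq_integrable M (\<lambda>\<omega>. real q * hermite_poly (q - 1) (W \<omega>))"
    "sq_integrable M (\<lambda>\<omega>. real q * hermite_poly (q - 1) (V \<omega>))"
    using bounded_momentsD(4)[OF hermite_bounded_moments[OF W]] bounded_momentsD(4)[OF hermite_bounded_moments[OF V]]
    by (auto intro: sq_integrable_cmult)
  show "sq_integrable (M \<Otimes>\<^sub>M lborel) (\<lambda>(\<omega>, r). real q * hermite_poly (q - 1) (W \<omega>) * h r)"
    by (rule sq_integrable_pair_product[OF sf sfl sq(1) wiener_sq_integrable(2)[OF W]])
  have "(\<integral>(\<omega>, r). (real q * hermite_poly (q - 1) (W \<omega>) * (real q * hermite_poly (q - 1) (V \<omega>))) * (h r * g r) \<partial>(M \<Otimes>\<^sub>M lborel))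
      = expectation (\<lambda>\<omega>. real q * hermite_poly (q - 1) (W \<omega>) * (real q * hermite_poly (q - 1) (V \<omega>))) * (\<integral>r. h r * g r \<partial>lborel)"
    by (rule integral_pair_product[OF sf sfl sq_integrable_mult[OF sq] sq_integrable_mult[OF wiener_sq_integrable(2)[OF W] wiener_sq_integrable(2)[OF V]]])
  moreover have "(\<lambda>z. (case z of (\<omega>, r) \<Rightarrow> real q * hermite_poly (q - 1) (W \<omega>) * h r) *
           (case z of (\<omega>, r) \<Rightarrow> real q * hermite_poly (q - 1) (V \<omega>) * g r)) =
      (\<lambda>(\<omega>, r). (real q * hermite_poly (q - 1) (W \<omega>) * (real q * hermite_poly (q - 1) (V \<omega>))) * (h r * g r))"
    by (auto simp: mult_ac)
  moreover have "expectation (\<lambda>\<omega>. real q * hermite_poly (q - 1) (W \<omega>) * (real q * hermite_poly (q - 1) (V \<omega>))) =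
      (real q)\<^sup>2 * expectation (\<lambda>\<omega>. hermite_poly (q - 1) (W \<omega>) * hermite_poly (q - 1) (V \<omega>))"
  proof -
    have "(\<lambda>\<omega>. real q * hermite_poly (q - 1) (W \<omega>) * (real q * hermite_poly (q - 1) (V \<omega>))) =
      (\<lambda>\<omega>. (real q)\<^sup>2 * (hermite_poly (q - 1) (W \<omega>) * hermite_poly (q - 1) (V \<omega>)))"
      by (simp add: power2_eq_square mult_ac)
    then show ?thesis by simp
  qed
  ultimately show "(\<integral>z. (case z of (\<omega>, r) \<Rightarrow> real q * hermite_poly (q - 1) (W \<omega>) * h r) *
           (case z of (\<omega>, r) \<Rightarrow> real q * hermite_poly (q - 1) (V \<omega>) * g r) \<partial>(M \<Otimes>\<^sub>M lborel)) =
         (real q)\<^sup>2 * expectation (\<lambda>\<omega>. hermite_poly (q - 1) (W \<omega>) * hermite_poly (q - 1) (V \<omega>)) * (\<integral>r. h r * g r \<partial>lborel)"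
    by simp
qed

text \<open>
  Both the multiple integral and its derivative are isometries up to a constant, because the
  covariance of \<open>H\<^sub>q(W)\<close> and \<open>H\<^sub>q(V)\<close> is a multiple of the inner product of the tensor powers.
\<close>

lemma elementary_chaos_isometry:
  assumes e: "elementary_chaos M B q f X U" and q: "q \<ge> 1"
  shows "sq_integrable (lborel_pow q) f" "sq_integrable M X" "sq_integrable (M \<Otimes>\<^sub>M lborel) (case_prod U)"
    and "(\<integral>\<omega>. (X \<omega>)\<^sup>2 \<partial>M) = fact q * (\<integral>\<xi>. (f \<xi>)\<^sup>2 \<partial>lborel_pow q)"
    and "(\<integral>z. (case_prod U z)\<^sup>2 \<partial>(M \<Otimes>\<^sub>M lborel)) = real q * fact q * (\<integral>\<xi>. (f \<xi>)\<^sup>2 \<partial>lborel_pow q)"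
proof -
  obtain m :: nat and c h W where
    Wh: "\<forall>i<m. is_wiener_integral M B (h i) (W i) \<and> (\<integral>r. (h i r)\<^sup>2 \<partial>lborel) = 1"
    and f: "f = (\<lambda>\<xi>. \<Sum>i<m. c i * tensor_power q (h i) \<xi>)"
    and X: "X = (\<lambda>\<omega>. \<Sum>i<m. c i * hermite_poly q (W i \<omega>))"
    and U: "U = (\<lambda>\<omega> r. \<Sum>i<m. c i * (real q * hermite_poly (q - 1) (W i \<omega>) * h i r))"
    using e by (elim elementary_chaosE) (rule that)
  have W: "is_wiener_integral M B (h i) (W i)" and h1: "(\<integral>r. (h i r)\<^sup>2 \<partial>lborel) = 1" if "i < m" for i
    using Wh that by auto
  define \<rho> where "\<rho> i j = (\<integral>r. h i r * h j r \<partial>lborel)" for i j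
  note h = wiener_sq_integrable(2)[OF W]
  have sqf: "sq_integrable (lborel_pow q) (tensor_power q (h i))" if "i < m" for i
    by (rule tensor_power_sq_integrable[OF h[OF that]])
  have sqX: "sq_integrable M (\<lambda>\<omega>. hermite_poly q (W i \<omega>))" if "i < m" for i
    by (rule bounded_momentsD(4)[OF hermite_bounded_moments[OF W[OF that]]])
  define u where "u i = (\<lambda>(\<omega>, r). real q * hermite_poly (q - 1) (W i \<omega>) * h i r)" for i
  have squ: "sq_integrable (M \<Otimes>\<^sub>M lborel) (u i)" if "i < m" for i
    unfolding u_def by (rule pair_integral_derivative_terms(1)[OF W[OF that] W[OF that]])
  have Uu: "case_prod U = (\<lambda>z. \<Sum>i<m. c i * u i z)"
    by (auto simp: U u_def fun_eq_iff)
  show "sq_integrable (lborel_pow q) f"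
    unfolding f by (intro sq_integrable_sum sq_integrable_cmult sqf) simp
  show "sq_integrable M X"
    unfolding X by (intro sq_integrable_sum sq_integrable_cmult sqX) simp
  show "sq_integrable (M \<Otimes>\<^sub>M lborel) (case_prod U)"
    unfolding Uu by (intro sq_integrable_sum sq_integrable_cmult squ) simp
  have nf: "(\<integral>\<xi>. (f \<xi>)\<^sup>2 \<partial>lborel_pow q) = (\<Sum>i<m. \<Sum>j<m. c i * c j * \<rho> i j ^ q)"
    unfolding f \<rho>_def
    by (subst integral_square_sum, erule sqf, intro sum.cong refl arg_cong2[where f = "(*)"] integral_tensor_power_mult h) auto
  have "(\<integral>\<omega>. (X \<omega>)\<^sup>2 \<partial>M) = (\<Sum>i<m. \<Sum>j<m. c i * c j * (fact q * \<rho> i j ^ q))"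
    unfolding X \<rho>_def
    by (subst integral_square_sum, erule sqX, intro sum.cong refl arg_cong2[where f = "(*)"] hermite_covariance W h1) auto
  then show "(\<integral>\<omega>. (X \<omega>)\<^sup>2 \<partial>M) = fact q * (\<integral>\<xi>. (f \<xi>)\<^sup>2 \<partial>lborel_pow q)"
    unfolding nf by (simp add: sum_distrib_left mult_ac)
  have uu: "(\<integral>z. u i z * u j z \<partial>(M \<Otimes>\<^sub>M lborel)) = real q * fact q * \<rho> i j ^ q" if "i < m" "j < m" for i j
  proof -
    have "(\<integral>z. u i z * u j z \<partial>(M \<Otimes>\<^sub>M lborel)) = (real q)\<^sup>2 * (fact (q - 1) * \<rho> i j ^ (q - 1)) * \<rho> i j"
      using pair_integral_derivative_terms(2)[OF W[OF that(1)] W[OF that(2)], of q]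
        hermite_covariance[OF W[OF that(1)] W[OF that(2)] h1[OF that(1)], of "q - 1"]
      by (simp add: u_def \<rho>_def)
    also have "\<dots> = real q * (real q * fact (q - 1)) * (\<rho> i j ^ (q - 1) * \<rho> i j)"
      by (simp add: power2_eq_square mult_ac)
    also have "real q * fact (q - 1) = fact q" using q by (simp add: fact_reduce)
    also have "\<rho> i j ^ (q - 1) * \<rho> i j = \<rho> i j ^ q" using q by (cases q) auto
    finally show ?thesis .
  qed
  have "(\<integral>z. (case_prod U z)\<^sup>2 \<partial>(M \<Otimes>\<^sub>M lborel)) = (\<Sum>i<m. \<Sum>j<m. c i * c j * (real q * fact q * \<rho> i j ^ q))"
    unfolding Uu
    by (subst integral_square_sum, erule squ, intro sum.cong refl arg_cong2[where f = "(*)"] uu) auto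
  then show "(\<integral>z. (case_prod U z)\<^sup>2 \<partial>(M \<Otimes>\<^sub>M lborel)) = real q * fact q * (\<integral>\<xi>. (f \<xi>)\<^sup>2 \<partial>lborel_pow q)"
    unfolding nf by (simp add: sum_distrib_left mult_ac)
qed

end

section \<open>The chaos of fixed order and its Malliavin derivative\<close>

text \<open>
  The closure of the elementary chaos in the three mean-square norms, which are proportional on it.
\<close>

definition chaos ::
  "'a measure \<Rightarrow> (real \<Rightarrow> 'a \<Rightarrow> real) \<Rightarrow> nat \<Rightarrow>
     ((nat \<Rightarrow> real) \<Rightarrow> real) \<Rightarrow> ('a \<Rightarrow> real) \<Rightarrow> ('a \<Rightarrow> real \<Rightarrow> real) \<Rightarrow> bool" where
  "chaos M B q f X u \<longleftrightarrow>
     (\<exists>fs Xs Us. (\<forall>n. elementary_chaos M B q (fs n) (Xs n) (Us n)) \<and>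
        L2_converges (lborel_pow q) fs f \<and> L2_converges M Xs X \<and>
        L2_converges (M \<Otimes>\<^sub>M lborel) (\<lambda>n. case_prod (Us n)) (case_prod u))"

lemma chaosE:
  assumes "chaos M B q f X u"
  obtains fs Xs Us where "\<forall>n. elementary_chaos M B q (fs n) (Xs n) (Us n)"
    "L2_converges (lborel_pow q) fs f" "L2_converges M Xs X"
    "L2_converges (M \<Otimes>\<^sub>M lborel) (\<lambda>n. case_prod (Us n)) (case_prod u)"
  using assms unfolding chaos_def by (elim exE conjE) (rule that)

lemma chaosI:
  assumes "\<forall>n. elementary_chaos M B q (fs n) (Xs n) (Us n)"
    "L2_converges (lborel_pow q) fs f" "L2_converges M Xs X"
    "L2_converges (M \<Otimes>\<^sub>M lborel) (\<lambda>n. case_prod (Us n)) (case_prod u)"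
  shows "chaos M B q f X u"
  using assms unfolding chaos_def by blast

lemma chaos_cmult:
  assumes "chaos M B q f X u"
  shows "chaos M B q (\<lambda>\<xi>. a * f \<xi>) (\<lambda>\<omega>. a * X \<omega>) (\<lambda>\<omega> r. a * u \<omega> r)"
proof -
  obtain fs Xs Us where *: "\<forall>n. elementary_chaos M B q (fs n) (Xs n) (Us n)"
    "L2_converges (lborel_pow q) fs f" "L2_converges M Xs X"
    "L2_converges (M \<Otimes>\<^sub>M lborel) (\<lambda>n. case_prod (Us n)) (case_prod u)"
    using assms by (elim chaosE) (rule that)
  show ?thesis
    by (rule chaosI[OF allI[OF elementary_chaos_cmult[OF *(1)[rule_format], of a]] L2_converges_cmult[OF *(2)] L2_converges_cmult[OF *(3)]])
       (use L2_converges_cmult[OF *(4), of a] in \<open>simp add: case_prod_beta'\<close>)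
qed

lemma chaos_diff:
  assumes "chaos M B q f X u" "chaos M B q g Y v"
  shows "chaos M B q (\<lambda>\<xi>. f \<xi> - g \<xi>) (\<lambda>\<omega>. X \<omega> - Y \<omega>) (\<lambda>\<omega> r. u \<omega> r - v \<omega> r)"
proof -
  obtain fs Xs Us where 1: "\<forall>n. elementary_chaos M B q (fs n) (Xs n) (Us n)"
    "L2_converges (lborel_pow q) fs f" "L2_converges M Xs X"
    "L2_converges (M \<Otimes>\<^sub>M lborel) (\<lambda>n. case_prod (Us n)) (case_prod u)"
    using assms(1) by (elim chaosE) (rule that)
  obtain gs Ys Vs where 2: "\<forall>n. elementary_chaos M B q (gs n) (Ys n) (Vs n)"
    "L2_converges (lborel_pow q) gs g" "L2_converges M Ys Y"
    "L2_converges (M \<Otimes>\<^sub>M lborel) (\<lambda>n. case_prod (Vs n)) (case_prod v)"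
    using assms(2) by (elim chaosE) (rule that)
  show ?thesis
    by (rule chaosI[OF allI[OF elementary_chaos_diff[OF 1(1)[rule_format] 2(1)[rule_format]]] L2_converges_diff[OF 1(2) 2(2)] L2_converges_diff[OF 1(3) 2(3)]])
       (use L2_converges_diff[OF 1(4) 2(4)] in \<open>simp add: case_prod_beta'\<close>)
qed

lemma chaos_cong_kernel:
  assumes "chaos M B q f X u" "g \<in> borel_measurable (lborel_pow q)" "AE \<xi> in lborel_pow q. f \<xi> = g \<xi>"
  shows "chaos M B q g X u"
proof -
  obtain fs Xs Us where *: "\<forall>n. elementary_chaos M B q (fs n) (Xs n) (Us n)"
    "L2_converges (lborel_pow q) fs f" "L2_converges M Xs X"
    "L2_converges (M \<Otimes>\<^sub>M lborel) (\<lambda>n. case_prod (Us n)) (case_prod u)"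
    using assms(1) by (elim chaosE) (rule that)
  have "L2_converges (lborel_pow q) fs g"
    by (rule L2_converges_cong_AE[OF *(2)])
       (use assms(2,3) L2_convergesD(1)[OF *(2)] in \<open>auto simp: sq_integrable_def\<close>)
  from chaosI[OF *(1) this *(3,4)] show ?thesis .
qed

context brownian_increments
begin

text \<open>
  Two approximating sequences of kernels with the same limit differ by a null sequence, and by the
  isometry so do the integrals and their derivatives.
\<close>

lemma chaos_unique:
  assumes X: "chaos M B q f X u" and Y: "chaos M B q f Y v" and q: "q \<ge> 1"
  shows "AE \<omega> in M. X \<omega> = Y \<omega>" "AE z in M \<Otimes>\<^sub>M lborel. case_prod u z = case_prod v z"
proof -
  obtain fs Xs Us where 1: "\<forall>n. elementary_chaos M B q (fs n) (Xs n) (Us n)"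
    "L2_converges (lborel_pow q) fs f" "L2_converges M Xs X"
    "L2_converges (M \<Otimes>\<^sub>M lborel) (\<lambda>n. case_prod (Us n)) (case_prod u)"
    using X by (elim chaosE) (rule that)
  obtain gs Ys Vs where 2: "\<forall>n. elementary_chaos M B q (gs n) (Ys n) (Vs n)"
    "L2_converges (lborel_pow q) gs f" "L2_converges M Ys Y"
    "L2_converges (M \<Otimes>\<^sub>M lborel) (\<lambda>n. case_prod (Vs n)) (case_prod v)"
    using Y by (elim chaosE) (rule that)
  note iso = elementary_chaos_isometry[OF elementary_chaos_diff[OF 1(1)[rule_format] 2(1)[rule_format]] q]
  have "(\<lambda>n. \<integral>\<xi>. (fs n \<xi> - gs n \<xi>)\<^sup>2 \<partial>lborel_pow q) \<longlonglongrightarrow> (\<integral>\<xi>. (f \<xi> - f \<xi>)\<^sup>2 \<partial>lborel_pow q)"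
    by (rule L2_converges_square[OF L2_converges_diff[OF 1(2) 2(2)]])
  then have z: "(\<lambda>n. \<integral>\<xi>. (fs n \<xi> - gs n \<xi>)\<^sup>2 \<partial>lborel_pow q) \<longlonglongrightarrow> 0" by simp
  show "AE \<omega> in M. X \<omega> = Y \<omega>"
    by (rule L2_limits_AE_eq[OF 1(3) 2(3)]) (unfold iso(4), rule tendsto_mult_right_zero[OF z])
  have "(\<lambda>n. \<integral>z. (case_prod (Us n) z - case_prod (Vs n) z)\<^sup>2 \<partial>(M \<Otimes>\<^sub>M lborel)) \<longlonglongrightarrow> 0"
    using tendsto_mult_right_zero[OF z, of "real q * fact q"] iso(5) by (simp add: case_prod_beta')
  then show "AE z in M \<Otimes>\<^sub>M lborel. case_prod u z = case_prod v z"
    by (rule L2_limits_AE_eq[OF 1(4) 2(4)])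
qed

text \<open>
  By the isometry the derivatives of the approximating integrals form a Cauchy sequence.
\<close>

lemma chaos_exists:
  assumes I: "is_multiple_integral M B q f X" and q: "q \<ge> 1"
  shows "\<exists>u. chaos M B q f X u"
proof -
  obtain fs Xs where e: "\<And>n. elementary_multiple_integral M B q (fs n) (Xs n)"
    and fs: "L2_converges (lborel_pow q) fs f" and Xs: "L2_converges M Xs X"
    using I unfolding is_multiple_integral_def by blast
  have "\<forall>n. \<exists>U. elementary_chaos M B q (fs n) (Xs n) U" using elementary_chaos_exists[OF e] by blast
  then obtain Us where Us: "\<forall>n. elementary_chaos M B q (fs n) (Xs n) (Us n)" unfolding choice_iff by blast
  note U = Us[rule_format]
  have "\<exists>u. L2_converges (M \<Otimes>\<^sub>M lborel) (\<lambda>n. case_prod (Us n)) u"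
  proof (rule L2_complete)
    show "sq_integrable (M \<Otimes>\<^sub>M lborel) (case_prod (Us n))" for n
      by (rule elementary_chaos_isometry(3)[OF U q])
    fix e :: real assume e: "e > 0"
    let ?d = "\<lambda>n. \<integral>\<xi>. (fs n \<xi> - f \<xi>)\<^sup>2 \<partial>lborel_pow q"
    define c where "c = real q * fact q"
    have c: "c > 0" using q by (simp add: c_def)
    have "\<forall>\<^sub>F n in sequentially. ?d n < e / (4 * c)"
      using L2_convergesD(3)[OF fs] e c by (intro order_tendstoD(2)) auto
    then obtain K where K: "\<And>n. n \<ge> K \<Longrightarrow> ?d n < e / (4 * c)" by (auto simp: eventually_sequentially)
    show "\<exists>K. \<forall>m\<ge>K. \<forall>n\<ge>K. (\<integral>z. (case_prod (Us m) z - case_prod (Us n) z)\<^sup>2 \<partial>(M \<Otimes>\<^sub>M lborel)) < e"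
    proof (intro exI[of _ K] allI impI)
      fix m n assume mn: "m \<ge> K" "n \<ge> K"
      have sq: "sq_integrable (lborel_pow q) (\<lambda>\<xi>. fs m \<xi> - f \<xi>)" "sq_integrable (lborel_pow q) (\<lambda>\<xi>. f \<xi> - fs n \<xi>)"
        by (intro sq_integrable_diff L2_convergesD[OF fs])+
      have "(\<integral>z. (case_prod (Us m) z - case_prod (Us n) z)\<^sup>2 \<partial>(M \<Otimes>\<^sub>M lborel)) =
          c * (\<integral>\<xi>. (fs m \<xi> - fs n \<xi>)\<^sup>2 \<partial>lborel_pow q)"
        using elementary_chaos_isometry(5)[OF elementary_chaos_diff[OF U[of m] U[of n]] q]
        by (simp add: case_prod_beta' c_def)
      also have "(\<integral>\<xi>. (fs m \<xi> - fs n \<xi>)\<^sup>2 \<partial>lborel_pow q) \<le> 2 * ?d m + 2 * ?d n"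
        using integral_square_add_le[OF sq] by (simp add: power2_commute[of "f _"])
      also have "\<dots> < e / c"
        using K[OF mn(1)] K[OF mn(2)] c by (simp add: field_simps)
      finally show "(\<integral>z. (case_prod (Us m) z - case_prod (Us n) z)\<^sup>2 \<partial>(M \<Otimes>\<^sub>M lborel)) < e"
        using c by (simp add: mult_less_cancel_left_pos field_simps)
    qed
  qed
  then obtain u where "L2_converges (M \<Otimes>\<^sub>M lborel) (\<lambda>n. case_prod (Us n)) u" by blast
  then have "L2_converges (M \<Otimes>\<^sub>M lborel) (\<lambda>n. case_prod (Us n)) (case_prod (curry u))" by simp
  then have "chaos M B q f X (curry u)" by (rule chaosI[OF Us fs Xs])
  then show ?thesis by (rule exI[where x = "curry u"])
qed

end

subsection \<open>Elementary chaos consists of smooth functionals\<close>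

lemma partial_deriv_sum_poly:
  assumes "j < n"
  shows "partial_deriv j (\<lambda>x. \<Sum>i<n. poly (P i) (x i)) =
    (\<lambda>x. \<Sum>i<n. poly (if i = j then pderiv (P j) else 0) (x i))" (is "?L = ?R")
    and "((\<lambda>u. \<Sum>i<n. poly (P i) ((x(j := u)) i)) has_real_derivative poly (pderiv (P j)) (x j)) (at (x j))"
proof -
  show *: "((\<lambda>u. \<Sum>i<n. poly (P i) ((x(j := u)) i)) has_real_derivative poly (pderiv (P j)) (x j)) (at (x j))" for x
  proof -
    have "((\<lambda>u. poly (P i) ((x(j := u)) i)) has_real_derivative (if i = j then poly (pderiv (P j)) (x j) else 0)) (at (x j))" for i
      by (cases "i = j") (auto intro: poly_DERIV)
    then have "((\<lambda>u. \<Sum>i<n. poly (P i) ((x(j := u)) i)) has_real_derivative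
        (\<Sum>i<n. if i = j then poly (pderiv (P j)) (x j) else 0)) (at (x j))"
      by (intro DERIV_sum)
    then show ?thesis using assms by simp
  qed
  show "?L = ?R"
  proof
    fix x :: "nat \<Rightarrow> real"
    have "(\<Sum>i<n. poly (if i = j then pderiv (P j) else 0) (x i)) = (\<Sum>i<n. if i = j then poly (pderiv (P j)) (x j) else 0)"
      by (intro sum.cong) auto
    then show "?L x = ?R x"
      unfolding partial_deriv_def DERIV_imp_deriv[OF *] using assms by simp
  qed
qed

text \<open>
  Sums of polynomials in the single coordinates are closed under partial derivatives, so that all
  iterated derivatives are of this form.
\<close>

lemma smooth_poly_growth_sum_poly: "smooth_poly_growth n (\<lambda>x. \<Sum>i<n. poly (P i) (x i))"
proof -
  have fold: "\<exists>Q. fold partial_deriv is (\<lambda>x. \<Sum>i<n. poly (P i) (x i)) = (\<lambda>x. \<Sum>i<n. poly (Q i) (x i))"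
    if "set is \<subseteq> {..<n}" for "is" and P :: "nat \<Rightarrow> real poly"
    using that
  proof (induction "is" arbitrary: P)
    case (Cons j js)
    then have "j < n" "set js \<subseteq> {..<n}" by auto
    then show ?case
      using Cons.IH[of "\<lambda>i. if i = j then pderiv (P j) else 0"] by (simp add: partial_deriv_sum_poly(1))
  qed auto
  have regular: "continuous_on UNIV g \<and> (\<forall>i<n. \<forall>x. (\<lambda>u. g (x(i := u))) differentiable (at (x i))) \<and>
      (\<exists>C (k::nat). \<forall>x. \<bar>g x\<bar> \<le> C * (1 + (\<Sum>i<n. \<bar>x i\<bar>)) ^ k)"
    if g: "g = (\<lambda>x. \<Sum>i<n. poly (Q i) (x i))" for g and Q :: "nat \<Rightarrow> real poly"
  proof (intro conjI allI impI)
    show "continuous_on UNIV g" unfolding g by (intro continuous_on_sum C1_polyD(2)[OF C1_poly_coord_poly[of _ n]]) simp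
    show "(\<lambda>u. g (x(i := u))) differentiable (at (x i))" if "i < n" for i x
      using partial_deriv_sum_poly(2)[OF that, of Q x] unfolding g by (auto simp: real_differentiable_def)
    have "poly_growth n g"
      unfolding g by (intro poly_growth_sum C1_polyD(3)[OF C1_poly_coord_poly]) simp
    then show "\<exists>C (k::nat). \<forall>x. \<bar>g x\<bar> \<le> C * (1 + (\<Sum>i<n. \<bar>x i\<bar>)) ^ k" by (simp add: poly_growth_def)
  qed
  show ?thesis
    unfolding smooth_poly_growth_def Let_def
  proof (intro conjI[OF _ allI[OF impI]])
    show "\<forall>x y. (\<forall>i<n. x i = y i) \<longrightarrow> (\<Sum>i<n. poly (P i) (x i)) = (\<Sum>i<n. poly (P i) (y i))" by auto
    fix "is" assume "set is \<subseteq> {..<n}"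
    from fold[OF this, of P] obtain Q where
      "fold partial_deriv is (\<lambda>x. \<Sum>i<n. poly (P i) (x i)) = (\<lambda>x. \<Sum>i<n. poly (Q i) (x i))" ..
    from regular[OF this] show "continuous_on UNIV (fold partial_deriv is (\<lambda>x. \<Sum>i<n. poly (P i) (x i))) \<and>
      (\<forall>i<n. \<forall>x. (\<lambda>u. fold partial_deriv is (\<lambda>x. \<Sum>i<n. poly (P i) (x i)) (x(i := u))) differentiable (at (x i))) \<and>
      (\<exists>C (k::nat). \<forall>x. \<bar>fold partial_deriv is (\<lambda>x. \<Sum>i<n. poly (P i) (x i)) x\<bar> \<le> C * (1 + (\<Sum>i<n. \<bar>x i\<bar>)) ^ k)" .
  qed
qed

lemma elementary_chaos_smooth_functional:
  assumes "elementary_chaos M B q f X U"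
  shows "smooth_functional M B X U"
proof -
  obtain m :: nat and c h W where
    Wh: "\<forall>i<m. is_wiener_integral M B (h i) (W i) \<and> (\<integral>r. (h i r)\<^sup>2 \<partial>lborel) = 1"
    and "f = (\<lambda>\<xi>. \<Sum>i<m. c i * tensor_power q (h i) \<xi>)"
    and X: "X = (\<lambda>\<omega>. \<Sum>i<m. c i * hermite_poly q (W i \<omega>))"
    and U: "U = (\<lambda>\<omega> r. \<Sum>i<m. c i * (real q * hermite_poly (q - 1) (W i \<omega>) * h i r))"
    using assms by (elim elementary_chaosE) (rule that)
  have W: "is_wiener_integral M B (h i) (W i)" if "i < m" for i using Wh that by auto
  obtain P where P: "\<And>x. hermite_poly q x = poly P x" using hermite_poly_is_poly by blast
  define F where "F x = (\<Sum>i<m. poly (smult (c i) P) (x i))" for x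
  have PP: "poly (pderiv P) x = real q * hermite_poly (q - 1) x" for x
  proof -
    have "hermite_poly q = poly P" using P by auto
    then have "(poly P has_real_derivative real q * hermite_poly (q - 1) x) (at x)"
      using hermite_poly_deriv[of q x] by (simp only:)
    then show ?thesis by (rule DERIV_unique[OF poly_DERIV])
  qed
  have D: "partial_deriv j F x = c j * (real q * hermite_poly (q - 1) (x j))" if "j < m" for j x
    unfolding partial_deriv_def F_def
    by (subst DERIV_imp_deriv[OF partial_deriv_sum_poly(2)[OF that, of "\<lambda>i. smult (c i) P" x]])
       (simp add: pderiv_smult PP)
  show ?thesis
    unfolding smooth_functional_def
  proof (intro exI conjI allI impI)
    show "smooth_poly_growth m F" unfolding F_def by (rule smooth_poly_growth_sum_poly)
    show "is_wiener_integral M B (h i) (W i)" if "i < m" for i by (rule W[OF that])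
    show "X = (\<lambda>\<omega>. F (\<lambda>i. W i \<omega>))" by (simp add: X F_def P)
    show "U = (\<lambda>\<omega> r. \<Sum>j<m. partial_deriv j F (\<lambda>i. W i \<omega>) * h j r)"
      unfolding U by (intro ext sum.cong refl) (simp add: D mult.assoc)
  qed
qed

lemma chaos_has_malliavin_derivative:
  assumes "chaos M B q f X u"
  shows "has_malliavin_derivative M B X u"
  using assms elementary_chaos_smooth_functional unfolding chaos_def has_malliavin_derivative_def by blast

section \<open>Functionals of the path\<close>

abbreviation path_space :: "(real \<Rightarrow> real) measure" where
  "path_space \<equiv> (\<Pi>\<^sub>M t\<in>UNIV. borel)"

text \<open>
  The path is normalised to vanish at time zero, so that it carries the same information as the
  increments.
\<close>

definition path_map :: "(real \<Rightarrow> 'a \<Rightarrow> real) \<Rightarrow> 'a \<Rightarrow> real \<Rightarrow> real" where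
  "path_map B \<omega> t = B t \<omega> - B 0 \<omega>"

lemma space_path_space: "space path_space = UNIV"
  by (auto simp: space_PiM)

lemma (in brownian_increments) path_map_measurable: "path_map B \<in> measurable M path_space"
proof -
  have "(\<lambda>\<omega> t. B t \<omega> - B 0 \<omega>) \<in> measurable M path_space"
    using process_measurable by (intro measurable_PiM_single') auto
  then show ?thesis by (simp add: path_map_def[abs_def])
qed

text \<open>
  The values of the normalised path at finitely many times are linear in the increments over a
  common partition, whose joint law is a product of normal laws.
\<close>

lemma path_law_unique:
  assumes B1: "brownian_increments M B" and B2: "brownian_increments M' B'"
  shows "distr M path_space (path_map B) = distr M' path_space (path_map B')"
proof (rule measure_eqI_PiM_infinite)
  show "sets (distr M path_space (path_map B)) = sets path_space"
    "sets (distr M' path_space (path_map B')) = sets path_space" by simp_all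
  show "finite_measure (distr M path_space (path_map B))"
    using B1 brownian_increments.path_map_measurable[OF B1]
    by (intro prob_space.finite_measure prob_space.prob_space_distr) (auto simp: brownian_increments_def)
  fix A :: "real \<Rightarrow> real set" and J :: "real set"
  assume J: "finite J" and A: "\<And>t. t \<in> J \<Longrightarrow> A t \<in> sets borel"
  obtain N0 :: nat and \<tau> :: "nat \<Rightarrow> real" where \<tau>: "strict_mono \<tau>" "insert 0 J \<subseteq> \<tau> ` {..N0}"
    using finite_subset_partition[of "insert 0 J"] J by auto
  \<comment> \<open>One more increment than necessary, as the product formula for joint laws needs a nonempty index set.\<close>
  define N where "N = Suc N0"
  have "\<forall>t. \<exists>k. t \<in> insert 0 J \<longrightarrow> k \<le> N \<and> \<tau> k = t"
  proof
    fix t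
    show "\<exists>k. t \<in> insert 0 J \<longrightarrow> k \<le> N \<and> \<tau> k = t"
      using \<tau>(2) by (cases "t \<in> insert 0 J") (auto simp: N_def intro: le_SucI)
  qed
  then obtain \<kappa> where \<kappa>: "\<And>t. t \<in> insert 0 J \<Longrightarrow> \<kappa> t \<le> N \<and> \<tau> (\<kappa> t) = t"
    unfolding choice_iff by blast
  define e where "e t k = (of_bool (k < \<kappa> t) - of_bool (k < \<kappa> 0) :: real)" for t k
  define E where "E = {x \<in> space (PiM {..<N} (\<lambda>_. borel :: real measure)). \<forall>t\<in>J. (\<Sum>k<N. e t k * x k) \<in> A t}"
  have E: "E \<in> sets (PiM {..<N} (\<lambda>_. borel))"
    unfolding E_def
  proof (intro sets.sets_Collect_finite_All J)
    fix t assume t: "t \<in> J"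
    have "(\<lambda>x. \<Sum>k<N. e t k * x k) \<in> borel_measurable (PiM {..<N} (\<lambda>_. borel))"
      by (intro borel_measurable_sum borel_measurable_times borel_measurable_const measurable_component_singleton)
    from measurable_sets[OF this A[OF t]]
    show "{x \<in> space (PiM {..<N} (\<lambda>_. borel :: real measure)). (\<Sum>k<N. e t k * x k) \<in> A t} \<in> sets (PiM {..<N} (\<lambda>_. borel))"
      by (simp add: vimage_def Int_def conj_commute)
  qed
  have main: "emeasure (distr M path_space (path_map B)) (prod_emb UNIV (\<lambda>_. borel) J (Pi\<^sub>E J A)) =
      emeasure (PiM {..<N} (\<lambda>k. centred_normal (sqrt (\<tau> (Suc k) - \<tau> k)))) E"
    if "brownian_increments M B" for M :: "'z measure" and B
  proof -
    interpret brownian_increments M B by fact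
    note [measurable] = process_measurable
    define X where "X k \<omega> = B (\<tau> (Suc k)) \<omega> - B (\<tau> k) \<omega>" for k \<omega>
    have lt: "\<tau> k < \<tau> (Suc k)" for k using \<tau>(1) by (simp add: strict_mono_Suc_iff)
    have [measurable]: "X k \<in> borel_measurable M" for k unfolding X_def by measurable
    have indep: "indep_vars (\<lambda>_. borel) X {..<N}"
      unfolding X_def by (rule increments_independent) (rule lt)
    have "distr M borel (X k) = centred_normal (sqrt (\<tau> (Suc k) - \<tau> k))" for k
    proof -
      have "distr M borel (X k) = distr M lborel (X k)" by (rule distr_cong) auto
      also have "\<dots> = centred_normal (sqrt (\<tau> (Suc k) - \<tau> k))"
        using distributed_distr_eq_density[OF increment_normal[OF lt]] by (simp add: X_def[abs_def])
      finally show ?thesis .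
    qed
    then have law: "distr M (PiM {..<N} (\<lambda>_. borel)) (\<lambda>\<omega>. \<lambda>k\<in>{..<N}. X k \<omega>) =
        PiM {..<N} (\<lambda>k. centred_normal (sqrt (\<tau> (Suc k) - \<tau> k)))"
      using indep by (subst (asm) indep_vars_iff_distr_eq_PiM') (auto simp: N_def)
    have val: "path_map B \<omega> t = (\<Sum>k<N. e t k * (\<lambda>k\<in>{..<N}. X k \<omega>) k)" if "t \<in> J" for t \<omega>
    proof -
      have "path_map B \<omega> t = B (\<tau> (\<kappa> t)) \<omega> - B (\<tau> (\<kappa> 0)) \<omega>"
        using \<kappa>[of t] \<kappa>[of 0] that by (simp add: path_map_def)
      also have "\<dots> = (\<Sum>k<N. e t k * X k \<omega>)"
        unfolding e_def X_def by (rule partition_telescope) (use \<kappa>[of t] \<kappa>[of 0] that in auto)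
      also have "\<dots> = (\<Sum>k<N. e t k * (\<lambda>k\<in>{..<N}. X k \<omega>) k)" by (intro sum.cong) auto
      finally show ?thesis .
    qed
    have "emeasure (distr M path_space (path_map B)) (prod_emb UNIV (\<lambda>_. borel) J (Pi\<^sub>E J A)) =
        emeasure M (path_map B -` prod_emb UNIV (\<lambda>_. borel) J (Pi\<^sub>E J A) \<inter> space M)"
      using J A by (intro emeasure_distr path_map_measurable sets_PiM_I) auto
    also have "path_map B -` prod_emb UNIV (\<lambda>_. borel) J (Pi\<^sub>E J A) \<inter> space M =
        (\<lambda>\<omega>. \<lambda>k\<in>{..<N}. X k \<omega>) -` E \<inter> space M"
      using val by (auto simp: prod_emb_def E_def space_PiM PiE_iff restrict_def extensional_def)
    also have "emeasure M \<dots> = emeasure (distr M (PiM {..<N} (\<lambda>_. borel)) (\<lambda>\<omega>. \<lambda>k\<in>{..<N}. X k \<omega>)) E"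
      by (intro emeasure_distr[symmetric] E measurable_restrict) simp
    finally show ?thesis unfolding law .
  qed
  show "emeasure (distr M path_space (path_map B)) (prod_emb UNIV (\<lambda>_. borel) J (Pi\<^sub>E J A)) =
      emeasure (distr M' path_space (path_map B')) (prod_emb UNIV (\<lambda>_. borel) J (Pi\<^sub>E J A))"
    unfolding main[OF B1] main[OF B2] ..
qed

definition factors_through :: "'b measure \<Rightarrow> 'c measure \<Rightarrow> ('b \<Rightarrow> 'c) \<Rightarrow> ('b \<Rightarrow> real) \<Rightarrow> bool" where
  "factors_through N Q T x \<longleftrightarrow> (\<exists>\<phi>\<in>borel_measurable Q. AE y in N. x y = \<phi> (T y))"

lemma factors_through_limit:
  assumes "\<And>n. factors_through N Q T (xs n)" and lim: "AE y in N. (\<lambda>n. xs n y) \<longlonglongrightarrow> x y"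
  shows "factors_through N Q T x"
proof -
  have "\<forall>n. \<exists>\<phi>. \<phi> \<in> borel_measurable Q \<and> (AE y in N. xs n y = \<phi> (T y))"
    using assms(1) unfolding factors_through_def by blast
  then obtain \<phi> where [measurable]: "\<And>n. \<phi> n \<in> borel_measurable Q" and \<phi>: "\<And>n. AE y in N. xs n y = \<phi> n (T y)"
    unfolding choice_iff by blast
  have "AE y in N. \<forall>n. xs n y = \<phi> n (T y)" using \<phi> by (simp add: AE_all_countable)
  with lim have "AE y in N. x y = lim (\<lambda>n. \<phi> n (T y))"
  proof eventually_elim
    case (elim y)
    then show ?case by (simp add: limI)
  qed
  then show ?thesis unfolding factors_through_def by (intro bexI[of _ "\<lambda>p. lim (\<lambda>n. \<phi> n p)"]) auto
qed

lemma factors_through_L2_limit: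
  assumes "\<And>n. factors_through N Q T (xs n)" "L2_converges N xs x"
  shows "factors_through N Q T x"
proof -
  obtain r where "AE y in N. (\<lambda>n. xs (r n) y) \<longlonglongrightarrow> x y" using L2_converges_AE_subseq[OF assms(2)] by blast
  then show ?thesis by (rule factors_through_limit[OF assms(1)])
qed

text \<open>
  The mean-square distance of two functionals depends on the path law only, so convergence along one
  process carries over to the other.
\<close>

lemma L2_converges_transport:
  assumes T: "T \<in> measurable N Q" and T': "T' \<in> measurable N' Q" and law: "distr N Q T = distr N' Q T'"
    and conv: "L2_converges N xs x" and \<phi>s: "\<And>n. \<phi>s n \<in> borel_measurable Q" "\<And>n. AE y in N. xs n y = \<phi>s n (T y)"
  shows "\<exists>\<phi>\<in>borel_measurable Q. (AE y in N. x y = \<phi> (T y)) \<and> L2_converges N' (\<lambda>n y. \<phi>s n (T' y)) (\<lambda>y. \<phi> (T' y))"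
proof -
  have "factors_through N Q T (xs n)" for n using \<phi>s unfolding factors_through_def by blast
  from factors_through_L2_limit[OF this conv] obtain \<phi> where
    \<phi>: "\<phi> \<in> borel_measurable Q" "AE y in N. x y = \<phi> (T y)"
    unfolding factors_through_def by blast
  have "L2_converges N (\<lambda>n y. \<phi>s n (T y)) (\<lambda>y. \<phi> (T y))"
    by (rule L2_converges_cong_AE[OF conv measurable_compose[OF T \<phi>s(1)] measurable_compose[OF T \<phi>(1)] \<phi>s(2) \<phi>(2)])
  then have "L2_converges (distr N Q T) \<phi>s \<phi>" by (simp add: L2_converges_distr_iff[OF T \<phi>s(1) \<phi>(1)])
  then have "L2_converges N' (\<lambda>n y. \<phi>s n (T' y)) (\<lambda>y. \<phi> (T' y))"
    unfolding law L2_converges_distr_iff[OF T' \<phi>s(1) \<phi>(1)] .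
  with \<phi> show ?thesis by blast
qed

text \<open>
  A step integral is a fixed linear combination of path values, whatever the driving process.
\<close>

lemma step_integral_path_functional:
  assumes "step_integral B h X"
  shows "\<exists>\<phi>\<in>borel_measurable path_space. X = (\<lambda>\<omega>. \<phi> (path_map B \<omega>)) \<and>
    (\<forall>B' :: real \<Rightarrow> 'z \<Rightarrow> real. step_integral B' h (\<lambda>\<omega>. \<phi> (path_map B' \<omega>)))"
proof -
  obtain n :: nat and c a b where s: "\<forall>i<n. a i \<le> b i" "h = (\<lambda>r. \<Sum>i<n. c i * indicator {a i<..b i} r)"
    "X = (\<lambda>\<omega>. \<Sum>i<n. c i * (B (b i) \<omega> - B (a i) \<omega>))"
    using assms unfolding step_integral_def by blast
  define \<phi> :: "(real \<Rightarrow> real) \<Rightarrow> real" where "\<phi> p = (\<Sum>i<n. c i * (p (b i) - p (a i)))" for p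
  have eq: "\<phi> (path_map B' \<omega>) = (\<Sum>i<n. c i * (B' (b i) \<omega> - B' (a i) \<omega>))" for B' and \<omega> :: 'y
    by (simp add: \<phi>_def path_map_def)
  have "\<phi> \<in> borel_measurable path_space"
    unfolding \<phi>_def[abs_def]
    by (intro borel_measurable_sum borel_measurable_times borel_measurable_diff borel_measurable_const
        measurable_component_singleton) auto
  moreover have "X = (\<lambda>\<omega>. \<phi> (path_map B \<omega>))" unfolding eq by (rule s(3))
  moreover have "step_integral B' h (\<lambda>\<omega>. \<phi> (path_map B' \<omega>))" for B' :: "real \<Rightarrow> 'z \<Rightarrow> real"
    unfolding eq step_integral_def using s(1,2) by blast
  ultimately show ?thesis by blast
qed

lemma wiener_integral_transport:
  assumes B1: "brownian_increments M B" and B2: "brownian_increments M' B'" and W: "is_wiener_integral M B h W"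
  shows "\<exists>\<phi>\<in>borel_measurable path_space. (AE \<omega> in M. W \<omega> = \<phi> (path_map B \<omega>)) \<and>
    is_wiener_integral M' B' h (\<lambda>\<omega>. \<phi> (path_map B' \<omega>))"
proof -
  obtain hs Xs where st: "\<forall>n. step_integral B (hs n) (Xs n)" and hs: "L2_converges lborel hs h"
    and Xs: "L2_converges M Xs W"
    using W unfolding is_wiener_integral_def by blast
  have "\<forall>n. \<exists>\<phi>. \<phi> \<in> borel_measurable path_space \<and> Xs n = (\<lambda>\<omega>. \<phi> (path_map B \<omega>)) \<and>
      step_integral B' (hs n) (\<lambda>\<omega>. \<phi> (path_map B' \<omega>))"
    using step_integral_path_functional[OF st[rule_format]] by blast
  then obtain \<phi>s where \<phi>s: "\<And>n. \<phi>s n \<in> borel_measurable path_space" "\<And>n. Xs n = (\<lambda>\<omega>. \<phi>s n (path_map B \<omega>))"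
      "\<And>n. step_integral B' (hs n) (\<lambda>\<omega>. \<phi>s n (path_map B' \<omega>))"
    unfolding choice_iff by blast
  have "\<exists>\<phi>\<in>borel_measurable path_space. (AE \<omega> in M. W \<omega> = \<phi> (path_map B \<omega>)) \<and>
      L2_converges M' (\<lambda>n \<omega>. \<phi>s n (path_map B' \<omega>)) (\<lambda>\<omega>. \<phi> (path_map B' \<omega>))"
    using \<phi>s(2) by (intro L2_converges_transport[OF brownian_increments.path_map_measurable[OF B1]
        brownian_increments.path_map_measurable[OF B2] path_law_unique[OF B1 B2] Xs \<phi>s(1)]) simp
  then obtain \<phi> where \<phi>: "\<phi> \<in> borel_measurable path_space" "AE \<omega> in M. W \<omega> = \<phi> (path_map B \<omega>)"
      "L2_converges M' (\<lambda>n \<omega>. \<phi>s n (path_map B' \<omega>)) (\<lambda>\<omega>. \<phi> (path_map B' \<omega>))" by blast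
  have "is_wiener_integral M' B' h (\<lambda>\<omega>. \<phi> (path_map B' \<omega>))"
    unfolding is_wiener_integral_def
    by (intro exI[of _ hs] exI[of _ "\<lambda>n \<omega>. \<phi>s n (path_map B' \<omega>)"] conjI allI \<phi>s(3) hs \<phi>(3))
  with \<phi>(1,2) show ?thesis by blast
qed

lemma hermite_poly_measurable: "hermite_poly q \<in> borel_measurable borel"
proof -
  have "continuous_on UNIV (hermite_poly q)"
    by (rule DERIV_continuous_on) (rule has_field_derivative_at_within[OF hermite_poly_deriv])
  then show ?thesis by (rule borel_measurable_continuous_onI)
qed

lemma AE_pair_fst:
  assumes "sigma_finite_measure N" "AE x in M. P x"
  shows "AE z in M \<Otimes>\<^sub>M N. P (fst z)"
proof -
  obtain A where A: "A \<in> null_sets M" "{x \<in> space M. \<not> P x} \<subseteq> A"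
    using assms(2) by (auto simp: eventually_ae_filter)
  have "emeasure (M \<Otimes>\<^sub>M N) (A \<times> space N) = emeasure M A * emeasure N (space N)"
    using A(1) by (intro sigma_finite_measure.emeasure_pair_measure_Times[OF assms(1)]) auto
  then have "A \<times> space N \<in> null_sets (M \<Otimes>\<^sub>M N)" using A(1) by (auto simp: null_sets_def)
  then show ?thesis
    by (rule AE_I'[rotated, rotated]) (use A(2) in \<open>auto simp: space_pair_measure\<close>) 
qed

definition path_time_map :: "(real \<Rightarrow> 'a \<Rightarrow> real) \<Rightarrow> 'a \<times> real \<Rightarrow> (real \<Rightarrow> real) \<times> real" where
  "path_time_map B = (\<lambda>(\<omega>, r). (path_map B \<omega>, r))"

lemma (in brownian_increments) path_time_map_measurable:
  "path_time_map B \<in> measurable (M \<Otimes>\<^sub>M lborel) (path_space \<Otimes>\<^sub>M lborel)"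
  unfolding path_time_map_def using path_map_measurable by measurable

lemma path_time_law_unique:
  assumes B1: "brownian_increments M B" and B2: "brownian_increments M' B'"
  shows "distr (M \<Otimes>\<^sub>M lborel) (path_space \<Otimes>\<^sub>M lborel) (path_time_map B) =
    distr (M' \<Otimes>\<^sub>M lborel) (path_space \<Otimes>\<^sub>M lborel) (path_time_map B')"
proof -
  have "distr M path_space (path_map B) \<Otimes>\<^sub>M lborel =
      distr (M \<Otimes>\<^sub>M lborel) (path_space \<Otimes>\<^sub>M lborel) (path_time_map B)"
    if "brownian_increments M B" for M :: "'z measure" and B
  proof -
    have id: "distr lborel lborel (\<lambda>r::real. r) = lborel" by (rule distr_id2) simp
    have "distr M path_space (path_map B) \<Otimes>\<^sub>M distr lborel lborel (\<lambda>r::real. r) =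
      distr (M \<Otimes>\<^sub>M lborel) (path_space \<Otimes>\<^sub>M lborel) (\<lambda>(x, y). (path_map B x, y))"
      by (rule pair_measure_distr[OF brownian_increments.path_map_measurable[OF that]]) (simp_all add: id sigma_finite_lborel)
    then show ?thesis by (simp add: id path_time_map_def)
  qed
  from this[OF B1] this[OF B2] path_law_unique[OF B1 B2] show ?thesis by simp
qed

lemma elementary_chaos_transport:
  assumes B1: "brownian_increments M B" and B2: "brownian_increments M' B'" and X: "elementary_chaos M B q f X U"
  shows "\<exists>\<phi>\<in>borel_measurable path_space. \<exists>\<upsilon>\<in>borel_measurable (path_space \<Otimes>\<^sub>M lborel).
    (AE \<omega> in M. X \<omega> = \<phi> (path_map B \<omega>)) \<and>
    (AE z in M \<Otimes>\<^sub>M lborel. case_prod U z = \<upsilon> (path_time_map B z)) \<and>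
    elementary_chaos M' B' q f (\<lambda>\<omega>. \<phi> (path_map B' \<omega>)) (\<lambda>\<omega> r. \<upsilon> (path_map B' \<omega>, r))"
proof -
  obtain m :: nat and c h W where
    W: "\<forall>i<m. is_wiener_integral M B (h i) (W i) \<and> (\<integral>r. (h i r)\<^sup>2 \<partial>lborel) = 1"
    and f: "f = (\<lambda>\<xi>. \<Sum>i<m. c i * tensor_power q (h i) \<xi>)"
    and X: "X = (\<lambda>\<omega>. \<Sum>i<m. c i * hermite_poly q (W i \<omega>))"
    and U: "U = (\<lambda>\<omega> r. \<Sum>i<m. c i * (real q * hermite_poly (q - 1) (W i \<omega>) * h i r))"
    using X by (elim elementary_chaosE) (rule that)
  have "\<forall>i. \<exists>\<phi>. i < m \<longrightarrow> \<phi> \<in> borel_measurable path_space \<and> (AE \<omega> in M. W i \<omega> = \<phi> (path_map B \<omega>)) \<and>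
    is_wiener_integral M' B' (h i) (\<lambda>\<omega>. \<phi> (path_map B' \<omega>))"
    using wiener_integral_transport[OF B1 B2] W by blast
  then obtain w where w: "\<And>i. i < m \<Longrightarrow> w i \<in> borel_measurable path_space"
    "\<And>i. i < m \<Longrightarrow> AE \<omega> in M. W i \<omega> = w i (path_map B \<omega>)"
    "\<And>i. i < m \<Longrightarrow> is_wiener_integral M' B' (h i) (\<lambda>\<omega>. w i (path_map B' \<omega>))"
    unfolding choice_iff by blast
  have h: "h i \<in> borel_measurable lborel" if "i < m" for i
    using W that by (auto simp: is_wiener_integral_def L2_converges_def sq_integrable_def)
  have ae: "AE \<omega> in M. \<forall>i<m. W i \<omega> = w i (path_map B \<omega>)"
    using w(2) by (simp add: AE_all_countable)
  define \<phi> where "\<phi> p = (\<Sum>i<m. c i * hermite_poly q (w i p))" for p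
  define \<upsilon> where "\<upsilon> z = (\<Sum>i<m. c i * (real q * hermite_poly (q - 1) (w i (fst z)) * h i (snd z)))" for z
  show ?thesis
  proof (intro bexI[of _ \<phi>] bexI[of _ \<upsilon>] conjI)
    show "\<phi> \<in> borel_measurable path_space"
      unfolding \<phi>_def[abs_def]
      by (intro borel_measurable_sum borel_measurable_times borel_measurable_const
          measurable_compose[OF w(1) hermite_poly_measurable]) simp
    show "\<upsilon> \<in> borel_measurable (path_space \<Otimes>\<^sub>M lborel)"
      unfolding \<upsilon>_def[abs_def]
      by (intro borel_measurable_sum borel_measurable_times borel_measurable_const
          measurable_compose[OF measurable_fst measurable_compose[OF w(1) hermite_poly_measurable]]
          measurable_compose[OF measurable_snd h]) simp_all
    show "AE \<omega> in M. X \<omega> = \<phi> (path_map B \<omega>)"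
      using ae by eventually_elim (simp add: X \<phi>_def)
    have "AE z in M \<Otimes>\<^sub>M lborel. \<forall>i<m. W i (fst z) = w i (path_map B (fst z))"
      by (rule AE_pair_fst[OF sigma_finite_lborel ae])
    then show "AE z in M \<Otimes>\<^sub>M lborel. case_prod U z = \<upsilon> (path_time_map B z)"
      by eventually_elim (auto simp: U \<upsilon>_def path_time_map_def case_prod_beta)
    show "elementary_chaos M' B' q f (\<lambda>\<omega>. \<phi> (path_map B' \<omega>)) (\<lambda>\<omega> r. \<upsilon> (path_map B' \<omega>, r))"
      unfolding elementary_chaos_def
      by (intro exI[of _ m] exI[of _ c] exI[of _ h] exI[of _ "\<lambda>i \<omega>. w i (path_map B' \<omega>)"])
         (use W w(3) in \<open>simp add: f \<phi>_def \<upsilon>_def\<close>)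
  qed
qed

text \<open>
  With \<open>B' = B\<close> this says that a multiple integral and its derivative are functionals of the path; in
  general it realises the same functionals for another process.
\<close>

lemma chaos_transport:
  assumes B1: "brownian_increments M B" and B2: "brownian_increments M' B'" and X: "chaos M B q f X u"
  shows "\<exists>\<phi>\<in>borel_measurable path_space. \<exists>\<upsilon>\<in>borel_measurable (path_space \<Otimes>\<^sub>M lborel).
    (AE \<omega> in M. X \<omega> = \<phi> (path_map B \<omega>)) \<and>
    (AE z in M \<Otimes>\<^sub>M lborel. case_prod u z = \<upsilon> (path_time_map B z)) \<and>
    chaos M' B' q f (\<lambda>\<omega>. \<phi> (path_map B' \<omega>)) (\<lambda>\<omega> r. \<upsilon> (path_map B' \<omega>, r))"
proof -
  obtain fs Xs Us where e: "\<forall>n. elementary_chaos M B q (fs n) (Xs n) (Us n)"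
    and fs: "L2_converges (lborel_pow q) fs f" and Xs: "L2_converges M Xs X"
    and Us: "L2_converges (M \<Otimes>\<^sub>M lborel) (\<lambda>n. case_prod (Us n)) (case_prod u)"
    using X by (elim chaosE) (rule that)
  have "\<forall>n. \<exists>\<phi> \<upsilon>. \<phi> \<in> borel_measurable path_space \<and> \<upsilon> \<in> borel_measurable (path_space \<Otimes>\<^sub>M lborel) \<and>
    (AE \<omega> in M. Xs n \<omega> = \<phi> (path_map B \<omega>)) \<and>
    (AE z in M \<Otimes>\<^sub>M lborel. case_prod (Us n) z = \<upsilon> (path_time_map B z)) \<and>
    elementary_chaos M' B' q (fs n) (\<lambda>\<omega>. \<phi> (path_map B' \<omega>)) (\<lambda>\<omega> r. \<upsilon> (path_map B' \<omega>, r))"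
    using elementary_chaos_transport[OF B1 B2 e[rule_format]] by blast
  then obtain \<phi>s \<upsilon>s where t: "\<And>n. \<phi>s n \<in> borel_measurable path_space"
    "\<And>n. \<upsilon>s n \<in> borel_measurable (path_space \<Otimes>\<^sub>M lborel)"
    "\<And>n. AE \<omega> in M. Xs n \<omega> = \<phi>s n (path_map B \<omega>)"
    "\<And>n. AE z in M \<Otimes>\<^sub>M lborel. case_prod (Us n) z = \<upsilon>s n (path_time_map B z)"
    "\<forall>n. elementary_chaos M' B' q (fs n) (\<lambda>\<omega>. \<phi>s n (path_map B' \<omega>)) (\<lambda>\<omega> r. \<upsilon>s n (path_map B' \<omega>, r))"
    unfolding choice_iff by blast
  obtain \<phi> where \<phi>: "\<phi> \<in> borel_measurable path_space" "AE \<omega> in M. X \<omega> = \<phi> (path_map B \<omega>)"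
    "L2_converges M' (\<lambda>n \<omega>. \<phi>s n (path_map B' \<omega>)) (\<lambda>\<omega>. \<phi> (path_map B' \<omega>))"
    using L2_converges_transport[where \<phi>s = \<phi>s, OF brownian_increments.path_map_measurable[OF B1]
        brownian_increments.path_map_measurable[OF B2] path_law_unique[OF B1 B2] Xs t(1) t(3)] by blast
  obtain \<upsilon> where \<upsilon>: "\<upsilon> \<in> borel_measurable (path_space \<Otimes>\<^sub>M lborel)"
    "AE z in M \<Otimes>\<^sub>M lborel. case_prod u z = \<upsilon> (path_time_map B z)"
    "L2_converges (M' \<Otimes>\<^sub>M lborel) (\<lambda>n z. \<upsilon>s n (path_time_map B' z)) (\<lambda>z. \<upsilon> (path_time_map B' z))"
    using L2_converges_transport[where \<phi>s = \<upsilon>s, OF brownian_increments.path_time_map_measurable[OF B1]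
        brownian_increments.path_time_map_measurable[OF B2] path_time_law_unique[OF B1 B2] Us t(2) t(4)] by blast
  have "L2_converges (M' \<Otimes>\<^sub>M lborel) (\<lambda>n. case_prod (\<lambda>\<omega> r. \<upsilon>s n (path_map B' \<omega>, r))) (case_prod (\<lambda>\<omega> r. \<upsilon> (path_map B' \<omega>, r)))"
    using \<upsilon>(3) by (simp add: path_time_map_def case_prod_beta')
  from chaosI[OF t(5) fs \<phi>(3) this] \<phi>(1,2) \<upsilon>(1,2) show ?thesis by blast
qed

section \<open>Uniqueness of the Malliavin derivative\<close>

lemma C1_poly_shift:
  assumes g: "C1_poly k g g'"
  shows "C1_poly (n + k) (\<lambda>x. g (\<lambda>i. x (n + i))) (\<lambda>j x. if n \<le> j then g' (j - n) (\<lambda>i. x (n + i)) else 0)"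
proof -
  note G = C1_polyD[OF g]
  have cont: "continuous_on UNIV (\<lambda>x::nat \<Rightarrow> real. (\<lambda>i. x (n + i)))"
    by (intro continuous_on_coordinatewise_then_product continuous_on_product_coordinates)
  have growth: "poly_growth (n + k) (\<lambda>x. u (\<lambda>i. x (n + i)))" if "poly_growth k u" for u
  proof -
    obtain C p where C: "C \<ge> 0" "\<And>x. \<bar>u x\<bar> \<le> C * (1 + (\<Sum>i<k. \<bar>x i\<bar>)) ^ p" using \<open>poly_growth k u\<close> by (rule poly_growthE) blast
    have "\<bar>u (\<lambda>i. x (n + i))\<bar> \<le> C * (1 + (\<Sum>i<n + k. \<bar>x i\<bar>)) ^ p" for x
    proof -
      have "(\<Sum>i<k. \<bar>x (n + i)\<bar>) = (\<Sum>i\<in>(\<lambda>i. n + i) ` {..<k}. \<bar>x i\<bar>)" by (subst sum.reindex) (auto simp: inj_on_def)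
      also have "\<dots> \<le> (\<Sum>i<n + k. \<bar>x i\<bar>)" by (intro sum_mono2) auto
      finally have "C * (1 + (\<Sum>i<k. \<bar>x (n + i)\<bar>)) ^ p \<le> C * (1 + (\<Sum>i<n + k. \<bar>x i\<bar>)) ^ p"
        using C(1) by (intro mult_left_mono power_mono) (auto simp: sum_nonneg)
      with C(2)[of "\<lambda>i. x (n + i)"] show ?thesis by linarith
    qed
    then show ?thesis unfolding poly_growth_def by blast
  qed
  show ?thesis
    unfolding C1_poly_def
  proof (intro conjI allI impI)
    show "g (\<lambda>i. x (n + i)) = g (\<lambda>i. y (n + i))" if "\<forall>i<n + k. x i = y i" for x y
      using that by (intro G(1)) auto
    show "continuous_on UNIV (\<lambda>x. g (\<lambda>i. x (n + i)))" by (rule continuous_on_compose2[OF G(2) cont]) simp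
    show "poly_growth (n + k) (\<lambda>x. g (\<lambda>i. x (n + i)))" by (rule growth[OF G(3)])
    fix j assume j: "j < n + k"
    show "continuous_on UNIV (\<lambda>x. if n \<le> j then g' (j - n) (\<lambda>i. x (n + i)) else 0)"
    proof (cases "n \<le> j")
      case True
      then have "j - n < k" using j by simp
      from continuous_on_compose2[OF G(4)[OF this] cont] True show ?thesis by simp
    qed simp
    show "poly_growth (n + k) (\<lambda>x. if n \<le> j then g' (j - n) (\<lambda>i. x (n + i)) else 0)"
    proof (cases "n \<le> j")
      case True
      then have "j - n < k" using j by simp
      from growth[OF G(5)[OF this]] True show ?thesis by simp
    qed (simp add: poly_growth_const)
    fix x :: "nat \<Rightarrow> real"
    show "((\<lambda>u. g (\<lambda>i. (x(j := u)) (n + i))) has_real_derivative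
        (if n \<le> j then g' (j - n) (\<lambda>i. x (n + i)) else 0)) (at (x j))"
    proof (cases "n \<le> j")
      case True
      have "(\<lambda>i. (x(j := u)) (n + i)) = (\<lambda>i. x (n + i))(j - n := u)" for u
        using True by (auto simp: fun_eq_iff)
      moreover have "j - n < k" using j True by simp
      ultimately show ?thesis using G(6)[of "j - n" "\<lambda>i. x (n + i)"] True by simp
    next
      case False
      then have "(\<lambda>i. (x(j := u)) (n + i)) = (\<lambda>i. x (n + i))" for u by (auto simp: fun_eq_iff)
      then show ?thesis using False by simp
    qed
  qed
qed

lemma smooth_poly_growth_C1_poly:
  assumes "smooth_poly_growth n f"
  shows "C1_poly n f (\<lambda>j. partial_deriv j f)"
proof -
  have dep: "\<forall>x y. (\<forall>i<n. x i = y i) \<longrightarrow> f x = f y"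
    and all: "\<And>is. set is \<subseteq> {..<n} \<Longrightarrow> continuous_on UNIV (fold partial_deriv is f) \<and>
           (\<forall>i<n. \<forall>x. (\<lambda>u. fold partial_deriv is f (x(i := u))) differentiable (at (x i))) \<and>
           poly_growth n (fold partial_deriv is f)"
    using assms unfolding smooth_poly_growth_def Let_def poly_growth_def by blast+
  show ?thesis
    unfolding C1_poly_def
  proof (intro conjI allI impI)
    show "f x = f y" if "\<forall>i<n. x i = y i" for x y using dep that by blast
    show "continuous_on UNIV f" "poly_growth n f" using all[of "[]"] by auto
    fix j assume j: "j < n"
    show "continuous_on UNIV (partial_deriv j f)" "poly_growth n (partial_deriv j f)"
      using all[of "[j]"] j by auto
    show "((\<lambda>u. f (x(j := u))) has_real_derivative partial_deriv j f x) (at (x j))" for x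
      using all[of "[]"] j unfolding partial_deriv_def
      by (auto simp: DERIV_deriv_iff_real_differentiable)
  qed
qed

context brownian_increments
begin

lemma wiener_integral_increment:
  assumes "a \<le> b"
  shows "is_wiener_integral M B (indicator {a<..b}) (\<lambda>\<omega>. B b \<omega> - B a \<omega>)"
proof -
  have st: "step_integral B (indicator {a<..b}) (\<lambda>\<omega>. B b \<omega> - B a \<omega>)"
    unfolding step_integral_def using assms
    by (intro exI[of _ "1::nat"] exI[of _ "\<lambda>_. 1::real"] exI[of _ "\<lambda>_. a"] exI[of _ "\<lambda>_. b"]) simp
  have "sq_integrable M (\<lambda>\<omega>. B b \<omega> - B a \<omega>)"
  proof (cases "a = b")
    case False
    then show ?thesis using bounded_momentsD(4)[OF increment_bounded_moments[of a b]] assms by simp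
  qed (simp add: sq_integrable_zero)
  moreover have "sq_integrable lborel (indicator {a<..b} :: real \<Rightarrow> real)"
  proof -
    have "(\<lambda>r::real. (indicator {a<..b} r :: real)\<^sup>2) = indicator {a<..b}" by (auto simp: indicator_def)
    then show ?thesis using assms by (simp add: sq_integrable_def)
  qed
  ultimately show ?thesis
    unfolding is_wiener_integral_def
    by (intro exI[of _ "\<lambda>n. indicator {a<..b}"] exI[of _ "\<lambda>n \<omega>. B b \<omega> - B a \<omega>"] conjI allI st) (rule L2_converges_const; assumption)+
qed

lemma wiener_integral_path: "\<exists>e. is_wiener_integral M B e (\<lambda>\<omega>. path_map B \<omega> t)"
proof (cases "0 \<le> t")
  case True
  then show ?thesis using wiener_integral_increment[of 0 t] by (auto simp: path_map_def)
next
  case False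
  have "is_wiener_integral M B (\<lambda>r. - indicator {t<..0} r) (\<lambda>\<omega>. B t \<omega> - B 0 \<omega>)"
    unfolding is_wiener_integral_def
  proof (intro exI conjI allI)
    note w = wiener_sq_integrable[OF wiener_integral_increment[of t 0]]
    show "step_integral B (\<lambda>r. - indicator {t<..0} r) (\<lambda>\<omega>. B t \<omega> - B 0 \<omega>)"
      unfolding step_integral_def using False
      by (intro exI[of _ "1::nat"] exI[of _ "\<lambda>_. -1::real"] exI[of _ "\<lambda>_. t"] exI[of _ "\<lambda>_. 0"]) simp
    show "L2_converges lborel (\<lambda>n r. - indicator {t<..0} r) (\<lambda>r. - indicator {t<..0} r)"
      using sq_integrable_cmult[OF w(2), of "-1"] False by (intro L2_converges_const) simp
    show "L2_converges M (\<lambda>n \<omega>. B t \<omega> - B 0 \<omega>) (\<lambda>\<omega>. B t \<omega> - B 0 \<omega>)"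
      using sq_integrable_cmult[OF w(1), of "-1"] False by (intro L2_converges_const) simp
  qed
  then show ?thesis by (auto simp: path_map_def)
qed

text \<open>
  Integration by parts for the product of a smooth functional \<open>F\<close> and a test functional
  \<open>G = g(V)\<close> moves the derivative from \<open>F\<close> to \<open>G\<close>.
\<close>

lemma smooth_functional_duality:
  assumes F: "smooth_functional M B F DF"
    and V: "\<And>i. i < k \<Longrightarrow> is_wiener_integral M B (e i) (V i)" and g: "C1_poly k g g'"
    and Y: "is_wiener_integral M B h Y"
  shows "(\<integral>z. case_prod DF z * (case z of (\<omega>, r) \<Rightarrow> g (\<lambda>i. V i \<omega>) * h r) \<partial>(M \<Otimes>\<^sub>M lborel)) =
    expectation (\<lambda>\<omega>. F \<omega> * (Y \<omega> * g (\<lambda>i. V i \<omega>) - (\<Sum>i<k. (\<integral>r. e i r * h r \<partial>lborel) * g' i (\<lambda>i. V i \<omega>))))"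
proof -
  obtain n :: nat and f a W where f: "smooth_poly_growth n f"
    and W: "\<And>i. i < n \<Longrightarrow> is_wiener_integral M B (a i) (W i)"
    and Feq: "F = (\<lambda>\<omega>. f (\<lambda>i. W i \<omega>))"
    and DFeq: "DF = (\<lambda>\<omega> r. \<Sum>j<n. partial_deriv j f (\<lambda>i. W i \<omega>) * a j r)"
    using F unfolding smooth_functional_def by blast
  note C = smooth_poly_growth_C1_poly[OF f]
  \<comment> \<open>A single family: first the variables of \<open>F\<close>, then those of \<open>G\<close>, and last the direction \<open>Y\<close>.\<close>
  define hs where "hs i = (if i < n then a i else if i < n + k then e (i - n) else h)" for i
  define Ws where "Ws i = (if i < n then W i else if i < n + k then V (i - n) else Y)" for i
  define m where "m = Suc (n + k)"
  have Ws: "is_wiener_integral M B (hs i) (Ws i)" if "i < m" for i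
    using W[of i] V[of "i - n"] Y by (auto simp: hs_def Ws_def)
  have C1: "C1_poly m f (\<lambda>j. if j < n then partial_deriv j f else (\<lambda>x. 0))"
    by (rule C1_poly_mono[OF C]) (simp add: m_def)
  have C2: "C1_poly m (\<lambda>x. g (\<lambda>i. x (n + i)))
      (\<lambda>j. if j < n + k then (\<lambda>x. if n \<le> j then g' (j - n) (\<lambda>i. x (n + i)) else 0) else (\<lambda>x. 0))"
    by (rule C1_poly_mono[OF C1_poly_shift[OF g]]) (simp add: m_def)
  have fW: "f (\<lambda>i. Ws i \<omega>) = f (\<lambda>i. W i \<omega>)" for \<omega>
    by (rule C1_polyD(1)[OF C]) (simp add: Ws_def)
  have fW': "partial_deriv j f (\<lambda>i. Ws i \<omega>) = partial_deriv j f (\<lambda>i. W i \<omega>)" if "j < n" for j \<omega>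
    by (rule C1_poly_gradient_depends[OF C that]) (simp add: Ws_def)
  have gV: "g (\<lambda>i. Ws (n + i) \<omega>) = g (\<lambda>i. V i \<omega>)" for \<omega>
    by (rule C1_polyD(1)[OF g]) (simp add: Ws_def)
  have gV': "g' j (\<lambda>i. Ws (n + i) \<omega>) = g' j (\<lambda>i. V i \<omega>)" if "j < k" for j \<omega>
    by (rule C1_poly_gradient_depends[OF g that]) (simp add: Ws_def)
  define G where "G \<omega> = g (\<lambda>i. V i \<omega>)" for \<omega>
  define G' where "G' i \<omega> = g' i (\<lambda>i. V i \<omega>)" for i \<omega>
  define F' where "F' j \<omega> = partial_deriv j f (\<lambda>i. W i \<omega>)" for j \<omega>
  have mF: "bounded_moments M (\<lambda>_::nat. F)"
    unfolding Feq by (rule wiener_function_bounded_moments[OF W C1_polyD(2,3)[OF C] C1_polyD(1)[OF C]])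
  have mF': "bounded_moments M (\<lambda>_::nat. F' j)" if "j < n" for j
    unfolding F'_def[abs_def]
    by (rule wiener_function_bounded_moments[OF W C1_polyD(4,5)[OF C that] C1_poly_gradient_depends[OF C that]])
  have mG: "bounded_moments M (\<lambda>_::nat. G)"
    unfolding G_def[abs_def] by (rule wiener_function_bounded_moments[OF V C1_polyD(2,3)[OF g] C1_polyD(1)[OF g]])
  have mG': "bounded_moments M (\<lambda>_::nat. G' i)" if "i < k" for i
    unfolding G'_def[abs_def]
    by (rule wiener_function_bounded_moments[OF V C1_polyD(4,5)[OF g that] C1_poly_gradient_depends[OF g that]])
  have mY: "bounded_moments M (\<lambda>_::nat. Y)" by (rule wiener_bounded_moments[OF Y])
  have ibp: "expectation (\<lambda>\<omega>. Y \<omega> * (F \<omega> * G \<omega>)) =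
      (\<Sum>j<n. (\<integral>r. a j r * h r \<partial>lborel) * expectation (\<lambda>\<omega>. F' j \<omega> * G \<omega>)) +
      (\<Sum>i<k. (\<integral>r. e i r * h r \<partial>lborel) * expectation (\<lambda>\<omega>. F \<omega> * G' i \<omega>))"
  proof -
    define T where "T j = (\<integral>r. hs j r * hs (n + k) r \<partial>lborel) * expectation (\<lambda>\<omega>.
        (if j < n then partial_deriv j f else (\<lambda>x. 0)) (\<lambda>i. Ws i \<omega>) * g (\<lambda>i. Ws (n + i) \<omega>) +
        f (\<lambda>i. Ws i \<omega>) * (if j < n + k then (\<lambda>x. if n \<le> j then g' (j - n) (\<lambda>i. x (n + i)) else 0) else (\<lambda>x. 0)) (\<lambda>i. Ws i \<omega>))" for j
    have "expectation (\<lambda>\<omega>. Ws (n + k) \<omega> * (f (\<lambda>i. Ws i \<omega>) * g (\<lambda>i. Ws (n + i) \<omega>))) = (\<Sum>j<m. T j)"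
      unfolding T_def
      by (rule wiener_integration_by_parts[OF Ws C1_poly_mult[OF C1 C2]]) (simp_all add: m_def)
    moreover have "expectation (\<lambda>\<omega>. Ws (n + k) \<omega> * (f (\<lambda>i. Ws i \<omega>) * g (\<lambda>i. Ws (n + i) \<omega>))) =
        expectation (\<lambda>\<omega>. Y \<omega> * (F \<omega> * G \<omega>))"
      unfolding fW gV by (simp add: Ws_def Feq G_def)
    moreover have "(\<Sum>j<m. T j) = (\<Sum>j<n. T j) + (\<Sum>i<k. T (n + i))"
    proof -
      have "T (n + k) = 0" by (simp add: T_def)
      moreover have "(\<Sum>j<n + k. T j) = (\<Sum>j<n. T j) + (\<Sum>i<k. T (n + i))"
        by (induction k) simp_all
      ultimately show ?thesis by (simp add: m_def)
    qed
    moreover have "T j = (\<integral>r. a j r * h r \<partial>lborel) * expectation (\<lambda>\<omega>. F' j \<omega> * G \<omega>)" if "j < n" for j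
      using that unfolding T_def gV by (simp add: fW' hs_def F'_def G_def)
    moreover have "T (n + i) = (\<integral>r. e i r * h r \<partial>lborel) * expectation (\<lambda>\<omega>. F \<omega> * G' i \<omega>)" if "i < k" for i
      using that unfolding T_def fW by (simp add: gV' hs_def Feq G'_def)
    ultimately show ?thesis by simp
  qed
  have sf: "sigma_finite_measure M" by (rule sigma_finite_measure_axioms)
  have sqa: "sq_integrable lborel (a j)" if "j < n" for j by (rule wiener_sq_integrable(2)[OF W[OF that]])
  have sqh: "sq_integrable lborel h" by (rule wiener_sq_integrable(2)[OF Y])
  have iFG: "integrable M (\<lambda>\<omega>. F' j \<omega> * G \<omega>)" if "j < n" for j
    by (rule bounded_momentsD(3)[OF bounded_moments_mult[OF mF'[OF that] mG]])
  have "(\<integral>z. case_prod DF z * (case z of (\<omega>, r) \<Rightarrow> G \<omega> * h r) \<partial>(M \<Otimes>\<^sub>M lborel)) =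
      (\<integral>z. (\<Sum>j<n. (case z of (\<omega>, r) \<Rightarrow> (F' j \<omega> * G \<omega>) * (a j r * h r))) \<partial>(M \<Otimes>\<^sub>M lborel))"
  proof (intro Bochner_Integration.integral_cong refl)
    fix z :: "'a \<times> real"
    obtain \<omega> r where z: "z = (\<omega>, r)" by (cases z)
    show "case_prod DF z * (case z of (\<omega>, r) \<Rightarrow> G \<omega> * h r) = (\<Sum>j<n. (case z of (\<omega>, r) \<Rightarrow> (F' j \<omega> * G \<omega>) * (a j r * h r)))"
      unfolding z DFeq prod.case F'_def sum_distrib_right by (intro sum.cong refl) (simp only: mult_ac)
  qed
  also have "\<dots> = (\<Sum>j<n. \<integral>z. (case z of (\<omega>, r) \<Rightarrow> (F' j \<omega> * G \<omega>) * (a j r * h r)) \<partial>(M \<Otimes>\<^sub>M lborel))"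
    by (rule Bochner_Integration.integral_sum)
       (intro integrable_pair_product sf sigma_finite_lborel iFG sq_integrable_mult sqa sqh; simp)
  also have "\<dots> = (\<Sum>j<n. expectation (\<lambda>\<omega>. F' j \<omega> * G \<omega>) * (\<integral>r. a j r * h r \<partial>lborel))"
    by (intro sum.cong refl integral_pair_product sf sigma_finite_lborel iFG sq_integrable_mult sqa sqh) simp_all
  also have "\<dots> = expectation (\<lambda>\<omega>. Y \<omega> * (F \<omega> * G \<omega>)) -
      (\<Sum>i<k. (\<integral>r. e i r * h r \<partial>lborel) * expectation (\<lambda>\<omega>. F \<omega> * G' i \<omega>))"
    unfolding ibp by (simp add: mult.commute)
  also have "\<dots> = expectation (\<lambda>\<omega>. Y \<omega> * (F \<omega> * G \<omega>)) -
      expectation (\<lambda>\<omega>. \<Sum>i<k. (\<integral>r. e i r * h r \<partial>lborel) * (F \<omega> * G' i \<omega>))"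
    using bounded_momentsD(3)[OF bounded_moments_mult[OF mF mG']]
    by (subst Bochner_Integration.integral_sum) auto
  also have "\<dots> = expectation (\<lambda>\<omega>. Y \<omega> * (F \<omega> * G \<omega>) - (\<Sum>i<k. (\<integral>r. e i r * h r \<partial>lborel) * (F \<omega> * G' i \<omega>)))"
    by (intro Bochner_Integration.integral_diff[symmetric] Bochner_Integration.integrable_sum integrable_mult_right
        bounded_momentsD(3)[OF bounded_moments_mult[OF mF mG']]
        bounded_momentsD(3)[OF bounded_moments_mult[OF mY bounded_moments_mult[OF mF mG]]]) simp
  also have "(\<lambda>\<omega>. Y \<omega> * (F \<omega> * G \<omega>) - (\<Sum>i<k. (\<integral>r. e i r * h r \<partial>lborel) * (F \<omega> * G' i \<omega>))) =
      (\<lambda>\<omega>. F \<omega> * (Y \<omega> * G \<omega> - (\<Sum>i<k. (\<integral>r. e i r * h r \<partial>lborel) * G' i \<omega>)))"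
    by (simp add: right_diff_distrib sum_distrib_left mult_ac)
  finally show ?thesis by (simp add: G_def G'_def)
qed

lemma malliavin_derivative_duality:
  assumes F: "has_malliavin_derivative M B F u"
    and V: "\<And>i. i < k \<Longrightarrow> is_wiener_integral M B (e i) (V i)" and g: "C1_poly k g g'"
    and Y: "is_wiener_integral M B h Y"
  shows "(\<integral>z. case_prod u z * (case z of (\<omega>, r) \<Rightarrow> g (\<lambda>i. V i \<omega>) * h r) \<partial>(M \<Otimes>\<^sub>M lborel)) =
    expectation (\<lambda>\<omega>. F \<omega> * (Y \<omega> * g (\<lambda>i. V i \<omega>) - (\<Sum>i<k. (\<integral>r. e i r * h r \<partial>lborel) * g' i (\<lambda>i. V i \<omega>))))"
proof -
  obtain Fs us where sm: "\<And>n. smooth_functional M B (Fs n) (us n)" and Fs: "L2_converges M Fs F"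
    and us: "L2_converges (M \<Otimes>\<^sub>M lborel) (\<lambda>n. case_prod (us n)) (case_prod u)"
    using F unfolding has_malliavin_derivative_def by blast
  define R where "R \<omega> = Y \<omega> * g (\<lambda>i. V i \<omega>) - (\<Sum>i<k. (\<integral>r. e i r * h r \<partial>lborel) * g' i (\<lambda>i. V i \<omega>))" for \<omega>
  have mg: "bounded_moments M (\<lambda>_::nat. \<lambda>\<omega>. g (\<lambda>i. V i \<omega>))"
    by (rule wiener_function_bounded_moments[OF V C1_polyD(2,3)[OF g] C1_polyD(1)[OF g]])
  have mg': "bounded_moments M (\<lambda>_::nat. \<lambda>\<omega>. g' i (\<lambda>i. V i \<omega>))" if "i < k" for i
    by (rule wiener_function_bounded_moments[OF V C1_polyD(4,5)[OF g that] C1_poly_gradient_depends[OF g that]])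
  have "bounded_moments M (\<lambda>_::nat. R)"
    unfolding R_def[abs_def]
    by (intro bounded_moments_diff bounded_moments_mult bounded_moments_sum bounded_moments_cmult mg mg'
        wiener_bounded_moments[OF Y]) simp
  then have R: "L2_converges M (\<lambda>n. R) R" by (intro L2_converges_const) (rule bounded_momentsD(4))
  have test: "L2_converges (M \<Otimes>\<^sub>M lborel) (\<lambda>n z. case z of (\<omega>, r) \<Rightarrow> g (\<lambda>i. V i \<omega>) * h r)
      (\<lambda>z. case z of (\<omega>, r) \<Rightarrow> g (\<lambda>i. V i \<omega>) * h r)"
    by (intro L2_converges_const sq_integrable_pair_product sigma_finite_measure_axioms sigma_finite_lborel
        bounded_momentsD(4)[OF mg] wiener_sq_integrable(2)[OF Y])
  have "(\<lambda>n. expectation (\<lambda>\<omega>. Fs n \<omega> * R \<omega>)) \<longlonglongrightarrow> expectation (\<lambda>\<omega>. F \<omega> * R \<omega>)"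
    by (rule L2_converges_inner[OF Fs R])
  moreover have "(\<lambda>n. \<integral>z. case_prod (us n) z * (case z of (\<omega>, r) \<Rightarrow> g (\<lambda>i. V i \<omega>) * h r) \<partial>(M \<Otimes>\<^sub>M lborel)) \<longlonglongrightarrow>
      (\<integral>z. case_prod u z * (case z of (\<omega>, r) \<Rightarrow> g (\<lambda>i. V i \<omega>) * h r) \<partial>(M \<Otimes>\<^sub>M lborel))"
    by (rule L2_converges_inner[OF us test])
  moreover have "(\<integral>z. case_prod (us n) z * (case z of (\<omega>, r) \<Rightarrow> g (\<lambda>i. V i \<omega>) * h r) \<partial>(M \<Otimes>\<^sub>M lborel)) =
      expectation (\<lambda>\<omega>. Fs n \<omega> * R \<omega>)" for n
    unfolding R_def by (rule smooth_functional_duality[OF sm V g Y])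
  ultimately show ?thesis
    unfolding R_def[symmetric] by (simp add: LIMSEQ_unique)
qed

end

text \<open>
  The positive and the negative part of \<open>w\<close> are densities of two measures that agree on the generator.
\<close>

lemma AE_zero_of_generator:
  fixes w :: "'b \<Rightarrow> real"
  assumes w[measurable]: "w \<in> borel_measurable \<mu>"
    and E: "Int_stable E" "E \<subseteq> Pow (space \<mu>)" "sets \<mu> = sigma_sets (space \<mu>) E"
    and A: "range A \<subseteq> E" "(\<Union>i::nat. A i) = space \<mu>"
    and int: "\<And>X. X \<in> E \<Longrightarrow> integrable \<mu> (\<lambda>z. w z * indicator X z)"
    and zero: "\<And>X. X \<in> E \<Longrightarrow> (\<integral>z. w z * indicator X z \<partial>\<mu>) = 0"
  shows "AE z in \<mu>. w z = 0"
proof -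
  define P where "P = density \<mu> (\<lambda>z. ennreal (max 0 (w z)))"
  define Q where "Q = density \<mu> (\<lambda>z. ennreal (max 0 (- w z)))"
  have part: "emeasure (density \<mu> (\<lambda>z. ennreal (max 0 (u z)))) X = ennreal (\<integral>z. max 0 (u z * indicator X z) \<partial>\<mu>)"
    if X: "X \<in> sets \<mu>" and i: "integrable \<mu> (\<lambda>z. u z * indicator X z)" and [measurable]: "u \<in> borel_measurable \<mu>"
    for u X
  proof -
    have "emeasure (density \<mu> (\<lambda>z. ennreal (max 0 (u z)))) X = (\<integral>\<^sup>+z. ennreal (max 0 (u z)) * indicator X z \<partial>\<mu>)"
      using X by (intro emeasure_density) auto
    also have "\<dots> = (\<integral>\<^sup>+z. ennreal (max 0 (u z * indicator X z)) \<partial>\<mu>)"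
      by (intro nn_integral_cong) (auto simp: indicator_def)
    also have "\<dots> = ennreal (\<integral>z. max 0 (u z * indicator X z) \<partial>\<mu>)"
      using i by (intro nn_integral_eq_integral) auto
    finally show ?thesis .
  qed
  have setsE: "X \<in> sets \<mu>" if "X \<in> E" for X using that unfolding E(3) by auto
  have intn: "integrable \<mu> (\<lambda>z. - w z * indicator X z)" if "X \<in> E" for X
    using int[OF that] by simp
  have eq: "emeasure P X = emeasure Q X" if X: "X \<in> E" for X
  proof -
    have "max 0 (w z * indicator X z) - max 0 (- w z * indicator X z) = w z * indicator X z" for z
      by (auto simp: max_def)
    moreover have "(\<integral>z. max 0 (w z * indicator X z) - max 0 (- w z * indicator X z) \<partial>\<mu>) =
        (\<integral>z. max 0 (w z * indicator X z) \<partial>\<mu>) - (\<integral>z. max 0 (- w z * indicator X z) \<partial>\<mu>)"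
      using int[OF X] intn[OF X] by (intro Bochner_Integration.integral_diff integrable_max) auto
    ultimately have "(\<integral>z. max 0 (w z * indicator X z) \<partial>\<mu>) = (\<integral>z. max 0 (- w z * indicator X z) \<partial>\<mu>)"
      using zero[OF X] by simp
    then show ?thesis
      unfolding P_def Q_def part[OF setsE[OF X] int[OF X] w]
      using part[OF setsE[OF X] intn[OF X]] by simp
  qed
  have "P = Q"
  proof (rule measure_eqI_generator_eq[OF E(1) E(2) eq _ _ A])
    show "sets P = sigma_sets (space \<mu>) E" "sets Q = sigma_sets (space \<mu>) E"
      by (simp_all add: P_def Q_def E(3))
    fix i
    have X: "A i \<in> E" using A(1) by auto
    show "emeasure P (A i) \<noteq> \<infinity>" unfolding P_def part[OF setsE[OF X] int[OF X] w] by simp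
  qed
  have nonpos: "AE z in \<mu>. u z \<le> 0"
    if PQ: "density \<mu> (\<lambda>z. ennreal (max 0 (u z))) = density \<mu> (\<lambda>z. ennreal (max 0 (- u z)))"
      and [measurable]: "u \<in> borel_measurable \<mu>" for u :: "'b \<Rightarrow> real"
  proof -
    define X where "X = {z \<in> space \<mu>. 0 < u z}"
    have X: "X \<in> sets \<mu>" unfolding X_def by measurable
    have "(\<integral>\<^sup>+z. ennreal (max 0 (u z)) * indicator X z \<partial>\<mu>) = (\<integral>\<^sup>+z. ennreal (max 0 (- u z)) * indicator X z \<partial>\<mu>)"
      using arg_cong[OF PQ, of "\<lambda>N. emeasure N X"] X by (simp add: emeasure_density)
    also have "\<dots> = (\<integral>\<^sup>+z. 0 \<partial>\<mu>)"
      by (intro nn_integral_cong) (auto simp: X_def indicator_def max_def)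
    finally have z: "(\<integral>\<^sup>+z. ennreal (max 0 (u z)) * indicator X z \<partial>\<mu>) = 0" by simp
    have m: "(\<lambda>z. ennreal (max 0 (u z)) * indicator X z) \<in> borel_measurable \<mu>" using X by measurable
    have "AE z in \<mu>. ennreal (max 0 (u z)) * indicator X z = 0"
      using nn_integral_0_iff_AE[OF m] z by (rule iffD1)
    then show ?thesis
    proof (rule AE_mp, intro AE_I2 impI)
      fix z assume "z \<in> space \<mu>" "ennreal (max 0 (u z)) * indicator X z = 0"
      then show "u z \<le> 0" by (cases "0 < u z") (auto simp: X_def)
    qed
  qed
  have "AE z in \<mu>. w z \<le> 0" using \<open>P = Q\<close> by (intro nonpos) (auto simp: P_def Q_def)
  moreover have "AE z in \<mu>. - w z \<le> 0" using \<open>P = Q\<close> by (intro nonpos) (auto simp: P_def Q_def)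
  ultimately show ?thesis by eventually_elim simp
qed

text \<open>
  Finitely many upper bounds on path values, given as pairs of a time and a level: in this form the
  intersection of two cylinders has the union of their constraints and the intersection of their time
  intervals.
\<close>

definition path_cylinder :: "(real \<times> real) set \<Rightarrow> real \<Rightarrow> real \<Rightarrow> ((real \<Rightarrow> real) \<times> real) set" where
  "path_cylinder J a b = {z. (\<forall>p\<in>J. fst z (fst p) \<le> snd p) \<and> a < snd z \<and> snd z \<le> b}"

lemma space_path_time: "space (path_space \<Otimes>\<^sub>M (lborel :: real measure)) = UNIV"
  by (simp add: space_pair_measure space_path_space)

lemma path_cylinder_measurable:
  assumes "finite J"
  shows "path_cylinder J a b \<in> sets (path_space \<Otimes>\<^sub>M lborel)"
proof -
  have coord: "(\<lambda>z. fst z t) \<in> borel_measurable (path_space \<Otimes>\<^sub>M (lborel :: real measure))" for t :: real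
    by (rule measurable_compose[OF measurable_fst measurable_component_singleton]) simp
  have "{z \<in> space (path_space \<Otimes>\<^sub>M (lborel :: real measure)). (\<forall>p\<in>J. fst z (fst p) \<le> snd p) \<and> a < snd z \<and> snd z \<le> b}
      \<in> sets (path_space \<Otimes>\<^sub>M (lborel :: real measure))"
  proof (intro sets.sets_Collect_conj sets.sets_Collect_finite_All assms)
    show "{z \<in> space (path_space \<Otimes>\<^sub>M (lborel :: real measure)). fst z (fst p) \<le> snd p} \<in> sets (path_space \<Otimes>\<^sub>M (lborel :: real measure))" for p
      using coord by measurable
  qed measurable
  then show ?thesis by (simp add: path_cylinder_def space_path_time)
qed

lemma sets_path_time_generated:
  "sets (path_space \<Otimes>\<^sub>M (lborel :: real measure)) = sigma_sets UNIV {path_cylinder J a b | J a b. finite J}"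
proof
  let ?E = "{path_cylinder J a b | J a b. finite J}"
  let ?S = "sigma UNIV ?E"
  have sS: "sets ?S = sigma_sets UNIV ?E" by (rule sets_measure_of) simp
  have spS: "space ?S = UNIV" by (rule space_measure_of) simp
  have cyl: "path_cylinder J a b \<in> sets ?S" if "finite J" for J a b
    unfolding sS using that by blast
  have arch: "\<exists>n. - real n < x \<and> x \<le> real n" for x :: real
  proof -
    obtain n where "\<bar>x\<bar> < real n" using reals_Archimedean2 by blast
    then show ?thesis by (intro exI[of _ n]) auto
  qed
  have 1: "(\<lambda>z. fst z) \<in> measurable ?S path_space"
  proof -
    have "(\<lambda>z. fst z t) \<in> borel_measurable ?S" for t
      unfolding borel_measurable_iff_le
    proof
      fix c
      have "{z \<in> space ?S. fst z t \<le> c} = (\<Union>n. path_cylinder {(t, c)} (- real n) (real n))"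
        using arch by (auto simp: spS path_cylinder_def)
      also have "\<dots> \<in> sets ?S" by (intro sets.countable_UN') (auto intro: cyl)
      finally show "{z \<in> space ?S. fst z t \<le> c} \<in> sets ?S" .
    qed
    then have "(\<lambda>z t. fst z t) \<in> measurable ?S path_space"
      by (intro measurable_PiM_single') auto
    then show ?thesis by simp
  qed
  have 2: "(\<lambda>z. snd z) \<in> measurable ?S lborel"
  proof -
    have "snd \<in> borel_measurable ?S"
      unfolding borel_measurable_iff_le
    proof
      fix c
      have "{z \<in> space ?S. snd z \<le> c} = (\<Union>n. path_cylinder {} (- real n) c)"
        using arch by (auto simp: spS path_cylinder_def)
      also have "\<dots> \<in> sets ?S" by (intro sets.countable_UN') (auto intro: cyl)
      finally show "{z \<in> space ?S. snd z \<le> c} \<in> sets ?S" .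
    qed
    then show ?thesis by simp
  qed
  have id: "(\<lambda>z. z) \<in> measurable ?S (path_space \<Otimes>\<^sub>M lborel)"
    using measurable_Pair[OF 1 2] by simp
  show "sets (path_space \<Otimes>\<^sub>M lborel) \<subseteq> sigma_sets UNIV ?E"
  proof
    fix X :: "((real \<Rightarrow> real) \<times> real) set" assume "X \<in> sets (path_space \<Otimes>\<^sub>M lborel)"
    from measurable_sets[OF id this] show "X \<in> sigma_sets UNIV ?E" by (simp add: sS spS)
  qed
  show "sigma_sets UNIV ?E \<subseteq> sets (path_space \<Otimes>\<^sub>M (lborel :: real measure))"
    using sets.sigma_sets_subset[of ?E "path_space \<Otimes>\<^sub>M (lborel :: real measure)"] path_cylinder_measurable
    by (auto simp: space_path_time)
qed

text \<open>
  Smooth approximations of the indicator of a half line; the shift by \<open>\<surd>n\<close> makes the limit at the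
  end point equal to one.
\<close>

definition soft_indicator :: "nat \<Rightarrow> real \<Rightarrow> real \<Rightarrow> real" where
  "soft_indicator n c y = 1 / (1 + exp (real n * (y - c) - sqrt (real n)))"

lemma soft_indicator_bounds: "0 \<le> soft_indicator n c y" "soft_indicator n c y \<le> 1"
  by (simp_all add: soft_indicator_def add_pos_pos less_imp_le divide_le_eq_1)

lemma soft_indicator_tendsto: "(\<lambda>n. soft_indicator n c y) \<longlonglongrightarrow> of_bool (y \<le> c)"
proof -
  define d where "d = y - c"
  have "(\<lambda>n. 1 / (1 + exp (real n * d - sqrt (real n)))) \<longlonglongrightarrow> (if d \<le> 0 then 1 else 0)"
  proof (cases d "0::real" rule: linorder_cases)
    case less
    then have "(\<lambda>n. 1 / (1 + exp (real n * d - sqrt (real n)))) \<longlonglongrightarrow> 1" by real_asymp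
    then show ?thesis using less by simp
  next
    case equal
    have "(\<lambda>n. 1 / (1 + exp (- sqrt (real n)))) \<longlonglongrightarrow> 1" by real_asymp
    then show ?thesis using equal by simp
  next
    case greater
    then have "(\<lambda>n. 1 / (1 + exp (real n * d - sqrt (real n)))) \<longlonglongrightarrow> 0" by real_asymp
    then show ?thesis using greater by simp
  qed
  then show ?thesis by (auto simp: soft_indicator_def d_def)
qed

lemma C1_poly_soft_indicator: "i < k \<Longrightarrow> \<exists>f'. C1_poly k (\<lambda>x. soft_indicator n c (x i)) f'"
proof -
  assume i: "i < k"
  define e where "e y = exp (real n * (y - c) - sqrt (real n))" for y
  have e: "e y > 0" for y by (simp add: e_def)
  show ?thesis
  proof (rule exI, rule C1_poly_coord[OF i, where \<phi> = "soft_indicator n c" and \<phi>' = "\<lambda>y. - (real n * e y) / (1 + e y)\<^sup>2"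
        and C = 1 and p = 0 and D = "real n" and r = 0])
    show "(soft_indicator n c has_real_derivative - (real n * e y) / (1 + e y)\<^sup>2) (at y)" for y
    proof -
      have d: "(e has_real_derivative real n * e y) (at y)"
        unfolding e_def[abs_def] by (auto intro!: derivative_eq_intros)
      have "((\<lambda>y. 1 / (1 + e y)) has_real_derivative - (real n * e y) / (1 + e y)\<^sup>2) (at y)"
        using e[of y] by (auto intro!: derivative_eq_intros d simp: power2_eq_square)
      then show ?thesis by (simp add: soft_indicator_def[abs_def] e_def[abs_def])
    qed
    have "1 + e y \<noteq> 0" for y using e[of y] by linarith
    then show "continuous_on UNIV (\<lambda>y. - (real n * e y) / (1 + e y)\<^sup>2)"
      by (intro continuous_intros) (auto simp: e_def intro!: continuous_intros)
    show "\<bar>soft_indicator n c u\<bar> \<le> 1 * (1 + \<bar>u\<bar>) ^ 0" for u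
      using soft_indicator_bounds[of n c u] by simp
    show "\<bar>- (real n * e y) / (1 + e y)\<^sup>2\<bar> \<le> real n * (1 + \<bar>y\<bar>) ^ 0" for y
    proof -
      have "e y \<le> (1 + e y)\<^sup>2" using e[of y] by (simp add: power2_eq_square algebra_simps add_nonneg_nonneg less_imp_le)
      then have "real n * (e y / (1 + e y)\<^sup>2) \<le> real n * 1" using e[of y] by (intro mult_left_mono) (auto simp: divide_le_eq_1)
      then show ?thesis using e[of y] by (simp add: abs_mult abs_of_pos)
    qed
  qed
qed

lemma C1_poly_prod:
  assumes "finite I" "\<And>i. i \<in> I \<Longrightarrow> \<exists>f'. C1_poly k (f i) f'"
  shows "\<exists>f'. C1_poly k (\<lambda>x. \<Prod>i\<in>I. f i x) f'"
  using assms
proof (induction I)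
  case empty
  then show ?case using C1_poly_one by auto
next
  case (insert i I)
  then obtain f' g' where "C1_poly k (f i) f'" "C1_poly k (\<lambda>x. \<Prod>i\<in>I. f i x) g'" by blast
  from C1_poly_mult[OF this] show ?case using insert by auto
qed

context brownian_increments
begin

lemma smooth_functional_factors_through:
  assumes "smooth_functional M B F DF"
  shows "factors_through (M \<Otimes>\<^sub>M lborel) (path_space \<Otimes>\<^sub>M lborel) (path_time_map B) (case_prod DF)"
proof -
  obtain n :: nat and f a W where f: "smooth_poly_growth n f"
    and W: "\<And>i. i < n \<Longrightarrow> is_wiener_integral M B (a i) (W i)"
    and DF: "DF = (\<lambda>\<omega> r. \<Sum>j<n. partial_deriv j f (\<lambda>i. W i \<omega>) * a j r)"
    using assms unfolding smooth_functional_def by blast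
  note C = smooth_poly_growth_C1_poly[OF f]
  have B: "brownian_increments M B" by unfold_locales
  have "\<forall>i. \<exists>\<phi>. i < n \<longrightarrow> \<phi> \<in> borel_measurable path_space \<and> (AE \<omega> in M. W i \<omega> = \<phi> (path_map B \<omega>))"
    using wiener_integral_transport[OF B B W] by blast
  then obtain w where w: "\<And>i. i < n \<Longrightarrow> w i \<in> borel_measurable path_space"
    "\<And>i. i < n \<Longrightarrow> AE \<omega> in M. W i \<omega> = w i (path_map B \<omega>)"
    unfolding choice_iff by blast
  define w0 where "w0 i = (if i < n then w i else (\<lambda>p. 0))" for i
  have w0: "w0 i \<in> borel_measurable path_space" for i using w(1) by (simp add: w0_def)
  have ae: "AE \<omega> in M. \<forall>i<n. W i \<omega> = w0 i (path_map B \<omega>)"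
    using w(2) by (simp add: AE_all_countable w0_def)
  define \<upsilon> where "\<upsilon> z = (\<Sum>j<n. partial_deriv j f (\<lambda>i. w0 i (fst z)) * a j (snd z))" for z
  show ?thesis
    unfolding factors_through_def
  proof (rule bexI[of _ \<upsilon>])
    show "\<upsilon> \<in> borel_measurable (path_space \<Otimes>\<^sub>M lborel)"
      unfolding \<upsilon>_def[abs_def]
      by (intro borel_measurable_sum borel_measurable_times
          borel_measurable_continuous_coords[OF C1_polyD(4)[OF C]] measurable_compose[OF measurable_fst w0]
          measurable_compose[OF measurable_snd wiener_sq_integrable(4)[OF W]]) simp_all
    have "AE z in M \<Otimes>\<^sub>M lborel. \<forall>i<n. W i (fst z) = w0 i (path_map B (fst z))"
      by (rule AE_pair_fst[OF sigma_finite_lborel ae])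
    then show "AE z in M \<Otimes>\<^sub>M lborel. case_prod DF z = \<upsilon> (path_time_map B z)"
    proof eventually_elim
      case (elim z)
      have "partial_deriv j f (\<lambda>i. W i (fst z)) = partial_deriv j f (\<lambda>i. w0 i (path_map B (fst z)))" if "j < n" for j
        using elim by (intro C1_poly_gradient_depends[OF C that]) simp
      then show ?case by (simp add: DF \<upsilon>_def path_time_map_def case_prod_beta)
    qed
  qed
qed

lemma malliavin_derivative_factors_through:
  assumes "has_malliavin_derivative M B F u"
  shows "factors_through (M \<Otimes>\<^sub>M lborel) (path_space \<Otimes>\<^sub>M lborel) (path_time_map B) (case_prod u)"
proof -
  obtain Fs us where sm: "\<And>n. smooth_functional M B (Fs n) (us n)"
    and us: "L2_converges (M \<Otimes>\<^sub>M lborel) (\<lambda>n. case_prod (us n)) (case_prod u)"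
    using assms unfolding has_malliavin_derivative_def by blast
  show ?thesis by (rule factors_through_L2_limit[OF smooth_functional_factors_through[OF sm] us])
qed

text \<open>
  By duality the pairing of the derivative with \<open>G h\<close> depends on \<open>F\<close> only, for \<open>G\<close> a product of smooth
  functions of path values and \<open>h\<close> the indicator of an interval.  Letting these functions tend to
  indicators of half lines, the difference of two derivatives integrates to zero over all cylinders;
  it is a function of path and time, and the cylinders generate the \<open>\<sigma>\<close>-algebra on pairs of a path and a
  time.
\<close>

theorem malliavin_derivative_unique:
  assumes u: "has_malliavin_derivative M B F u" and v: "has_malliavin_derivative M B F v"
  shows "AE z in M \<Otimes>\<^sub>M lborel. case_prod u z = case_prod v z"
proof -
  let ?N = "M \<Otimes>\<^sub>M (lborel :: real measure)"
  let ?Q = "path_space \<Otimes>\<^sub>M (lborel :: real measure)"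
  define d where "d z = case_prod u z - case_prod v z" for z
  have squ: "sq_integrable ?N (case_prod u)"
    using u unfolding has_malliavin_derivative_def by (blast dest: L2_convergesD(2))
  have sqv: "sq_integrable ?N (case_prod v)"
    using v unfolding has_malliavin_derivative_def by (blast dest: L2_convergesD(2))
  have sqd: "sq_integrable ?N d" unfolding d_def[abs_def] by (rule sq_integrable_diff[OF squ sqv])
  note [measurable] = sq_integrable_measurable[OF sqd] process_measurable
  have path_meas[measurable]: "(\<lambda>\<omega>. path_map B \<omega> t) \<in> borel_measurable M" for t
    unfolding path_map_def by measurable
  obtain e where e: "\<And>t. is_wiener_integral M B (e t) (\<lambda>\<omega>. path_map B \<omega> t)"
    using wiener_integral_path by metis
  have ind: "is_wiener_integral M B (indicator {a<..b}) (\<lambda>\<omega>. B b \<omega> - B a \<omega>)" if "a \<le> b" for a b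
    by (rule wiener_integral_increment[OF that])
  have smooth_zero: "(\<integral>z. d z * (case z of (\<omega>, r) \<Rightarrow> (\<Prod>i<k. soft_indicator n (c i) (path_map B \<omega> (t i))) * indicator {a<..b} r) \<partial>?N) = 0"
    if ab: "a \<le> b" for n k :: nat and c t :: "nat \<Rightarrow> real" and a b
  proof -
    have "\<exists>g'. C1_poly k (\<lambda>x. \<Prod>i<k. soft_indicator n (c i) (x i)) g'"
      by (intro C1_poly_prod) (auto intro: C1_poly_soft_indicator)
    then obtain g' where g: "C1_poly k (\<lambda>x. \<Prod>i<k. soft_indicator n (c i) (x i)) g'" ..
    let ?T = "\<lambda>z. case z of (\<omega>, r) \<Rightarrow> (\<Prod>i<k. soft_indicator n (c i) (path_map B \<omega> (t i))) * indicator {a<..b} r"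
    have eq: "(\<integral>z. case_prod u z * ?T z \<partial>?N) = (\<integral>z. case_prod v z * ?T z \<partial>?N)"
      using malliavin_derivative_duality[OF u e g ind[OF ab]] malliavin_derivative_duality[OF v e g ind[OF ab]] by simp
    have "bounded_moments M (\<lambda>_::nat. \<lambda>\<omega>. \<Prod>i<k. soft_indicator n (c i) (path_map B \<omega> (t i)))"
      by (rule wiener_function_bounded_moments[OF e C1_polyD(2,3)[OF g] C1_polyD(1)[OF g]])
    then have sqT: "sq_integrable ?N ?T"
      by (intro sq_integrable_pair_product sigma_finite_measure_axioms sigma_finite_lborel
          wiener_sq_integrable(2)[OF ind[OF ab]]) (rule bounded_momentsD(4))
    show ?thesis
      unfolding d_def left_diff_distrib
      using eq sq_integrable_mult[OF squ sqT] sq_integrable_mult[OF sqv sqT] by simp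
  qed
  have dom: "integrable ?N (\<lambda>z. d z * indicator {a<..b} (snd z))" if "a \<le> b" for a b
  proof -
    have "sq_integrable ?N (\<lambda>(\<omega>, r). 1 * indicator {a<..b} r)"
      by (intro sq_integrable_pair_product sigma_finite_measure_axioms sigma_finite_lborel
          wiener_sq_integrable(2)[OF ind[OF that]]) (simp add: sq_integrable_def)
    from sq_integrable_mult[OF sqd this] show ?thesis by (simp add: case_prod_beta')
  qed
  have sharp: "integrable ?N (\<lambda>z. d z * indicator (path_cylinder J a b) (path_time_map B z)) \<and>
      (\<integral>z. d z * indicator (path_cylinder J a b) (path_time_map B z) \<partial>?N) = 0" if J: "finite J" for J a b
  proof (cases "a \<le> b")
    case False
    then have "path_cylinder J a b = {}" by (auto simp: path_cylinder_def)
    then show ?thesis by simp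
  next
    case True
    obtain f where f: "bij_betw f {0..<card J} J" using ex_bij_betw_nat_finite[OF J] by blast
    define k where "k = card J"
    have J': "J = f ` {..<k}" using f by (simp add: bij_betw_def k_def atLeast0LessThan)
    define t where "t i = fst (f i)" for i
    define c where "c i = snd (f i)" for i
    have cyl: "indicator (path_cylinder J a b) (path_time_map B z) =
        (\<Prod>i<k. of_bool (path_map B (fst z) (t i) \<le> c i)) * (indicator {a<..b} (snd z) :: real)" for z
    proof (cases "\<forall>i<k. path_map B (fst z) (t i) \<le> c i")
      case True
      then show ?thesis
        unfolding J' by (auto simp: path_cylinder_def path_time_map_def case_prod_beta t_def c_def indicator_def)
    next
      case False
      then have "(\<Prod>i<k. of_bool (path_map B (fst z) (t i) \<le> c i)) = (0::real)" by (intro prod_zero) auto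
      then show ?thesis
        using False unfolding J' by (auto simp: path_cylinder_def path_time_map_def case_prod_beta t_def c_def indicator_def)
    qed
    have [measurable]: "(\<lambda>z. path_map B (fst z) (t i)) \<in> borel_measurable ?N" for i
      by (rule measurable_compose[OF measurable_fst path_meas])
    define h where "h n z = d z * ((\<Prod>i<k. soft_indicator n (c i) (path_map B (fst z) (t i))) * indicator {a<..b} (snd z))" for n z
    have [measurable]: "soft_indicator n x \<in> borel_measurable borel" for n x
      unfolding soft_indicator_def[abs_def] by measurable
    have hm: "h n \<in> borel_measurable ?N" for n unfolding h_def[abs_def] by measurable
    have lim: "(\<lambda>n. h n z) \<longlonglongrightarrow> d z * indicator (path_cylinder J a b) (path_time_map B z)" for z
      unfolding h_def cyl by (intro tendsto_intros soft_indicator_tendsto)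
    have limm: "(\<lambda>z. d z * indicator (path_cylinder J a b) (path_time_map B z)) \<in> borel_measurable ?N"
      by (rule borel_measurable_LIMSEQ_real[OF lim hm])
    have bound: "norm (h n z) \<le> \<bar>d z * indicator {a<..b} (snd z)\<bar>" for n z
    proof -
      have "0 \<le> (\<Prod>i<k. soft_indicator n (c i) (path_map B (fst z) (t i)))" "(\<Prod>i<k. soft_indicator n (c i) (path_map B (fst z) (t i))) \<le> 1"
        by (auto intro!: prod_nonneg prod_le_1 simp: soft_indicator_bounds)
      then show ?thesis
        by (auto simp: h_def abs_mult indicator_def mult_left_le)
    qed
    note DCT = integral_dominated_convergence[where s = h and w = "\<lambda>z. \<bar>d z * indicator {a<..b} (snd z)\<bar>",
        OF limm hm integrable_abs[OF dom[OF True]] AE_I2[OF lim] AE_I2[OF bound]]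
      integrable_dominated_convergence[where s = h and w = "\<lambda>z. \<bar>d z * indicator {a<..b} (snd z)\<bar>",
        OF limm hm integrable_abs[OF dom[OF True]] AE_I2[OF lim] AE_I2[OF bound]]
    have "(\<integral>z. h n z \<partial>?N) = 0" for n
      using smooth_zero[OF True, of n c t k] by (simp add: h_def case_prod_beta')
    then have "(\<integral>z. d z * indicator (path_cylinder J a b) (path_time_map B z) \<partial>?N) = 0"
      using DCT(1) by (simp add: LIMSEQ_const_iff)
    then show ?thesis using DCT(2) by simp
  qed
  have "\<exists>w\<in>borel_measurable ?Q. AE z in ?N. d z = w (path_time_map B z)"
  proof -
    obtain \<phi> where \<phi>: "\<phi> \<in> borel_measurable ?Q" "AE z in ?N. case_prod u z = \<phi> (path_time_map B z)"
      using malliavin_derivative_factors_through[OF u] unfolding factors_through_def by blast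
    obtain \<psi> where \<psi>: "\<psi> \<in> borel_measurable ?Q" "AE z in ?N. case_prod v z = \<psi> (path_time_map B z)"
      using malliavin_derivative_factors_through[OF v] unfolding factors_through_def by blast
    have "AE z in ?N. d z = \<phi> (path_time_map B z) - \<psi> (path_time_map B z)"
      using \<phi>(2) \<psi>(2) by eventually_elim (simp add: d_def)
    then show ?thesis using \<phi>(1) \<psi>(1) by (intro bexI[of _ "\<lambda>p. \<phi> p - \<psi> p"]) auto
  qed
  then obtain w where w[measurable]: "w \<in> borel_measurable ?Q" and dw: "AE z in ?N. d z = w (path_time_map B z)" ..
  note T[measurable] = path_time_map_measurable
  define \<mu> where "\<mu> = distr ?N ?Q (path_time_map B)"
  have "AE p in \<mu>. w p = 0"
  proof (rule AE_zero_of_generator[where E = "{path_cylinder J a b | J a b. finite J}" and A = "\<lambda>n. path_cylinder {} (- real n) (real n)"])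
    show "w \<in> borel_measurable \<mu>" by (simp add: \<mu>_def)
    have "path_cylinder J a b \<inter> path_cylinder J' a' b' = path_cylinder (J \<union> J') (max a a') (min b b')" for J J' a b a' b'
      by (auto simp: path_cylinder_def)
    then show "Int_stable {path_cylinder J a b | J a b. finite J}"
      by (auto simp: Int_stable_def) (metis finite_UnI)
    have sp: "space \<mu> = UNIV" by (simp add: \<mu>_def space_path_time)
    show "{path_cylinder J a b | J a b. finite J} \<subseteq> Pow (space \<mu>)" by (simp add: sp)
    show "sets \<mu> = sigma_sets (space \<mu>) {path_cylinder J a b | J a b. finite J}"
      unfolding sp unfolding \<mu>_def sets_distr by (rule sets_path_time_generated)
    show "range (\<lambda>n. path_cylinder {} (- real n) (real n)) \<subseteq> {path_cylinder J a b | J a b. finite J}" by auto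
    have "\<exists>n. - real n < x \<and> x \<le> real n" for x :: real
    proof -
      obtain n where "\<bar>x\<bar> < real n" using reals_Archimedean2 by blast
      then show ?thesis by (intro exI[of _ n]) auto
    qed
    then show "(\<Union>n. path_cylinder {} (- real n) (real n)) = space \<mu>" by (auto simp: sp path_cylinder_def)
    fix X assume "X \<in> {path_cylinder J a b | J a b. finite J}"
    then obtain J a b where J: "finite J" and X: "X = path_cylinder J a b" by blast
    have [measurable]: "X \<in> sets ?Q" unfolding X by (rule path_cylinder_measurable[OF J])
    have m: "(\<lambda>z. w (path_time_map B z) * indicator X (path_time_map B z)) \<in> borel_measurable ?N" by measurable
    have m': "(\<lambda>z. w z * indicator X z) \<in> borel_measurable ?Q" by measurable
    have ae: "AE z in ?N. d z * indicator X (path_time_map B z) = w (path_time_map B z) * indicator X (path_time_map B z)"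
      using dw by eventually_elim simp
    have md: "(\<lambda>z. d z * indicator X (path_time_map B z)) \<in> borel_measurable ?N" by measurable
    have "integrable ?N (\<lambda>z. w (path_time_map B z) * indicator X (path_time_map B z))"
      using sharp[OF J, of a b] integrable_cong_AE[OF md m ae] by (simp add: X)
    then show "integrable \<mu> (\<lambda>z. w z * indicator X z)"
      unfolding \<mu>_def by (subst integrable_distr_eq[OF T m'])
    have "(\<integral>z. w z * indicator X z \<partial>\<mu>) = (\<integral>z. w (path_time_map B z) * indicator X (path_time_map B z) \<partial>?N)"
      unfolding \<mu>_def by (rule integral_distr[OF T m'])
    also have "\<dots> = (\<integral>z. d z * indicator X (path_time_map B z) \<partial>?N)"
      by (rule integral_cong_AE[OF m md]) (use ae in eventually_elim, rule sym)
    also have "\<dots> = 0" using sharp[OF J, of a b] by (simp add: X)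
    finally show "(\<integral>z. w z * indicator X z \<partial>\<mu>) = 0" .
  qed
  then have "AE z in ?N. w (path_time_map B z) = 0" unfolding \<mu>_def by (rule AE_distrD[OF T])
  with dw show ?thesis by eventually_elim (simp add: d_def case_prod_beta)
qed

end

section \<open>Affine changes of time\<close>

text \<open>
  \<open>T\<close> multiplies volumes by \<open>\<kappa>\<close>, so composition with \<open>T\<close> followed by multiplication with
  \<open>\<surd>\<kappa>\<close> is an isometry of mean-square spaces.
\<close>

definition scales_measure :: "'b measure \<Rightarrow> 'c measure \<Rightarrow> ('b \<Rightarrow> 'c) \<Rightarrow> real \<Rightarrow> bool" where
  "scales_measure N Q T \<kappa> \<longleftrightarrow> T \<in> measurable N Q \<and>
     (\<forall>f\<in>borel_measurable Q. (\<integral>\<^sup>+y. f y \<partial>Q) = ennreal \<kappa> * (\<integral>\<^sup>+x. f (T x) \<partial>N))"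

lemma L2_converges_scale:
  assumes T: "scales_measure N Q T \<kappa>" and \<kappa>: "\<kappa> > 0" and conv: "L2_converges Q fs f"
  shows "L2_converges N (\<lambda>n x. sqrt \<kappa> * fs n (T x)) (\<lambda>x. sqrt \<kappa> * f (T x))"
proof -
  have Tm: "T \<in> measurable N Q" using T by (simp add: scales_measure_def)
  have nn: "(\<integral>\<^sup>+x. ennreal ((sqrt \<kappa> * g (T x))\<^sup>2) \<partial>N) = (\<integral>\<^sup>+y. ennreal ((g y)\<^sup>2) \<partial>Q)"
    if g: "g \<in> borel_measurable Q" for g
  proof -
    have "(\<lambda>y. ennreal ((g y)\<^sup>2)) \<in> borel_measurable Q" using g by measurable
    then have "(\<integral>\<^sup>+y. ennreal ((g y)\<^sup>2) \<partial>Q) = ennreal \<kappa> * (\<integral>\<^sup>+x. ennreal ((g (T x))\<^sup>2) \<partial>N)"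
      using T by (simp add: scales_measure_def)
    also have "\<dots> = (\<integral>\<^sup>+x. ennreal \<kappa> * ennreal ((g (T x))\<^sup>2) \<partial>N)"
      using measurable_compose[OF Tm g] by (intro nn_integral_cmult[symmetric]) simp
    also have "\<dots> = (\<integral>\<^sup>+x. ennreal ((sqrt \<kappa> * g (T x))\<^sup>2) \<partial>N)"
      using \<kappa> by (intro nn_integral_cong) (simp add: power_mult_distrib ennreal_mult)
    finally show ?thesis by simp
  qed
  have int: "(\<integral>x. (sqrt \<kappa> * g (T x))\<^sup>2 \<partial>N) = (\<integral>y. (g y)\<^sup>2 \<partial>Q)" if g: "g \<in> borel_measurable Q" for g
    using nn[OF g] measurable_compose[OF Tm g] g by (simp add: integral_eq_nn_integral)
  have sq: "sq_integrable N (\<lambda>x. sqrt \<kappa> * g (T x))" if g: "sq_integrable Q g" for g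
  proof -
    have m: "g \<in> borel_measurable Q" using g by (simp add: sq_integrable_def)
    have "(\<integral>\<^sup>+y. ennreal ((g y)\<^sup>2) \<partial>Q) < \<infinity>" using g by (simp add: sq_integrable_def integrable_iff_bounded)
    then have "(\<integral>\<^sup>+x. ennreal ((sqrt \<kappa> * g (T x))\<^sup>2) \<partial>N) < \<infinity>" unfolding nn[OF m] .
    then show ?thesis
      using measurable_compose[OF Tm m] by (simp add: sq_integrable_def integrable_iff_bounded)
  qed
  note C = L2_convergesD[OF conv]
  show ?thesis
  proof (rule L2_convergesI)
    show "sq_integrable N (\<lambda>x. sqrt \<kappa> * fs n (T x))" for n by (rule sq[OF C(1)])
    show "sq_integrable N (\<lambda>x. sqrt \<kappa> * f (T x))" by (rule sq[OF C(2)])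
    have "(\<integral>x. (sqrt \<kappa> * fs n (T x) - sqrt \<kappa> * f (T x))\<^sup>2 \<partial>N) = (\<integral>y. (fs n y - f y)\<^sup>2 \<partial>Q)" for n
      using int[of "\<lambda>y. fs n y - f y"] sq_integrable_measurable[OF C(1)] sq_integrable_measurable[OF C(2)]
      by (simp add: right_diff_distrib)
    then show "(\<lambda>n. \<integral>x. (sqrt \<kappa> * fs n (T x) - sqrt \<kappa> * f (T x))\<^sup>2 \<partial>N) \<longlonglongrightarrow> 0"
      using C(3) by simp
  qed
qed

lemma scales_measure_lborel:
  assumes "c > 0"
  shows "scales_measure lborel lborel (\<lambda>r::real. c * r + a) c"
  unfolding scales_measure_def
proof (intro conjI ballI)
  show "(\<lambda>r::real. c * r + a) \<in> measurable lborel lborel" by simp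
  fix f :: "real \<Rightarrow> ennreal" assume "f \<in> borel_measurable lborel"
  then have "f \<in> borel_measurable borel" by simp
  from nn_integral_real_affine[OF this, of c a] assms
  show "(\<integral>\<^sup>+y. f y \<partial>lborel) = ennreal c * (\<integral>\<^sup>+x. f (c * x + a) \<partial>lborel)"
    by (simp add: add.commute[of a])
qed

lemma scales_measure_pair:
  assumes "c > 0"
  shows "scales_measure (M \<Otimes>\<^sub>M lborel) (M \<Otimes>\<^sub>M lborel) (\<lambda>(\<omega>, r::real). (\<omega>, c * r + a)) c"
  unfolding scales_measure_def
proof (intro conjI ballI)
  show T: "(\<lambda>(\<omega>, r::real). (\<omega>, c * r + a)) \<in> measurable (M \<Otimes>\<^sub>M lborel) (M \<Otimes>\<^sub>M lborel)" by measurable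
  fix f :: "'a \<times> real \<Rightarrow> ennreal" assume f[measurable]: "f \<in> borel_measurable (M \<Otimes>\<^sub>M lborel)"
  have fT: "(\<lambda>z. f (case z of (\<omega>, r) \<Rightarrow> (\<omega>, c * r + a))) \<in> borel_measurable (M \<Otimes>\<^sub>M lborel)"
    by (rule measurable_compose[OF T f])
  have inner: "(\<integral>\<^sup>+r. f (\<omega>, r) \<partial>lborel) = ennreal c * (\<integral>\<^sup>+r. f (\<omega>, c * r + a) \<partial>lborel)" if "\<omega> \<in> space M" for \<omega>
  proof -
    have "(\<lambda>r. f (\<omega>, r)) \<in> borel_measurable borel"
      using measurable_compose[OF measurable_Pair1'[OF that] f] by simp
    from nn_integral_real_affine[OF this, of c a] assms show ?thesis by (simp add: add.commute[of a])
  qed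
  have "(\<integral>\<^sup>+z. f z \<partial>(M \<Otimes>\<^sub>M lborel)) = (\<integral>\<^sup>+\<omega>. \<integral>\<^sup>+r. f (\<omega>, r) \<partial>lborel \<partial>M)"
    by (rule lborel.nn_integral_fst[symmetric]) fact
  also have "\<dots> = (\<integral>\<^sup>+\<omega>. ennreal c * (\<integral>\<^sup>+r. f (\<omega>, c * r + a) \<partial>lborel) \<partial>M)"
    by (intro nn_integral_cong inner)
  also have "\<dots> = ennreal c * (\<integral>\<^sup>+\<omega>. (\<integral>\<^sup>+r. f (case (\<omega>, r) of (\<omega>, r) \<Rightarrow> (\<omega>, c * r + a)) \<partial>lborel) \<partial>M)"
    using lborel.borel_measurable_nn_integral_fst[OF fT] by (subst nn_integral_cmult) simp_all
  also have "(\<integral>\<^sup>+\<omega>. (\<integral>\<^sup>+r. f (case (\<omega>, r) of (\<omega>, r) \<Rightarrow> (\<omega>, c * r + a)) \<partial>lborel) \<partial>M) =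
      (\<integral>\<^sup>+z. f (case z of (\<omega>, r) \<Rightarrow> (\<omega>, c * r + a)) \<partial>(M \<Otimes>\<^sub>M lborel))"
    by (rule lborel.nn_integral_fst[OF fT])
  finally show "(\<integral>\<^sup>+z. f z \<partial>(M \<Otimes>\<^sub>M lborel)) = ennreal c * (\<integral>\<^sup>+z. f (case z of (\<omega>, r) \<Rightarrow> (\<omega>, c * r + a)) \<partial>(M \<Otimes>\<^sub>M lborel))" .
qed

lemma scales_measure_PiM:
  assumes c: "c > 0" and "finite (I :: nat set)"
  shows "scales_measure (\<Pi>\<^sub>M j\<in>I. lborel) (\<Pi>\<^sub>M j\<in>I. lborel) (\<lambda>\<xi>. \<lambda>j\<in>I. c * \<xi> j + a :: real) (c ^ card I)"
  using assms(2)
proof (induction I)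
  case empty
  show ?case unfolding scales_measure_def by (auto simp: PiM_empty nn_integral_count_space_finite)
next
  case (insert i I)
  let ?P = "\<lambda>I. (\<Pi>\<^sub>M j\<in>I. lborel :: (nat \<Rightarrow> real) measure)"
  let ?T = "\<lambda>I. (\<lambda>\<xi>. \<lambda>j\<in>I. c * \<xi> j + a :: real)"
  have Tm: "?T J \<in> measurable (?P J) (?P J)" for J
    by (intro measurable_restrict) measurable
  show ?case
    unfolding scales_measure_def
  proof (intro conjI ballI)
    show "?T (insert i I) \<in> measurable (?P (insert i I)) (?P (insert i I))" by (rule Tm)
    fix f :: "(nat \<Rightarrow> real) \<Rightarrow> ennreal" assume f[measurable]: "f \<in> borel_measurable (?P (insert i I))"
    note fT = measurable_compose[OF Tm f]
    have m: "(\<lambda>y. f (x(i := y))) \<in> borel_measurable borel" if "x \<in> space (?P I)" for x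
      using measurable_compose[OF measurable_fun_upd[where I = "insert i I" and J = I and M = "\<lambda>_. lborel", OF _ measurable_const[OF that] measurable_ident] f]
      by auto
    have mg: "(\<lambda>x. \<integral>\<^sup>+y. f (x(i := c * y + a)) \<partial>lborel) \<in> borel_measurable (?P I)"
    proof -
      have "(\<lambda>z. f ((fst z)(i := c * snd z + a))) \<in> borel_measurable (?P I \<Otimes>\<^sub>M lborel)"
        by (rule measurable_compose[OF _ f]) (rule measurable_fun_upd[where J = I]; measurable)
      then have "(\<lambda>x. \<integral>\<^sup>+y. (\<lambda>z. f ((fst z)(i := c * snd z + a))) (x, y) \<partial>lborel) \<in> borel_measurable (?P I)"
        by (rule lborel.borel_measurable_nn_integral_fst)
      then show ?thesis by simp
    qed
    have upd: "(?T I x)(i := c * y + a) = ?T (insert i I) (x(i := y))" for x y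
      using insert(2) by (auto simp: fun_eq_iff restrict_def)
    have "(\<integral>\<^sup>+x. f x \<partial>?P (insert i I)) = (\<integral>\<^sup>+x. \<integral>\<^sup>+y. f (x(i := y)) \<partial>lborel \<partial>?P I)"
      by (rule lborel_product.product_nn_integral_insert[OF insert(1,2) f])
    also have "\<dots> = (\<integral>\<^sup>+x. ennreal c * (\<integral>\<^sup>+y. f (x(i := c * y + a)) \<partial>lborel) \<partial>?P I)"
      using nn_integral_real_affine[OF m, of _ c a] c by (intro nn_integral_cong) (simp add: add.commute[of a])
    also have "\<dots> = ennreal c * (\<integral>\<^sup>+x. \<integral>\<^sup>+y. f (x(i := c * y + a)) \<partial>lborel \<partial>?P I)"
      by (rule nn_integral_cmult[OF mg])
    also have "(\<integral>\<^sup>+x. \<integral>\<^sup>+y. f (x(i := c * y + a)) \<partial>lborel \<partial>?P I) =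
        ennreal (c ^ card I) * (\<integral>\<^sup>+x. \<integral>\<^sup>+y. f ((?T I x)(i := c * y + a)) \<partial>lborel \<partial>?P I)"
      using insert(3) mg unfolding scales_measure_def by blast
    also have "(\<integral>\<^sup>+x. \<integral>\<^sup>+y. f ((?T I x)(i := c * y + a)) \<partial>lborel \<partial>?P I) =
        (\<integral>\<^sup>+x. \<integral>\<^sup>+y. f (?T (insert i I) (x(i := y))) \<partial>lborel \<partial>?P I)"
      unfolding upd ..
    also have "\<dots> = (\<integral>\<^sup>+x. f (?T (insert i I) x) \<partial>?P (insert i I))"
      by (rule lborel_product.product_nn_integral_insert[OF insert(1,2) fT, symmetric])
    finally show "(\<integral>\<^sup>+x. f x \<partial>?P (insert i I)) =
        ennreal (c ^ card (insert i I)) * (\<integral>\<^sup>+x. f (?T (insert i I) x) \<partial>?P (insert i I))"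
      using insert(1,2) c by (simp add: ennreal_mult mult.assoc)
  qed
qed

definition affine_process :: "real \<Rightarrow> real \<Rightarrow> (real \<Rightarrow> 'a \<Rightarrow> real) \<Rightarrow> real \<Rightarrow> 'a \<Rightarrow> real" where
  "affine_process c a B t \<omega> = (B (c * t + a) \<omega> - B a \<omega>) / sqrt c"

lemma affine_process_increment:
  "affine_process c a B t \<omega> - affine_process c a B s \<omega> = (B (c * t + a) \<omega> - B (c * s + a) \<omega>) / sqrt c"
  by (simp add: affine_process_def diff_divide_distrib)

lemma brownian_increments_affine:
  assumes B: "brownian_increments M B" and c: "c > 0"
  shows "brownian_increments M (affine_process c a B)"
proof -
  interpret brownian_increments M B by fact
  note [measurable] = process_measurable
  show ?thesis
  proof (intro brownian_increments.intro brownian_increments_axioms.intro)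
    show "prob_space M" by unfold_locales
    show "affine_process c a B t \<in> borel_measurable M" for t
      unfolding affine_process_def[abs_def] by measurable
    show "distributed M lborel (\<lambda>\<omega>. affine_process c a B t \<omega> - affine_process c a B s \<omega>) (normal_density 0 (sqrt (t - s)))"
      if "s < t" for s t
    proof -
      have lt: "c * s + a < c * t + a" using that c by simp
      have "distributed M lborel (\<lambda>\<omega>. 0 + (1 / sqrt c) * (B (c * t + a) \<omega> - B (c * s + a) \<omega>))
          (normal_density (0 + (1 / sqrt c) * 0) (\<bar>1 / sqrt c\<bar> * sqrt ((c * t + a) - (c * s + a))))"
        using lt c by (intro normal_density_affine increment_normal) auto
      moreover have "\<bar>1 / sqrt c\<bar> * sqrt ((c * t + a) - (c * s + a)) = sqrt (t - s)"
      proof -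
        have "(c * t + a) - (c * s + a) = c * (t - s)" by (simp add: algebra_simps)
        then show ?thesis using c by (simp add: real_sqrt_mult)
      qed
      ultimately show ?thesis by (simp add: affine_process_increment)
    qed
    show "indep_vars (\<lambda>_. borel) (\<lambda>i \<omega>. affine_process c a B (\<tau> (Suc i)) \<omega> - affine_process c a B (\<tau> i) \<omega>) {..<n}"
      if "\<And>i. i < n \<Longrightarrow> \<tau> i < \<tau> (Suc i)" for n :: nat and \<tau> :: "nat \<Rightarrow> real"
      unfolding affine_process_increment
    proof (rule indep_vars_compose2[where Y = "\<lambda>_ x. x / sqrt c" and M' = "\<lambda>_. borel"])
      show "indep_vars (\<lambda>_. borel) (\<lambda>i \<omega>. B (c * \<tau> (Suc i) + a) \<omega> - B (c * \<tau> i + a) \<omega>) {..<n}"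
        using that c by (intro increments_independent[where \<tau> = "\<lambda>i. c * \<tau> i + a"]) simp
    qed simp
  qed
qed

lemma step_integral_affine:
  assumes "step_integral B h X" and c: "c > 0"
  shows "step_integral (affine_process c a B) (\<lambda>r. sqrt c * h (c * r + a)) X"
proof -
  obtain n :: nat and d x y where s: "\<forall>i<n. x i \<le> y i" "h = (\<lambda>r. \<Sum>i<n. d i * indicator {x i<..y i} r)"
    "X = (\<lambda>\<omega>. \<Sum>i<n. d i * (B (y i) \<omega> - B (x i) \<omega>))"
    using assms(1) unfolding step_integral_def by blast
  have ind: "indicator {(x i - a) / c<..(y i - a) / c} r = (indicator {x i<..y i} (c * r + a) :: real)" for i r
    using c by (auto simp: indicator_def field_simps)
  have inverse: "c * ((z - a) / c) + a = z" for z using c by simp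
  show ?thesis
    unfolding step_integral_def
  proof (intro exI conjI allI impI)
    show "(x i - a) / c \<le> (y i - a) / c" if "i < n" for i
      using s(1) that c by (simp add: divide_right_mono)
    show "(\<lambda>r. sqrt c * h (c * r + a)) = (\<lambda>r. \<Sum>i<n. (sqrt c * d i) * indicator {(x i - a) / c<..(y i - a) / c} r)"
      unfolding s(2) ind sum_distrib_left by (simp only: mult.assoc)
    show "X = (\<lambda>\<omega>. \<Sum>i<n. (sqrt c * d i) * (affine_process c a B ((y i - a) / c) \<omega> - affine_process c a B ((x i - a) / c) \<omega>))"
      unfolding s(3) affine_process_increment inverse using c by simp
  qed
qed

lemma wiener_integral_affine:
  assumes "is_wiener_integral M B h X" and c: "c > 0"
  shows "is_wiener_integral M (affine_process c a B) (\<lambda>r. sqrt c * h (c * r + a)) X"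
proof -
  obtain hs Xs where s: "\<forall>n. step_integral B (hs n) (Xs n)" "L2_converges lborel hs h" "L2_converges M Xs X"
    using assms(1) unfolding is_wiener_integral_def by blast
  show ?thesis
    unfolding is_wiener_integral_def
    by (intro exI[of _ "\<lambda>n r. sqrt c * hs n (c * r + a)"] exI[of _ Xs] conjI allI
        step_integral_affine[OF s(1)[rule_format] c] s(3) L2_converges_scale[OF scales_measure_lborel[OF c] c s(2)])
qed

text \<open>
  Tensor powers of \<open>h\<close> turn into tensor powers of \<open>r \<mapsto> \<surd>c h(c r + a)\<close>, again a unit vector, while the
  integrals themselves do not change.
\<close>

lemma chaos_affine:
  assumes B: "brownian_increments M B" and X: "chaos M B q f X u" and c: "c > 0"
  shows "chaos M (affine_process c a B) q (\<lambda>\<xi>. sqrt c ^ q * f (\<lambda>j\<in>{..<q}. c * \<xi> j + a)) X (\<lambda>\<omega> r. sqrt c * u \<omega> (c * r + a))"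
proof -
  interpret brownian_increments M B by fact
  obtain fs Xs Us where e: "\<forall>n. elementary_chaos M B q (fs n) (Xs n) (Us n)"
    and fs: "L2_converges (lborel_pow q) fs f" and Xs: "L2_converges M Xs X"
    and Us: "L2_converges (M \<Otimes>\<^sub>M lborel) (\<lambda>n. case_prod (Us n)) (case_prod u)"
    using X by (elim chaosE) (rule that)
  have elem: "elementary_chaos M (affine_process c a B) q (\<lambda>\<xi>. sqrt c ^ q * f (\<lambda>j\<in>{..<q}. c * \<xi> j + a)) X (\<lambda>\<omega> r. sqrt c * U \<omega> (c * r + a))"
    if e0: "elementary_chaos M B q f X U" for f X U
  proof -
    obtain m :: nat and d h W where
      W: "\<forall>i<m. is_wiener_integral M B (h i) (W i) \<and> (\<integral>r. (h i r)\<^sup>2 \<partial>lborel) = 1"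
      and f: "f = (\<lambda>\<xi>. \<Sum>i<m. d i * tensor_power q (h i) \<xi>)"
      and X: "X = (\<lambda>\<omega>. \<Sum>i<m. d i * hermite_poly q (W i \<omega>))"
      and U: "U = (\<lambda>\<omega> r. \<Sum>i<m. d i * (real q * hermite_poly (q - 1) (W i \<omega>) * h i r))"
      using e0 by (elim elementary_chaosE) (rule that)
    have norm: "(\<integral>r. (sqrt c * h i (c * r + a))\<^sup>2 \<partial>lborel) = 1" if "i < m" for i
    proof -
      have "(\<integral>r. (h i r)\<^sup>2 \<partial>lborel) = c * (\<integral>r. (h i (a + c * r))\<^sup>2 \<partial>lborel)"
        using lborel_integral_real_affine[of c "\<lambda>r. (h i r)\<^sup>2" a] c by simp
      then show ?thesis using W that c by (simp add: power_mult_distrib add.commute)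
    qed
    have tensor: "tensor_power q (\<lambda>r. sqrt c * h i (c * r + a)) \<xi> = sqrt c ^ q * tensor_power q (h i) (\<lambda>j\<in>{..<q}. c * \<xi> j + a)" for i \<xi>
      by (simp add: tensor_power_def prod.distrib)
    show ?thesis
      unfolding elementary_chaos_def
    proof (intro exI conjI allI impI)
      show "is_wiener_integral M (affine_process c a B) (\<lambda>r. sqrt c * h i (c * r + a)) (W i)" if "i < m" for i
        using W that by (intro wiener_integral_affine c) simp
      show "(\<integral>r. (sqrt c * h i (c * r + a))\<^sup>2 \<partial>lborel) = 1" if "i < m" for i by (rule norm[OF that])
      show "(\<lambda>\<xi>. sqrt c ^ q * f (\<lambda>j\<in>{..<q}. c * \<xi> j + a)) = (\<lambda>\<xi>. \<Sum>i<m. d i * tensor_power q (\<lambda>r. sqrt c * h i (c * r + a)) \<xi>)"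
        unfolding tensor f sum_distrib_left by (simp only: mult.left_commute)
      show "X = (\<lambda>\<omega>. \<Sum>i<m. d i * hermite_poly q (W i \<omega>))" by (rule X)
      show "(\<lambda>\<omega> r. sqrt c * U \<omega> (c * r + a)) =
          (\<lambda>\<omega> r. \<Sum>i<m. d i * (real q * hermite_poly (q - 1) (W i \<omega>) * (sqrt c * h i (c * r + a))))"
        unfolding U sum_distrib_left by (simp only: mult_ac)
    qed
  qed
  have "sqrt (c ^ q) = sqrt c ^ q" by (rule real_sqrt_power)
  moreover have "L2_converges (lborel_pow q) (\<lambda>n \<xi>. sqrt (c ^ q) * fs n (\<lambda>j\<in>{..<q}. c * \<xi> j + a)) (\<lambda>\<xi>. sqrt (c ^ q) * f (\<lambda>j\<in>{..<q}. c * \<xi> j + a))"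
    using scales_measure_PiM[OF c, of "{..<q}" a] c by (intro L2_converges_scale[OF _ _ fs]) auto
  ultimately have 1: "L2_converges (lborel_pow q) (\<lambda>n \<xi>. sqrt c ^ q * fs n (\<lambda>j\<in>{..<q}. c * \<xi> j + a)) (\<lambda>\<xi>. sqrt c ^ q * f (\<lambda>j\<in>{..<q}. c * \<xi> j + a))"
    by simp
  have 2: "L2_converges (M \<Otimes>\<^sub>M lborel) (\<lambda>n. case_prod (\<lambda>\<omega> r. sqrt c * Us n \<omega> (c * r + a))) (case_prod (\<lambda>\<omega> r. sqrt c * u \<omega> (c * r + a)))"
    using L2_converges_scale[OF scales_measure_pair[OF c] c Us, of a]
    by (simp add: case_prod_beta')
  show ?thesis by (rule chaosI[OF _ 1 Xs 2]) (use elem e in blast)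
qed

section \<open>The kernel of the Hermite process\<close>

text \<open>
  The diagonal \<open>\<xi> i = \<xi> j\<close> has null sections in the direction of coordinate \<open>i\<close>.
\<close>

lemma AE_distinct_coordinates:
  "AE \<xi> in lborel_pow q. \<forall>i<q. \<forall>j<q. i \<noteq> j \<longrightarrow> \<xi> i \<noteq> \<xi> j"
proof -
  have "AE \<xi> in lborel_pow q. \<xi> i \<noteq> \<xi> j" if ij: "i < q" "j < q" "i \<noteq> j" for i j
  proof -
    have [measurable]: "(\<lambda>\<xi>. \<xi> k) \<in> borel_measurable (lborel_pow q)" if "k < q" for k
      using measurable_component_singleton[of k "{..<q}" "\<lambda>_. lborel"] that by simp
    let ?X = "{\<xi> \<in> space (lborel_pow q). \<xi> i = \<xi> j}"
    have X: "?X \<in> sets (lborel_pow q)" using ij by measurable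
    have ins: "insert i ({..<q} - {i}) = {..<q}" using ij by auto
    have "emeasure (lborel_pow q) ?X = (\<integral>\<^sup>+\<xi>. indicator ?X \<xi> \<partial>lborel_pow q)" using X by simp
    also have "\<dots> = (\<integral>\<^sup>+\<xi>. (\<integral>\<^sup>+y. indicator ?X (\<xi>(i := y)) \<partial>lborel) \<partial>(\<Pi>\<^sub>M j\<in>{..<q} - {i}. lborel :: real measure))"
      using lborel_product.product_nn_integral_insert[of "{..<q} - {i}" i "indicator ?X"] X unfolding ins by simp
    also have "\<dots> \<le> (\<integral>\<^sup>+\<xi>. (\<integral>\<^sup>+y. indicator {\<xi> j} y \<partial>lborel) \<partial>(\<Pi>\<^sub>M j\<in>{..<q} - {i}. lborel :: real measure))"
      using ij by (intro nn_integral_mono) (auto simp: indicator_def)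
    also have "\<dots> = 0" by simp
    finally have "emeasure (lborel_pow q) ?X = 0" by simp
    with X have "?X \<in> null_sets (lborel_pow q)" by auto
    then show ?thesis by (rule AE_I') auto
  qed
  then have "\<forall>i. \<forall>j. i < q \<longrightarrow> j < q \<longrightarrow> i \<noteq> j \<longrightarrow> (AE \<xi> in lborel_pow q. \<xi> i \<noteq> \<xi> j)" by blast
  then show ?thesis by (simp add: AE_all_countable)
qed

lemma integrable_powr_translate:
  fixes \<alpha> m x y :: real
  assumes "\<alpha> > -1"
  shows "integrable lborel (\<lambda>s. indicator {x<..<y} s * pos_powr (s - m) \<alpha>)"
proof -
  define b where "b = max 0 (y - m)"
  have b: "0 \<le> b" by (simp add: b_def)
  have "(\<lambda>s. s powr \<alpha>) absolutely_integrable_on {0<..b}"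
    using integrable_on_powr_from_0'[OF assms b] by (subst absolutely_integrable_on_iff_nonneg) auto
  then have "integrable lborel (\<lambda>s. indicat_real {0<..b} s *\<^sub>R (s powr \<alpha>))"
    unfolding set_integrable_def by (subst (asm) integrable_completion) auto
  then have "integrable lborel (\<lambda>s. (\<lambda>s. indicat_real {0<..b} s *\<^sub>R (s powr \<alpha>)) (- m + 1 * s))"
    by (rule lborel_integrable_real_affine) simp
  then have base: "integrable lborel (\<lambda>s. indicat_real {0<..b} (s - m) * (s - m) powr \<alpha>)" by simp
  show ?thesis
  proof (rule Bochner_Integration.integrable_bound[OF base])
    show "(\<lambda>s. indicator {x<..<y} s * pos_powr (s - m) \<alpha>) \<in> borel_measurable lborel"
      unfolding pos_powr_def by measurable
    show "AE s in lborel. norm (indicator {x<..<y} s * pos_powr (s - m) \<alpha>) \<le> norm (indicat_real {0<..b} (s - m) * (s - m) powr \<alpha>)"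
      by (intro AE_I2) (auto simp: indicator_def pos_powr_def b_def)
  qed
qed

text \<open>
  If the coordinates are distinct, only the factor of the largest one is singular on the support of
  the product; the others are bounded there, since the exponent is negative.
\<close>

lemma interval_integrable_powr_product:
  fixes \<xi> :: "nat \<Rightarrow> real"
  assumes \<alpha>: "-1 < \<alpha>" "\<alpha> < 0" and q: "q \<ge> 1"
    and distinct: "\<forall>i<q. \<forall>j<q. i \<noteq> j \<longrightarrow> \<xi> i \<noteq> \<xi> j"
  shows "interval_lebesgue_integrable lborel (ereal x) (ereal y) (\<lambda>s. \<Prod>j<q. pos_powr (s - \<xi> j) \<alpha>)"
proof -
  let ?g = "\<lambda>s. \<Prod>j<q. pos_powr (s - \<xi> j) \<alpha>"
  have "0 \<in> {..<q}" using q by simp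
  then have "{..<q} \<noteq> {}" by blast
  then have "Max (\<xi> ` {..<q}) \<in> \<xi> ` {..<q}" by (intro Max_in) auto
  then obtain m where m: "m < q" "\<xi> m = Max (\<xi> ` {..<q})" by auto
  have le: "\<xi> j \<le> \<xi> m" if "j < q" for j unfolding m(2) using that by (intro Max_ge) auto
  then have lt: "\<xi> j < \<xi> m" if "j < q" "j \<noteq> m" for j
    using distinct m(1) that by (metis order_le_less)
  define K where "K = (\<Prod>j\<in>{..<q} - {m}. (\<xi> m - \<xi> j) powr \<alpha>)"
  have K: "K \<ge> 0" by (auto simp: K_def intro: prod_nonneg)
  have gm: "?g \<in> borel_measurable borel" unfolding pos_powr_def by measurable
  have bound: "\<bar>?g s\<bar> \<le> K * pos_powr (s - \<xi> m) \<alpha>" for s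
  proof (cases "s > \<xi> m")
    case True
    have "?g s = pos_powr (s - \<xi> m) \<alpha> * (\<Prod>j\<in>{..<q} - {m}. pos_powr (s - \<xi> j) \<alpha>)"
      using m(1) by (subst prod.remove[of _ m]) auto
    moreover have "(\<Prod>j\<in>{..<q} - {m}. pos_powr (s - \<xi> j) \<alpha>) \<le> K"
      unfolding K_def
    proof (intro prod_mono conjI)
      fix j assume j: "j \<in> {..<q} - {m}"
      show "0 \<le> pos_powr (s - \<xi> j) \<alpha>" by (simp add: pos_powr_def)
      show "pos_powr (s - \<xi> j) \<alpha> \<le> (\<xi> m - \<xi> j) powr \<alpha>"
        using lt[of j] j True \<alpha>(2) by (auto simp: pos_powr_def intro!: powr_mono2')
    qed
    moreover have "0 \<le> (\<Prod>j\<in>{..<q} - {m}. pos_powr (s - \<xi> j) \<alpha>)"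
      by (intro prod_nonneg) (simp add: pos_powr_def)
    moreover have "0 \<le> pos_powr (s - \<xi> m) \<alpha>" by (simp add: pos_powr_def)
    ultimately show ?thesis by (simp add: abs_mult mult_left_mono mult.commute[of K])
  next
    case False
    then have z: "pos_powr (s - \<xi> m) \<alpha> = 0" by (simp add: pos_powr_def)
    then have "?g s = 0" using m(1) by (intro prod_zero) auto
    then show ?thesis using z by simp
  qed
  have int: "integrable lborel (\<lambda>s. indicator {x<..<y} s * ?g s)" for x y
  proof (rule Bochner_Integration.integrable_bound[OF integrable_mult_right[OF integrable_powr_translate[OF \<alpha>(1)], of K x y "\<xi> m"]])
    show "(\<lambda>s. indicator {x<..<y} s * ?g s) \<in> borel_measurable lborel" using gm by measurable
    show "AE s in lborel. norm (indicator {x<..<y} s * ?g s) \<le> norm (K * (indicator {x<..<y} s * pos_powr (s - \<xi> m) \<alpha>))"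
    proof (rule AE_I2)
      fix s
      have "0 \<le> pos_powr (s - \<xi> m) \<alpha>" by (simp add: pos_powr_def)
      then show "norm (indicator {x<..<y} s * ?g s) \<le> norm (K * (indicator {x<..<y} s * pos_powr (s - \<xi> m) \<alpha>))"
        using bound[of s] K by (auto simp: indicator_def abs_mult)
    qed
  qed
  show ?thesis
    unfolding interval_lebesgue_integrable_def set_integrable_def using int by simp
qed

lemma interval_integral_affine:
  fixes g :: "real \<Rightarrow> real"
  assumes c: "c > 0"
  shows "(LBINT s=ereal a..ereal (c * t + a). g s) = c * (LBINT r=ereal 0..ereal t. g (c * r + a))"
proof -
  have set: "(\<integral>s. indicator {c * x + a<..<c * y + a} s * g s \<partial>lborel) = c * (\<integral>r. indicator {x<..<y} r * g (c * r + a) \<partial>lborel)" for x y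
  proof -
    have "indicator {c * x + a<..<c * y + a} (a + c * r) = (indicator {x<..<y} r :: real)" for r
      using c by (auto simp: indicator_def)
    then show ?thesis
      using lborel_integral_real_affine[of c "\<lambda>s. indicator {c * x + a<..<c * y + a} s * g s" a] c
      by (simp add: add.commute)
  qed
  show ?thesis
  proof (cases "0 \<le> t")
    case True
    then show ?thesis
      using set[of 0 t] c by (simp add: interval_lebesgue_integral_def set_lebesgue_integral_def)
  next
    case False
    then have "c * t < 0" using c by (simp add: mult_less_0_iff)
    then show ?thesis
      using set[of t 0] False by (simp add: interval_lebesgue_integral_def set_lebesgue_integral_def)
  qed
qed

lemma pos_powr_scale:
  assumes "c > 0"
  shows "pos_powr (c * x) \<alpha> = c powr \<alpha> * pos_powr x \<alpha>"
  using assms by (auto simp: pos_powr_def powr_mult zero_less_mult_iff)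

text \<open>
  Stationarity and self-similarity of the kernel: \<open>s \<mapsto> c s + a\<close> contributes a factor \<open>c\<close>, and each of
  the \<open>q\<close> factors of the integrand a factor \<open>c\<close> to the power \<open>H\<^sub>0 - 3/2\<close>; with the normalisation
  \<open>c\<^sup>q\<^sup>/\<^sup>2\<close> the total exponent is \<open>1 + q (H\<^sub>0 - 1) = H\<close>.
\<close>

lemma hermite_kernel_affine:
  assumes q: "q \<ge> 1" and H: "1/2 < H" "H < 1" and c: "c > 0"
    and distinct: "\<forall>i<q. \<forall>j<q. i \<noteq> j \<longrightarrow> \<xi> i \<noteq> \<xi> j"
  shows "sqrt c ^ q * (hermite_kernel H q (c * t + a) (\<lambda>j\<in>{..<q}. c * \<xi> j + a) - hermite_kernel H q a (\<lambda>j\<in>{..<q}. c * \<xi> j + a))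
    = c powr H * hermite_kernel H q t \<xi>"
proof -
  define \<alpha> where "\<alpha> = hermite_H0 H q - 3/2"
  have \<alpha>eq: "\<alpha> = (H - 1) / real q - 1/2" by (simp add: \<alpha>_def hermite_H0_def)
  have "(1 - H) / real q \<le> 1 - H" using q H by (simp add: divide_le_eq mult_left_le)
  moreover have "(H - 1) / real q = - ((1 - H) / real q)" using q by (simp add: field_simps)
  ultimately have "- (1/2) < (H - 1) / real q" using H by linarith
  moreover have "(H - 1) / real q < 0" using q H by (simp add: divide_less_0_iff)
  ultimately have \<alpha>: "-1 < \<alpha>" "\<alpha> < 0" unfolding \<alpha>eq by linarith+
  define \<eta> where "\<eta> = (\<lambda>j\<in>{..<q}. c * \<xi> j + a)"
  define g where "g s = (\<Prod>j<q. pos_powr (s - \<eta> j) \<alpha>)" for s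
  have "\<forall>i<q. \<forall>j<q. i \<noteq> j \<longrightarrow> \<eta> i \<noteq> \<eta> j" using distinct c by (simp add: \<eta>_def)
  from interval_integrable_powr_product[OF \<alpha> q this]
  have int: "interval_lebesgue_integrable lborel (ereal x) (ereal y) g" for x y
    unfolding g_def .
  have split: "(LBINT s=ereal 0..ereal a. g s) + (LBINT s=ereal a..ereal (c * t + a). g s) = (LBINT s=ereal 0..ereal (c * t + a). g s)"
  proof (rule interval_integral_sum)
    show "interval_lebesgue_integrable lborel (min (ereal 0) (min (ereal a) (ereal (c * t + a)))) (max (ereal 0) (max (ereal a) (ereal (c * t + a)))) g"
      using int[of "min 0 (min a (c * t + a))" "max 0 (max a (c * t + a))"] by (simp only: ereal_min ereal_max)
  qed
  have sub: "(LBINT s=ereal a..ereal (c * t + a). g s) = c * (LBINT r=ereal 0..ereal t. g (c * r + a))"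
    by (rule interval_integral_affine[OF c])
  have scale: "g (c * r + a) = c powr (real q * \<alpha>) * (\<Prod>j<q. pos_powr (r - \<xi> j) \<alpha>)" for r
  proof -
    have "g (c * r + a) = (\<Prod>j<q. c powr \<alpha> * pos_powr (r - \<xi> j) \<alpha>)"
      unfolding g_def
    proof (intro prod.cong refl)
      fix j assume "j \<in> {..<q}"
      then have "c * r + a - \<eta> j = c * (r - \<xi> j)" by (simp add: \<eta>_def algebra_simps)
      then show "pos_powr (c * r + a - \<eta> j) \<alpha> = c powr \<alpha> * pos_powr (r - \<xi> j) \<alpha>"
        by (simp add: pos_powr_scale[OF c])
    qed
    also have "\<dots> = (c powr \<alpha>) ^ q * (\<Prod>j<q. pos_powr (r - \<xi> j) \<alpha>)" by (simp add: prod.distrib)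
    also have "(c powr \<alpha>) ^ q = c powr (real q * \<alpha>)" using c by (simp add: powr_power mult.commute)
    finally show ?thesis .
  qed
  have diff: "(LBINT s=ereal 0..ereal (c * t + a). g s) - (LBINT s=ereal 0..ereal a. g s) =
      c * (c powr (real q * \<alpha>) * (LBINT r=ereal 0..ereal t. (\<Prod>j<q. pos_powr (r - \<xi> j) \<alpha>)))"
    unfolding split[symmetric] sub scale interval_lebesgue_integral_mult_right by simp
  have "hermite_kernel H q (c * t + a) \<eta> - hermite_kernel H q a \<eta> = c * c powr (real q * \<alpha>) * hermite_kernel H q t \<xi>"
    unfolding hermite_kernel_def \<alpha>_def[symmetric] g_def[symmetric]
    by (simp only: right_diff_distrib[symmetric] diff) (simp only: mult_ac)
  moreover have "sqrt c ^ q * (c * c powr (real q * \<alpha>)) = c powr H"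
  proof -
    have "sqrt c ^ q = c powr (real q / 2)"
      using c by (simp add: powr_half_sqrt[symmetric] powr_power)
    then have "sqrt c ^ q * (c * c powr (real q * \<alpha>)) = c powr (real q / 2) * (c powr 1 * c powr (real q * \<alpha>))"
      using c by simp
    also have "\<dots> = c powr (real q / 2 + (1 + real q * \<alpha>))" by (simp only: powr_add)
    also have "real q / 2 + (1 + real q * \<alpha>) = H" using q by (simp add: \<alpha>eq field_simps)
    finally show ?thesis .
  qed
  ultimately show ?thesis unfolding \<eta>_def by (simp add: mult.assoc[symmetric])
qed

section \<open>Stationarity and self-similarity\<close>

lemma equal_in_law_path_functionals:
  fixes \<kappa> :: "'i \<Rightarrow> (real \<Rightarrow> real) \<Rightarrow> real"
  assumes B1: "brownian_increments M B" and B2: "brownian_increments M B'"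
    and meas: "\<And>i. X i \<in> borel_measurable M" "\<And>i. Y i \<in> borel_measurable M" "\<And>i. \<kappa> i \<in> borel_measurable path_space"
    and X: "\<And>i. AE \<omega> in M. X i \<omega> = \<kappa> i (path_map B' \<omega>)" and Y: "\<And>i. AE \<omega> in M. Y i \<omega> = \<kappa> i (path_map B \<omega>)"
  shows "equal_in_law M X Y"
  unfolding equal_in_law_def
proof (intro conjI allI impI)
  show "X i \<in> borel_measurable M" "Y i \<in> borel_measurable M" for i by (rule meas)+
  fix J :: "'i set" assume J: "finite J"
  let ?P = "\<Pi>\<^sub>M j\<in>J. (borel :: real measure)"
  have law: "distr M ?P (\<lambda>\<omega>. \<lambda>j\<in>J. Z j \<omega>) = distr (distr M path_space (path_map B)) ?P (\<lambda>p. \<lambda>j\<in>J. \<kappa> j p)"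
    if B: "brownian_increments M B" and Z: "\<And>i. Z i \<in> borel_measurable M" "\<And>i. AE \<omega> in M. Z i \<omega> = \<kappa> i (path_map B \<omega>)"
    for B Z
  proof -
    note pm = brownian_increments.path_map_measurable[OF B]
    have k: "(\<lambda>p. \<lambda>j\<in>J. \<kappa> j p) \<in> measurable path_space ?P" by (intro measurable_restrict meas)
    have "AE \<omega> in M. \<forall>j\<in>J. Z j \<omega> = \<kappa> j (path_map B \<omega>)"
      using J Z(2) by (intro AE_finite_allI) auto
    then have "AE \<omega> in M. (\<lambda>j\<in>J. Z j \<omega>) = (\<lambda>j\<in>J. \<kappa> j (path_map B \<omega>))"
      by eventually_elim (simp cong: restrict_cong)
    then have "distr M ?P (\<lambda>\<omega>. \<lambda>j\<in>J. Z j \<omega>) = distr M ?P (\<lambda>\<omega>. \<lambda>j\<in>J. \<kappa> j (path_map B \<omega>))"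
      by (intro distr_cong_AE refl measurable_restrict Z(1) measurable_compose[OF pm meas(3)])
    also have "\<dots> = distr (distr M path_space (path_map B)) ?P (\<lambda>p. \<lambda>j\<in>J. \<kappa> j p)"
      by (subst distr_distr[OF k pm]) (simp add: comp_def)
    finally show ?thesis .
  qed
  show "distr M ?P (\<lambda>\<omega>. \<lambda>j\<in>J. X j \<omega>) = distr M ?P (\<lambda>\<omega>. \<lambda>j\<in>J. Y j \<omega>)"
    unfolding law[OF B2 meas(1) X] law[OF B1 meas(2) Y] path_law_unique[OF B1 B2] ..
qed

lemma inner_H_measurable:
  assumes "sigma_finite_measure M" "case_prod u \<in> borel_measurable (M \<Otimes>\<^sub>M lborel)" "case_prod v \<in> borel_measurable (M \<Otimes>\<^sub>M lborel)"
  shows "(\<lambda>\<omega>. inner_H (u \<omega>) (v \<omega>)) \<in> borel_measurable M"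
proof -
  have "(\<lambda>(\<omega>, r). u \<omega> r * v \<omega> r) \<in> borel_measurable (M \<Otimes>\<^sub>M lborel)"
    using borel_measurable_times[OF assms(2,3)] by (simp add: case_prod_beta')
  then show ?thesis
    unfolding inner_H_def by (intro sigma_finite_measure.borel_measurable_lebesgue_integral[OF sigma_finite_lborel])
qed

lemma inner_H_cong_AE:
  assumes "sigma_finite_measure M" "AE z in M \<Otimes>\<^sub>M lborel. case_prod u z = case_prod u' z" "AE z in M \<Otimes>\<^sub>M lborel. case_prod v z = case_prod v' z"
    and meas: "case_prod u \<in> borel_measurable (M \<Otimes>\<^sub>M lborel)" "case_prod v \<in> borel_measurable (M \<Otimes>\<^sub>M lborel)"
      "case_prod u' \<in> borel_measurable (M \<Otimes>\<^sub>M lborel)" "case_prod v' \<in> borel_measurable (M \<Otimes>\<^sub>M lborel)"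
  shows "AE \<omega> in M. inner_H (u \<omega>) (v \<omega>) = inner_H (u' \<omega>) (v' \<omega>)"
proof -
  interpret pair_sigma_finite M lborel
    using assms(1) sigma_finite_lborel by (rule pair_sigma_finite.intro)
  have "AE \<omega> in M. AE r in lborel. u \<omega> r = u' \<omega> r" using AE_pair[OF assms(2)] by simp
  moreover have "AE \<omega> in M. AE r in lborel. v \<omega> r = v' \<omega> r" using AE_pair[OF assms(3)] by simp
  ultimately show ?thesis
    using AE_space
  proof eventually_elim
    case (elim \<omega>)
    have sec: "w \<omega> \<in> borel_measurable lborel" if "case_prod w \<in> borel_measurable (M \<Otimes>\<^sub>M lborel)" for w :: "'a \<Rightarrow> real \<Rightarrow> real"
      using measurable_compose[OF measurable_Pair1'[OF elim(3)] that] by simp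
    show ?case
      unfolding inner_H_def
    proof (rule integral_cong_AE)
      show "AE r in lborel. u \<omega> r * v \<omega> r = u' \<omega> r * v' \<omega> r"
        using elim(1,2) by eventually_elim simp
    qed (use sec[OF meas(1)] sec[OF meas(2)] sec[OF meas(3)] sec[OF meas(4)] in simp_all)
  qed
qed

lemma chaos_measurable:
  assumes "chaos M B q f X u"
  shows "case_prod u \<in> borel_measurable (M \<Otimes>\<^sub>M lborel)" "f \<in> borel_measurable (lborel_pow q)"
  using assms unfolding chaos_def by (auto dest!: L2_convergesD(2) sq_integrable_measurable)

text \<open>
  The common core of both assertions.  The kernels \<open>k s\<close> become, up to the factor \<open>c\<^sup>H\<close>, the kernels
  of the Hermite process after an affine change of time.  Hence \<open>Y s / c\<^sup>H\<close> and its rescaled derivative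
  are functionals of the transformed Brownian motion, the same functionals as \<open>Z s\<close> and its derivative
  are of the original one, and the two Brownian motions have the same path law.
\<close>

lemma malliavin_covariance_affine:
  assumes B: "brownian_increments M B" and q: "q \<ge> 1" and H: "1/2 < H" "H < 1" and c: "c > 0"
    and Z: "\<And>s. chaos M B q (hermite_kernel H q s) (Z s) (DZ s)"
    and Y: "\<And>s. chaos M B q (k s) (Y s) (DY s)"
    and k: "\<And>s. AE \<xi> in lborel_pow q. sqrt c ^ q * k s (\<lambda>j\<in>{..<q}. c * \<xi> j + a) = c powr H * hermite_kernel H q s \<xi>"
  shows "equal_in_law M (\<lambda>(s, t) \<omega>. inner_H (DY s \<omega>) (DY t \<omega>)) (\<lambda>(s, t) \<omega>. c powr (2 * H) * inner_H (DZ s \<omega>) (DZ t \<omega>))"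
proof -
  interpret brownian_increments M B by fact
  define B' where "B' = affine_process c a B"
  have B': "brownian_increments M B'" unfolding B'_def by (rule brownian_increments_affine[OF B c])
  have sf: "sigma_finite_measure M" by (rule sigma_finite_measure_axioms)
  define \<gamma> where "\<gamma> = c powr (- H)"
  have \<gamma>: "\<gamma> * c powr H = 1" using c by (simp add: \<gamma>_def powr_minus)
  define V where "V s \<omega> r = \<gamma> * (sqrt c * DY s \<omega> (c * r + a))" for s \<omega> r
  have tr: "chaos M B' q (hermite_kernel H q s) (\<lambda>\<omega>. \<gamma> * Y s \<omega>) (V s)" for s
  proof (rule chaos_cong_kernel)
    show "chaos M B' q (\<lambda>\<xi>. \<gamma> * (sqrt c ^ q * k s (\<lambda>j\<in>{..<q}. c * \<xi> j + a))) (\<lambda>\<omega>. \<gamma> * Y s \<omega>) (V s)"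
      unfolding V_def[abs_def] B'_def by (rule chaos_cmult[OF chaos_affine[OF B Y c]])
    show "hermite_kernel H q s \<in> borel_measurable (lborel_pow q)" by (rule chaos_measurable(2)[OF Z])
    show "AE \<xi> in lborel_pow q. \<gamma> * (sqrt c ^ q * k s (\<lambda>j\<in>{..<q}. c * \<xi> j + a)) = hermite_kernel H q s \<xi>"
      using k[of s] by eventually_elim (simp add: mult.assoc[symmetric] \<gamma>)
  qed
  have "\<forall>s. \<exists>\<phi> \<upsilon>. \<upsilon> \<in> borel_measurable (path_space \<Otimes>\<^sub>M lborel) \<and>
      (AE z in M \<Otimes>\<^sub>M lborel. case_prod (DZ s) z = \<upsilon> (path_time_map B z)) \<and>
      chaos M B' q (hermite_kernel H q s) (\<lambda>\<omega>. \<phi> (path_map B' \<omega>)) (\<lambda>\<omega> r. \<upsilon> (path_map B' \<omega>, r))"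
    using chaos_transport[OF B B' Z] by blast
  then obtain \<phi> \<upsilon> where \<upsilon>: "\<And>s. \<upsilon> s \<in> borel_measurable (path_space \<Otimes>\<^sub>M lborel)"
    "\<And>s. AE z in M \<Otimes>\<^sub>M lborel. case_prod (DZ s) z = \<upsilon> s (path_time_map B z)"
    "\<And>s. chaos M B' q (hermite_kernel H q s) (\<lambda>\<omega>. \<phi> s (path_map B' \<omega>)) (\<lambda>\<omega> r. \<upsilon> s (path_map B' \<omega>, r))"
    unfolding choice_iff by blast
  have VU: "AE z in M \<Otimes>\<^sub>M lborel. case_prod (V s) z = case_prod (\<lambda>\<omega> r. \<upsilon> s (path_map B' \<omega>, r)) z" for s
    by (rule brownian_increments.chaos_unique(2)[OF B' tr \<upsilon>(3) q])
  define \<kappa> where "\<kappa> = (\<lambda>(s, t) p. c powr (2 * H) * inner_H (\<lambda>r. \<upsilon> s (p, r)) (\<lambda>r. \<upsilon> t (p, r)))"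
  have "inner_H (DY s \<omega>) (DY t \<omega>) = c powr (2 * H) * inner_H (V s \<omega>) (V t \<omega>)" for s t \<omega>
  proof -
    have "V s \<omega> r * V t \<omega> r = \<gamma>\<^sup>2 * (c * (DY s \<omega> (a + c * r) * DY t \<omega> (a + c * r)))" for r
    proof -
      have "V s \<omega> r * V t \<omega> r = \<gamma>\<^sup>2 * ((sqrt c * sqrt c) * (DY s \<omega> (a + c * r) * DY t \<omega> (a + c * r)))"
        by (simp add: V_def power2_eq_square mult_ac add.commute)
      then show ?thesis using c by simp
    qed
    then have "inner_H (V s \<omega>) (V t \<omega>) = \<gamma>\<^sup>2 * (c * (\<integral>r. DY s \<omega> (a + c * r) * DY t \<omega> (a + c * r) \<partial>lborel))"
      by (simp add: inner_H_def)
    also have "c * (\<integral>r. DY s \<omega> (a + c * r) * DY t \<omega> (a + c * r) \<partial>lborel) = inner_H (DY s \<omega>) (DY t \<omega>)"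
      using lborel_integral_real_affine[of c "\<lambda>r. DY s \<omega> r * DY t \<omega> r" a] c by (simp add: inner_H_def)
    finally have "c powr (2 * H) * inner_H (V s \<omega>) (V t \<omega>) = (c powr (2 * H) * \<gamma>\<^sup>2) * inner_H (DY s \<omega>) (DY t \<omega>)" by simp
    moreover have "c powr (2 * H) * \<gamma>\<^sup>2 = 1"
    proof -
      have "c powr (2 * H) = (c powr H)\<^sup>2" using c by (simp add: powr_power mult.commute)
      then show ?thesis using \<gamma> by (simp add: power_mult_distrib[symmetric] mult.commute)
    qed
    ultimately show ?thesis by simp
  qed
  then have DYV: "(\<lambda>(s, t) \<omega>. inner_H (DY s \<omega>) (DY t \<omega>)) = (\<lambda>(s, t) \<omega>. c powr (2 * H) * inner_H (V s \<omega>) (V t \<omega>))"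
    by (simp add: fun_eq_iff)
  show ?thesis
    unfolding DYV
  proof (rule equal_in_law_path_functionals[OF B B', where \<kappa> = \<kappa>])
    fix i :: "real \<times> real"
    obtain s t where i: "i = (s, t)" by (cases i)
    have mV: "case_prod (V s) \<in> borel_measurable (M \<Otimes>\<^sub>M lborel)" for s by (rule chaos_measurable(1)[OF tr])
    have mZ: "case_prod (DZ s) \<in> borel_measurable (M \<Otimes>\<^sub>M lborel)" for s by (rule chaos_measurable(1)[OF Z])
    have mU: "case_prod (\<lambda>\<omega> r. \<upsilon> s (path_map B' \<omega>, r)) \<in> borel_measurable (M \<Otimes>\<^sub>M lborel)" for s
      by (rule chaos_measurable(1)[OF \<upsilon>(3)])
    have mU': "case_prod (\<lambda>\<omega> r. \<upsilon> s (path_map B \<omega>, r)) \<in> borel_measurable (M \<Otimes>\<^sub>M lborel)" for s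
      using measurable_compose[OF path_time_map_measurable \<upsilon>(1)[of s]] by (simp add: path_time_map_def case_prod_beta')
    show "(case i of (s, t) \<Rightarrow> \<lambda>\<omega>. c powr (2 * H) * inner_H (V s \<omega>) (V t \<omega>)) \<in> borel_measurable M"
      unfolding i prod.case by (intro borel_measurable_times borel_measurable_const inner_H_measurable[OF sf mV mV])
    show "(case i of (s, t) \<Rightarrow> \<lambda>\<omega>. c powr (2 * H) * inner_H (DZ s \<omega>) (DZ t \<omega>)) \<in> borel_measurable M"
      unfolding i prod.case by (intro borel_measurable_times borel_measurable_const inner_H_measurable[OF sf mZ mZ])
    have "(\<lambda>(p, r). \<upsilon> s (p, r) * \<upsilon> t (p, r)) \<in> borel_measurable (path_space \<Otimes>\<^sub>M lborel)"
      using borel_measurable_times[OF \<upsilon>(1)[of s] \<upsilon>(1)[of t]] by (simp add: case_prod_beta')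
    then show "\<kappa> i \<in> borel_measurable path_space"
      unfolding i \<kappa>_def prod.case inner_H_def
      by (intro borel_measurable_times borel_measurable_const
          sigma_finite_measure.borel_measurable_lebesgue_integral[OF sigma_finite_lborel])
    have "AE \<omega> in M. inner_H (V s \<omega>) (V t \<omega>) = inner_H (\<lambda>r. \<upsilon> s (path_map B' \<omega>, r)) (\<lambda>r. \<upsilon> t (path_map B' \<omega>, r))"
      by (rule inner_H_cong_AE[OF sf VU VU mV mV mU mU])
    then show "AE \<omega> in M. (case i of (s, t) \<Rightarrow> \<lambda>\<omega>. c powr (2 * H) * inner_H (V s \<omega>) (V t \<omega>)) \<omega> = \<kappa> i (path_map B' \<omega>)"
      by eventually_elim (simp add: i \<kappa>_def)
    have ZU: "AE z in M \<Otimes>\<^sub>M lborel. case_prod (DZ s) z = case_prod (\<lambda>\<omega> r. \<upsilon> s (path_map B \<omega>, r)) z" for s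
      using \<upsilon>(2)[of s] by (simp add: path_time_map_def case_prod_beta')
    have "AE \<omega> in M. inner_H (DZ s \<omega>) (DZ t \<omega>) = inner_H (\<lambda>r. \<upsilon> s (path_map B \<omega>, r)) (\<lambda>r. \<upsilon> t (path_map B \<omega>, r))"
      by (rule inner_H_cong_AE[OF sf ZU ZU mZ mZ mU' mU'])
    then show "AE \<omega> in M. (case i of (s, t) \<Rightarrow> \<lambda>\<omega>. c powr (2 * H) * inner_H (DZ s \<omega>) (DZ t \<omega>)) \<omega> = \<kappa> i (path_map B \<omega>)"
      by eventually_elim (simp add: i \<kappa>_def)
  qed
qed

text \<open>
  Uniqueness identifies the chosen version of the derivative with the limit of the derivatives of the
  approximating integrals.
\<close>

lemma chaos_malliavin_D:
  assumes B: "brownian_increments M B" and X: "chaos M B q f X u"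
  shows "chaos M B q f X (malliavin_D M B X)"
proof -
  interpret brownian_increments M B by fact
  note hu = chaos_has_malliavin_derivative[OF X]
  have hD: "has_malliavin_derivative M B X (malliavin_D M B X)"
    unfolding malliavin_D_def by (rule someI[of "has_malliavin_derivative M B X", OF hu])
  have ae: "AE z in M \<Otimes>\<^sub>M lborel. case_prod u z = case_prod (malliavin_D M B X) z"
    by (rule malliavin_derivative_unique[OF hu hD])
  have m: "case_prod (malliavin_D M B X) \<in> borel_measurable (M \<Otimes>\<^sub>M lborel)"
    using hD unfolding has_malliavin_derivative_def
    by (blast dest: L2_convergesD(2) sq_integrable_measurable)
  obtain fs Xs Us where c: "\<forall>n. elementary_chaos M B q (fs n) (Xs n) (Us n)"
    "L2_converges (lborel_pow q) fs f" "L2_converges M Xs X"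
    "L2_converges (M \<Otimes>\<^sub>M lborel) (\<lambda>n. case_prod (Us n)) (case_prod u)"
    using X by (elim chaosE) (rule that)
  have "L2_converges (M \<Otimes>\<^sub>M lborel) (\<lambda>n. case_prod (Us n)) (case_prod (malliavin_D M B X))"
    by (rule L2_converges_cong_AE[OF c(4) _ m _ ae]) (use sq_integrable_measurable[OF L2_convergesD(1)[OF c(4)]] in auto)
  from chaosI[OF c(1-3) this] show ?thesis .
qed

theorem proposition5p1:
  fixes M :: "'a measure" and B Z :: "real \<Rightarrow> 'a \<Rightarrow> real" and q :: nat and H :: real
  assumes "complete_measure M"
    and "two_sided_brownian_motion M B"
    and "q \<ge> 1"
    and "1/2 < H" and "H < 1"
    and "is_hermite_process M B H q Z"
  shows
    "(\<forall>a::real. equal_in_law M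
        (\<lambda>(s, t) \<omega>. inner_H
           (\<lambda>r. malliavin_D M B (Z (s + a)) \<omega> r - malliavin_D M B (Z a) \<omega> r)
           (\<lambda>r. malliavin_D M B (Z (t + a)) \<omega> r - malliavin_D M B (Z a) \<omega> r))
        (\<lambda>(s, t) \<omega>. inner_H (malliavin_D M B (Z s) \<omega>) (malliavin_D M B (Z t) \<omega>))) \<and>
     (\<forall>c::real. c > 0 \<longrightarrow> equal_in_law M
        (\<lambda>(s, t) \<omega>. inner_H (malliavin_D M B (Z (c * s)) \<omega>) (malliavin_D M B (Z (c * t)) \<omega>))
        (\<lambda>(s, t) \<omega>. c powr (2 * H) *
           inner_H (malliavin_D M B (Z s) \<omega>) (malliavin_D M B (Z t) \<omega>)))"
proof (intro conjI allI impI)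
  have B: "brownian_increments M B" by (rule two_sided_brownian_motion_increments[OF assms(2)])
  have Z: "chaos M B q (hermite_kernel H q s) (Z s) (malliavin_D M B (Z s))" for s
  proof -
    have "is_multiple_integral M B q (hermite_kernel H q s) (Z s)"
      using assms(6) by (simp add: is_hermite_process_def)
    then obtain u where "chaos M B q (hermite_kernel H q s) (Z s) u"
      using brownian_increments.chaos_exists[OF B _ assms(3)] by blast
    then show ?thesis by (rule chaos_malliavin_D[OF B])
  qed
  note core = malliavin_covariance_affine[OF B assms(3-5)]
  have kernel: "AE \<xi> in lborel_pow q. sqrt c ^ q * (hermite_kernel H q (c * s + a) (\<lambda>j\<in>{..<q}. c * \<xi> j + a)
      - hermite_kernel H q a (\<lambda>j\<in>{..<q}. c * \<xi> j + a)) = c powr H * hermite_kernel H q s \<xi>"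
    if "c > 0" for c s a
    using AE_distinct_coordinates[of q]
    by eventually_elim (rule hermite_kernel_affine[OF assms(3-5) that])
  show "equal_in_law M
        (\<lambda>(s, t) \<omega>. inner_H
           (\<lambda>r. malliavin_D M B (Z (s + a)) \<omega> r - malliavin_D M B (Z a) \<omega> r)
           (\<lambda>r. malliavin_D M B (Z (t + a)) \<omega> r - malliavin_D M B (Z a) \<omega> r))
        (\<lambda>(s, t) \<omega>. inner_H (malliavin_D M B (Z s) \<omega>) (malliavin_D M B (Z t) \<omega>))" for a
  proof -
    have "equal_in_law M
        (\<lambda>(s, t) \<omega>. inner_H
           (\<lambda>r. malliavin_D M B (Z (s + a)) \<omega> r - malliavin_D M B (Z a) \<omega> r)
           (\<lambda>r. malliavin_D M B (Z (t + a)) \<omega> r - malliavin_D M B (Z a) \<omega> r))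
        (\<lambda>(s, t) \<omega>. 1 powr (2 * H) * inner_H (malliavin_D M B (Z s) \<omega>) (malliavin_D M B (Z t) \<omega>))"
    proof (rule core[where c = 1 and a = a and Z = Z
          and k = "\<lambda>s \<xi>. hermite_kernel H q (s + a) \<xi> - hermite_kernel H q a \<xi>"
          and Y = "\<lambda>s \<omega>. Z (s + a) \<omega> - Z a \<omega>", OF zero_less_one Z chaos_diff[OF Z Z]])
      show "AE \<xi> in lborel_pow q. sqrt 1 ^ q * (hermite_kernel H q (s + a) (\<lambda>j\<in>{..<q}. 1 * \<xi> j + a)
          - hermite_kernel H q a (\<lambda>j\<in>{..<q}. 1 * \<xi> j + a)) = 1 powr H * hermite_kernel H q s \<xi>" for s
        using kernel[of 1 s a] by simp
    qed
    then show ?thesis by simp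
  qed
  show "equal_in_law M
        (\<lambda>(s, t) \<omega>. inner_H (malliavin_D M B (Z (c * s)) \<omega>) (malliavin_D M B (Z (c * t)) \<omega>))
        (\<lambda>(s, t) \<omega>. c powr (2 * H) *
           inner_H (malliavin_D M B (Z s) \<omega>) (malliavin_D M B (Z t) \<omega>))" if c: "c > 0" for c
  proof (rule core[OF c Z Z])
    \<comment> \<open>The kernel at time zero vanishes, so the increment from zero is the kernel itself.\<close>
    have "hermite_kernel H q 0 \<xi> = 0" for \<xi> by (simp add: hermite_kernel_def)
    then show "AE \<xi> in lborel_pow q. sqrt c ^ q * hermite_kernel H q (c * s) (\<lambda>j\<in>{..<q}. c * \<xi> j + 0) = c powr H * hermite_kernel H q s \<xi>" for s
      using kernel[OF c, of s 0] by simp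
  qed
qed

end
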